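(* Let $(\mathcal Q,d,\mathcal E)$ be as in the context. Every energetic solution of $(\mathcal Q,d,\mathcal E)$ is a local solution, and every BV solution of $(\mathcal Q,d,\mathcal E)$ is a local solution.
   Context: Setting. $T>0$; $\mathcal Q$ is a finite-dimensional smooth manifold; $\mathcal E\in C^1([0,T]\times\mathcal Q)$ is real-valued, with differential $\mathrm D_q\mathcal E(t,q)\in \mathrm T_q^*\mathcal Q$ in $q$. $\mathcal R_1:\mathrm T\mathcal Q\to[0,\infty)$ is continuous and $\mathcal R_1(q,\cdot)$ is a norm on $\mathrm T_q\mathcal Q$ for every $q$. $\mathcal A(q_0,q_1)$ is the set of $y\in \mathrm{AC}([0,1],\mathcal Q)$ with $y(0)=q_0$, $y(1)=q_1$. The distance $d:\mathcal Q\times\mathcal Q\to[0,\infty)$ is $d(q_0,q_1)=\min\{\int_0^1\mathcal R_1(y(s),y'(s))\,\mathrm ds: y\in\mathcal A(q_0,q_1)\}$, and $(\mathcal Q,d)$ is assumed complete. For an absolutely continuous curve $q$, $|q'|(t):=\mathcal R_1(q(t),q'(t))$. The local slope is $|\partial_q\mathcal E|(t,q):=\sup_{v\in \mathrm T_q\mathcal Q\setminus\{0\}}\frac{\langle \mathrm D_q\mathcal E(t,q),v\rangle}{\mathcal R_1(q,v)}$. BV functions. $\mathrm{Var}(q,I)=\sup\sum_{j=1}^n d(q(\tau_{j-1}),q(\tau_j))$ over all $n$ and all $\tau_0<\dots<\tau_n$ in $I$; $\mathrm{BV}([0,T];\mathcal Q)$ is the set of everywhere-defined $q:[0,T]\to\mathcal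 Q$ with $\mathrm{Var}(q,[0,T])<\infty$. One-sided limits $q(t^\pm)$ exist, with $q(0^-)=q(0)$, $q(T^+)=q(T)$. $\mathrm C_q=\{t:q(t^-)=q(t)=q(t^+)\}$, $\mathrm J_q=[0,T]\setminus \mathrm C_q$. $V_q(t)=\mathrm{Var}(q,[0,t])$, and $\mu_q$ is the nonnegative Borel measure on $[0,T]$ given by the distributional derivative of $V_q$: $\mu_q([s,t])=V_q(t)-V_q(s)$ for $s\le t$ in $\mathrm C_q$, with atoms $\mu_q(\{t\})=d(q(t^-),q(t))+d(q(t),q(t^+))$ at $t\in \mathrm J_q$. Its diffuse part is $\mu_q^{\mathrm{co}}(A)=\mu_q(A\cap \mathrm C_q)$. Local solution: $q:[0,T]\to\mathcal Q$ such that (a1) $|\partial_q\mathcal E|(t,q(t))\le1$ for a.a. $t\in[0,T]$; (a2) for all $r<s$ in $[0,T]$, $\mathcal E(s,q(s))+\mathrm{Var}(q,[r,s])\le\mathcal E(r,q(r))+\int_r^s\partial_t\mathcal E(\tau,q(\tau))\,\mathrm d\tau$. Energetic solution: $q:[0,T]\to\mathcal Q$ such that for all $t\in[0,T]$: (S) $\mathcal E(t,q(t))\le\mathcal E(t,\tilde q)+d(q(t),\tilde q)$ for all $\tilde q\in\mathcal Q$; (E) $\mathcal E(t,q(t))+\mathrm{Var}(q,[0,t])=\mathcal E(0,q(0))+\int_0^t\partial_s\mathcal E(s,q(s))\,\mathrm ds$. Slope distance: $S_0(t;q_0,q_1)=\inf\{\int_0^1|\partial_q\mathcal E|(t,y(s))\,|y'|(s)\,\mathrm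 ds: y\in\mathcal A(q_0,q_1)\}$. For $0\le t_0\le t_1\le T$, $$\Sigma_0(q,[t_0,t_1])=\int_{t_0}^{t_1}|\partial_q\mathcal E|(r,q(r))\,\mu_q^{\mathrm{co}}(\mathrm dr)+S_0(t_0;q(t_0),q(t_0^+))+S_0(t_1;q(t_1^-),q(t_1))+\sum_{t\in \mathrm J_q\cap(t_0,t_1)}\big[S_0(t;q(t^-),q(t))+S_0(t;q(t),q(t^+))\big].$$ BV solution: $q\in \mathrm{BV}([0,T];\mathcal Q)$ is a BV solution of $(\mathcal Q,d,\mathcal E)$ if: (i) $\mathcal E(t_1,q(t_1))-\mathcal E(t_0,q(t_0))-\int_{t_0}^{t_1}\partial_t\mathcal E(t,q(t))\,\mathrm dt\le-\Sigma_0(q,[t_0,t_1])$ for $0\le t_0<t_1\le T$; (ii) $|\partial_q\mathcal E|(t,q(t))\le1$ for $t\in[0,T]\setminus \mathrm J_q$; (iii) $|\partial_q\mathcal E|(t,q(t))\ge1$ for $t$ in the support of $\mu_q$; (iv) for every $t\in \mathrm J_q$ there exist $y^t\in\mathcal A(q(t^-),q(t^+))$ and $\theta^t\in[0,1]$ with $y^t(\theta^t)=q(t)$, $|\partial_q\mathcal E|(t,y^t(\theta))\ge1$ for all $\theta\in[0,1]$, and $\mathcal E(t,q(t^+))-\mathcal E(t,q(t^-))=-\int_0^1|\partial_q\mathcal E|(t,y^t(\theta))\,|(y^t)'|(\theta)\,\mathrm d\theta$. *)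

theory Defs
  imports "HOL-Analysis.Analysis"
begin

section \<open>Smoothness and absolute continuity in Euclidean coordinates\<close>

text \<open>\<open>Ck_on k S f\<close> is \<open>k\<close>-fold continuous differentiability on an open set \<open>S\<close>, phrased through
  iterated directional derivatives.\<close>

primrec Ck_on :: "nat \<Rightarrow> 'a::real_normed_vector set \<Rightarrow> ('a \<Rightarrow> 'b::real_normed_vector) \<Rightarrow> bool" where
  "Ck_on 0 S f \<longleftrightarrow> continuous_on S f"
| "Ck_on (Suc k) S f \<longleftrightarrow> (\<forall>x\<in>S. f differentiable (at x)) \<and>
     (\<forall>v. Ck_on k S (\<lambda>x. frechet_derivative f (at x) v))"

definition smooth_on :: "'a::real_normed_vector set \<Rightarrow> ('a \<Rightarrow> 'b::real_normed_vector) \<Rightarrow> bool" where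
  "smooth_on S f \<longleftrightarrow> (\<forall>k. Ck_on k S f)"

text \<open>The derivative is taken within \<open>S\<close>, so that \<open>S\<close> may have a boundary, as
  \<open>{0..T} \<times> U\<close> has; there it is one-sided in time at \<open>0\<close> and \<open>T\<close>.\<close>

definition C1_on :: "'a::real_normed_vector set \<Rightarrow> ('a \<Rightarrow> 'b::real_normed_vector) \<Rightarrow> bool" where
  "C1_on S f \<longleftrightarrow> (\<exists>f'. (\<forall>x\<in>S. (f has_derivative f' x) (at x within S)) \<and>
                        (\<forall>v. continuous_on S (\<lambda>x. f' x v)))"

definition abs_continuous_on :: "real \<Rightarrow> real \<Rightarrow> (real \<Rightarrow> 'b::real_normed_vector) \<Rightarrow> bool" where
  "abs_continuous_on a b f \<longleftrightarrow>
    (\<forall>\<epsilon>>0. \<exists>\<delta>>0. \<forall>n l r.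
       (\<forall>i<n. a \<le> l i \<and> l i \<le> r i \<and> r i \<le> b) \<and>
       (\<forall>i<n. \<forall>j<n. i \<noteq> j \<longrightarrow> {l i<..<r i} \<inter> {l j<..<r j} = {}) \<and>
       (\<Sum>i<n::nat. r i - l i) < \<delta>
       \<longrightarrow> (\<Sum>i<n. norm (f (r i) - f (l i))) < \<epsilon>)"

definition measure_support :: "'a::topological_space measure \<Rightarrow> 'a set" where
  "measure_support M = {x. \<forall>U. open U \<longrightarrow> x \<in> U \<longrightarrow> emeasure M U > 0}"


section \<open>Smooth manifolds\<close>

text \<open>A chart is a pair \<open>(U, \<phi>)\<close> of an open domain \<open>U\<close> and a homeomorphism \<open>\<phi>\<close> of \<open>U\<close> onto an open
  subset of the model space \<open>'e\<close>; the values of \<open>\<phi>\<close> outside \<open>U\<close> are irrelevant.\<close>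

type_synonym ('q, 'e) chart = "'q set \<times> ('q \<Rightarrow> 'e)"

text \<open>A tangent vector at \<open>q\<close> is represented by the family of its coordinate vectors in all charts
  around \<open>q\<close>.\<close>

type_synonym ('q, 'e) tangent = "('q, 'e) chart \<Rightarrow> 'e"

locale smooth_manifold =
  fixes atlas :: "('q::{t2_space, second_countable_topology}, 'e::euclidean_space) chart set"
  assumes chart: "\<And>U \<phi>. (U, \<phi>) \<in> atlas \<Longrightarrow>
      open U \<and> open (\<phi> ` U) \<and> homeomorphism U (\<phi> ` U) \<phi> (inv_into U \<phi>)"
    and cover: "(\<Union>c\<in>atlas. fst c) = UNIV"
    and compatible: "\<And>U \<phi> V \<psi>. (U, \<phi>) \<in> atlas \<Longrightarrow> (V, \<psi>) \<in> atlas \<Longrightarrow>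
      smooth_on (\<phi> ` (U \<inter> V)) (\<psi> \<circ> inv_into U \<phi>)"
begin

definition charts_at :: "'q \<Rightarrow> ('q, 'e) chart set" where
  "charts_at q = {c \<in> atlas. q \<in> fst c}"

text \<open>Coordinate vectors in different charts are related by the derivative of the coordinate
  change. The value \<open>0\<close> at charts not around \<open>q\<close> is a normalisation, making the representation
  unique; vector space operations are the pointwise ones.\<close>

definition tangent_space :: "'q \<Rightarrow> ('q, 'e) tangent set" where
  "tangent_space q = {v. (\<forall>c. c \<notin> charts_at q \<longrightarrow> v c = 0) \<and>
     (\<forall>(U, \<phi>) \<in> charts_at q. \<forall>(V, \<psi>) \<in> charts_at q.
        v (V, \<psi>) = frechet_derivative (\<psi> \<circ> inv_into U \<phi>) (at (\<phi> q)) (v (U, \<phi>)))}"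

definition tangent_bundle :: "('q \<times> ('q, 'e) tangent) set" where
  "tangent_bundle = {(q, v). v \<in> tangent_space q}"

text \<open>The usual topology of the tangent bundle, for which the maps
  \<open>(q, v) \<mapsto> (\<phi> q, v (U, \<phi>))\<close> are homeomorphisms from the bundle over \<open>U\<close> onto \<open>\<phi> ` U \<times> UNIV\<close>.\<close>

definition tangent_topology :: "('q \<times> ('q, 'e) tangent) topology" where
  "tangent_topology = topology_generated_by
     {{(q, v) \<in> tangent_bundle. q \<in> U \<and> (\<phi> q, v (U, \<phi>)) \<in> W} | U \<phi> W.
        (U, \<phi>) \<in> atlas \<and> open W}"

definition ac_curves :: "(real \<Rightarrow> 'q) set" where
  "ac_curves = {y. continuous_on {0..1} y \<and>
     (\<forall>(U, \<phi>) \<in> atlas. \<forall>a b. 0 \<le> a \<longrightarrow> a \<le> b \<longrightarrow> b \<le> 1 \<longrightarrow> y ` {a..b} \<subseteq> U \<longrightarrow>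
        abs_continuous_on a b (\<phi> \<circ> y))}"

definition admissible :: "'q \<Rightarrow> 'q \<Rightarrow> (real \<Rightarrow> 'q) set" where
  "admissible q0 q1 = {y \<in> ac_curves. y 0 = q0 \<and> y 1 = q1}"

text \<open>The tangent vector \<open>y' s\<close> of a curve on \<open>[0,1]\<close>. It is meaningful where \<open>y\<close> is differentiable,
  hence for almost every \<open>s\<close> if \<open>y\<close> is absolutely continuous.\<close>

definition velocity :: "(real \<Rightarrow> 'q) \<Rightarrow> real \<Rightarrow> ('q, 'e) tangent" where
  "velocity y s = (\<lambda>c. if c \<in> charts_at (y s)
                       then vector_derivative (snd c \<circ> y) (at s within {0..1}) else 0)"

text \<open>The differential of \<open>f\<close> at \<open>q\<close> applied to \<open>v\<close>; for \<open>v \<in> tangent_space q\<close> it does not depend on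
  the chosen chart.\<close>

definition differential :: "('q \<Rightarrow> real) \<Rightarrow> 'q \<Rightarrow> ('q, 'e) tangent \<Rightarrow> real" where
  "differential f q v = (let c = (SOME c. c \<in> charts_at q) in
     frechet_derivative (f \<circ> inv_into (fst c) (snd c)) (at (snd c q)) (v c))"

end


section \<open>The Finsler distance\<close>

locale finsler_manifold = smooth_manifold atlas
  for atlas :: "('q::{t2_space, second_countable_topology}, 'e::euclidean_space) chart set" +
  fixes R1 :: "'q \<Rightarrow> ('q, 'e) tangent \<Rightarrow> real"
  assumes R1_continuous: "continuous_map tangent_topology euclideanreal (\<lambda>(q, v). R1 q v)"
    and R1_nonneg: "\<And>q v. v \<in> tangent_space q \<Longrightarrow> R1 q v \<ge> 0"
    and R1_eq_0_iff: "\<And>q v. v \<in> tangent_space q \<Longrightarrow> R1 q v = 0 \<longleftrightarrow> v = (\<lambda>_. 0)"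
    and R1_scaleR: "\<And>q v a. v \<in> tangent_space q \<Longrightarrow> R1 q (\<lambda>c. a *\<^sub>R v c) = \<bar>a\<bar> * R1 q v"
    and R1_triangle: "\<And>q v w. v \<in> tangent_space q \<Longrightarrow> w \<in> tangent_space q \<Longrightarrow>
        R1 q (\<lambda>c. v c + w c) \<le> R1 q v + R1 q w"
begin

definition speed :: "(real \<Rightarrow> 'q) \<Rightarrow> real \<Rightarrow> real" where
  "speed y s = R1 (y s) (velocity y s)"

text \<open>The infimum is in \<open>[0,\<infinity>]\<close>; it is finite as soon as \<open>admissible q0 q1 \<noteq> {}\<close>, since absolutely
  continuous curves have finite length.\<close>

definition d :: "'q \<Rightarrow> 'q \<Rightarrow> real" where
  "d q0 q1 = enn2real (INF y \<in> admissible q0 q1. \<integral>\<^sup>+s\<in>{0..1}. ennreal (speed y s) \<partial>lebesgue)"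

definition Var :: "(real \<Rightarrow> 'q) \<Rightarrow> real set \<Rightarrow> ereal" where
  "Var q I = (SUP (n, \<tau>) \<in> {(n::nat, \<tau>). (\<forall>j<n. \<tau> j < \<tau> (Suc j)) \<and> (\<forall>j\<le>n. \<tau> j \<in> I)}.
     ereal (\<Sum>j<n. d (q (\<tau> j)) (q (\<tau> (Suc j)))))"

end


section \<open>Rate-independent systems and their solutions\<close>

text \<open>A minimum over \<open>admissible q0 q1\<close> presupposes that this set is nonempty, i.e. that the
  manifold is connected. Curves \<open>q\<close> on \<open>[0,T]\<close> are total functions whose values outside \<open>[0,T]\<close>
  are never used.\<close>

locale rate_independent_system = finsler_manifold atlas R1
  for atlas :: "('q::{t2_space, second_countable_topology}, 'e::euclidean_space) chart set"
    and R1 :: "'q \<Rightarrow> ('q, 'e) tangent \<Rightarrow> real" +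
  fixes T :: real and E :: "real \<Rightarrow> 'q \<Rightarrow> real"
  assumes T_pos: "T > 0"
    and admissible_nonempty: "\<And>q0 q1. admissible q0 q1 \<noteq> {}"
    and complete: "Metric_space.mcomplete UNIV d"
    and E_C1: "\<And>U \<phi>. (U, \<phi>) \<in> atlas \<Longrightarrow>
        C1_on ({0..T} \<times> \<phi> ` U) (\<lambda>(t, x). E t (inv_into U \<phi> x))"
begin

definition dt_E :: "real \<Rightarrow> 'q \<Rightarrow> real" where
  "dt_E t q = vector_derivative (\<lambda>s. E s q) (at t within {0..T})"

text \<open>A real supremum: the set is nonempty, because \<open>'e\<close> has positive dimension, and bounded above.\<close>

definition slope :: "real \<Rightarrow> 'q \<Rightarrow> real" where
  "slope t q = (SUP v \<in> tangent_space q - {\<lambda>_. 0}. differential (E t) q v / R1 q v)"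

text \<open>In the next two definitions \<open>Var\<close> is extended real, so (a2) and (E) entail that it is finite
  on \<open>{0..T}\<close>. The integrands are then measurable and bounded on the intervals in question.\<close>

definition local_solution :: "(real \<Rightarrow> 'q) \<Rightarrow> bool" where
  "local_solution q \<longleftrightarrow>
     (AE t in lebesgue. t \<in> {0..T} \<longrightarrow> slope t (q t) \<le> 1) \<and>
     (\<forall>r s. 0 \<le> r \<longrightarrow> r < s \<longrightarrow> s \<le> T \<longrightarrow>
        ereal (E s (q s)) + Var q {r..s}
          \<le> ereal (E r (q r) + (LINT \<tau>:{r..s}|lebesgue. dt_E \<tau> (q \<tau>))))"

definition energetic_solution :: "(real \<Rightarrow> 'q) \<Rightarrow> bool" where
  "energetic_solution q \<longleftrightarrow> (\<forall>t\<in>{0..T}.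
     (\<forall>p. E t (q t) \<le> E t p + d (q t) p) \<and>
     ereal (E t (q t)) + Var q {0..t}
       = ereal (E 0 (q 0) + (LINT s:{0..t}|lebesgue. dt_E s (q s))))"

definition BV :: "(real \<Rightarrow> 'q) set" where
  "BV = {q. Var q {0..T} < \<infinity>}"

definition lim_left :: "(real \<Rightarrow> 'q) \<Rightarrow> real \<Rightarrow> 'q" where
  "lim_left q t = (if t \<le> 0 then q 0 else Lim (at_left t) q)"

definition lim_right :: "(real \<Rightarrow> 'q) \<Rightarrow> real \<Rightarrow> 'q" where
  "lim_right q t = (if t \<ge> T then q T else Lim (at_right t) q)"

definition cont_points :: "(real \<Rightarrow> 'q) \<Rightarrow> real set" where
  "cont_points q = {t\<in>{0..T}. lim_left q t = q t \<and> q t = lim_right q t}"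

definition jump_points :: "(real \<Rightarrow> 'q) \<Rightarrow> real set" where
  "jump_points q = {0..T} - cont_points q"

definition V :: "(real \<Rightarrow> 'q) \<Rightarrow> real \<Rightarrow> real" where
  "V q t = real_of_ereal (Var q {0..t})"

text \<open>The Lebesgue--Stieltjes measure of \<open>V q\<close>, extended by \<open>0\<close> to the left of \<open>0\<close> and by the constant
  \<open>V q T\<close> to the right of \<open>T\<close>, as a measure on \<open>\<real>\<close> concentrated on \<open>[0,T]\<close>.
  Since \<open>interval_measure\<close> needs a right-continuous function, \<open>V q\<close> is replaced by its right limit.
  Thus \<open>{s..t}\<close> has mass \<open>V q t - V q s\<close> for continuity points \<open>s \<le> t\<close>, and an atom \<open>{t}\<close> has mass
  \<open>V q (t+) - V q (t-) = d (q (t-)) (q t) + d (q t) (q (t+))\<close>.\<close>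

definition var_measure :: "(real \<Rightarrow> 'q) \<Rightarrow> real measure" where
  "var_measure q = interval_measure
     (\<lambda>t. if t < 0 then 0 else if t < T then Lim (at_right t) (V q) else V q T)"

definition diffuse_var_measure :: "(real \<Rightarrow> 'q) \<Rightarrow> real measure" where
  "diffuse_var_measure q = density (var_measure q) (indicator (cont_points q))"

definition slope_length :: "real \<Rightarrow> (real \<Rightarrow> 'q) \<Rightarrow> ennreal" where
  "slope_length t y = (\<integral>\<^sup>+s\<in>{0..1}. ennreal (slope t (y s) * speed y s) \<partial>lebesgue)"

definition S0 :: "real \<Rightarrow> 'q \<Rightarrow> 'q \<Rightarrow> ennreal" where
  "S0 t q0 q1 = (INF y \<in> admissible q0 q1. slope_length t y)"

definition Sigma0 :: "(real \<Rightarrow> 'q) \<Rightarrow> real \<Rightarrow> real \<Rightarrow> ennreal" where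
  "Sigma0 q t0 t1 =
     (\<integral>\<^sup>+r\<in>{t0..t1}. ennreal (slope r (q r)) \<partial>diffuse_var_measure q)
     + S0 t0 (q t0) (lim_right q t0) + S0 t1 (lim_left q t1) (q t1)
     + (\<Sum>\<^sub>\<infinity>t\<in>jump_points q \<inter> {t0<..<t1}.
          S0 t (lim_left q t) (q t) + S0 t (q t) (lim_right q t))"

definition BV_solution :: "(real \<Rightarrow> 'q) \<Rightarrow> bool" where
  "BV_solution q \<longleftrightarrow> q \<in> BV \<and>
     (\<forall>t0 t1. 0 \<le> t0 \<longrightarrow> t0 < t1 \<longrightarrow> t1 \<le> T \<longrightarrow>
        ereal (E t1 (q t1) - E t0 (q t0) - (LINT t:{t0..t1}|lebesgue. dt_E t (q t)))
          \<le> - enn2ereal (Sigma0 q t0 t1)) \<and>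
     (\<forall>t\<in>{0..T} - jump_points q. slope t (q t) \<le> 1) \<and>
     (\<forall>t\<in>measure_support (var_measure q). slope t (q t) \<ge> 1) \<and>
     (\<forall>t\<in>jump_points q. \<exists>y\<in>admissible (lim_left q t) (lim_right q t). \<exists>\<theta>\<in>{0..1}.
        y \<theta> = q t \<and> (\<forall>\<theta>'\<in>{0..1}. slope t (y \<theta>') \<ge> 1) \<and>
        ereal (E t (lim_right q t) - E t (lim_left q t)) = - enn2ereal (slope_length t y))"

end

end

theory Submission
  imports Defs
begin

text \<open>Both implications compare the variation of \<open>q\<close> with the energy that \<open>q\<close> dissipates.

\<^emph>\<open>Energetic solutions.\<close> Stability bounds the slope by \<open>1\<close> (\<open>stable_imp_slope_le_1\<close>): a short straight
segment in a chart that leaves \<open>q t\<close> in direction \<open>v\<close> costs at most its length, which to first order is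
\<open>R1 (q t) v\<close>, so no directional derivative of the energy exceeds the norm of the direction. The upper
energy estimate on \<open>{r..s}\<close> follows by subtracting the energy balance on \<open>{0..r}\<close> from that on \<open>{0..s}\<close>,
because the variation is superadditive (\<open>Var_le_V\<close>, \<open>Var_eq_V\<close>). Splitting the power integral needs
the power \<open>dt_E t (q t)\<close> to be integrable (\<open>dt_E_integrable\<close>): finite variation and completeness of the
distance give \<open>q\<close> one-sided limits everywhere and continuity outside a countable set, so the power is
measurable and bounded.

\<^emph>\<open>BV solutions.\<close> The energy inequality already contains \<open>Sigma0\<close>, so it suffices that the variation is
at most \<open>Sigma0\<close> (\<open>V_increment_le_Sigma0\<close>). On the diffuse part this holds because the slope is at least
\<open>1\<close> on the support of the variation measure. At a jump the infimum \<open>S0\<close> runs over all curves, along which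
the slope may be small. However, by the chain rule \<open>S0\<close> is at least the energy drop between the two points
(\<open>energy_drop_le_S0\<close>), while along the optimal transition the energy drop equals the slope length and the
slope is at least \<open>1\<close>; hence both halves of the transition have an energy drop of at least the distance of
their end points (\<open>d_le_slope_length_halves\<close>).

\<^emph>\<open>Foundations.\<close> The chain rule \<open>energy_chain_bound\<close>, and the fact that points of small distance are close
in the manifold (\<open>chart_ball_escape\<close>), rest on Lebesgue's theorem: an absolutely continuous function is
differentiable almost everywhere, and its increments are integrals of its derivative
(\<open>abs_continuous_on_differentiable_AE\<close>, \<open>abs_continuous_on_has_integral\<close>). It is derived from
monotone functions by means of the Vitali covering theorem.\<close>

section \<open>Lower integrals\<close>

text \<open>Length integrands such as \<open>slope t (y s) * speed y s\<close> have no evident measurability, and for them the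
nonnegative integral is a lower integral. Attaining it by a measurable minorant carries additivity over
sets and the affine substitution rule over to arbitrary integrands.\<close>

lemma nn_integral_attained:
  fixes f :: "'a \<Rightarrow> ennreal"
  obtains g where "g \<in> borel_measurable M" "\<And>x. g x \<le> f x"
    "integral\<^sup>N M g = integral\<^sup>N M f"
proof -
  let ?S = "{g. simple_function M g \<and> g \<le> f}"
  have ne: "?S \<noteq> {}"
    by (intro ex_in_conv[THEN iffD1] exI[of _ "\<lambda>_. 0"]) (auto simp: le_fun_def)
  obtain h :: "nat \<Rightarrow> ennreal" where h: "range h \<subseteq> integral\<^sup>S M ` ?S"
    "(SUP g\<in>?S. integral\<^sup>S M g) = (SUP n. h n)"
    using ennreal_SUP_countable_SUP[OF ne] by metis
  then have "\<forall>n. \<exists>g. g \<in> ?S \<and> integral\<^sup>S M g = h n" by (auto simp: image_iff subset_iff) metis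
  then obtain g where g: "\<And>n. g n \<in> ?S" "\<And>n. integral\<^sup>S M (g n) = h n" by metis
  let ?g = "\<lambda>x. SUP n. g n x"
  have meas: "?g \<in> borel_measurable M"
    using g(1) by (intro borel_measurable_SUP) (auto dest: borel_measurable_simple_function)
  have le: "?g x \<le> f x" for x
    using g by (auto intro!: SUP_least simp: le_fun_def)
  have "integral\<^sup>N M f = (SUP n. h n)" using h by (simp add: nn_integral_def)
  also have "\<dots> \<le> integral\<^sup>N M ?g"
  proof (rule SUP_least)
    fix n
    have "h n = integral\<^sup>N M (g n)" using g by (metis mem_Collect_eq nn_integral_eq_simple_integral)
    also have "\<dots> \<le> integral\<^sup>N M ?g" by (intro nn_integral_mono SUP_upper) auto
    finally show "h n \<le> integral\<^sup>N M ?g" .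
  qed
  finally have "integral\<^sup>N M ?g = integral\<^sup>N M f"
    using nn_integral_mono[of M ?g f] le by (intro antisym) auto
  with meas le show ?thesis by (rule that)
qed

lemma nn_integral_split_set:
  fixes f :: "'a \<Rightarrow> ennreal"
  assumes A: "A \<in> sets M" and B: "B \<in> sets M" and AB: "A \<inter> B = {}"
  shows "(\<integral>\<^sup>+x\<in>A \<union> B. f x \<partial>M) = (\<integral>\<^sup>+x\<in>A. f x \<partial>M) + (\<integral>\<^sup>+x\<in>B. f x \<partial>M)"
proof (rule antisym)
  note [measurable] = A B
  obtain g where [measurable]: "g \<in> borel_measurable M"
    and g: "\<And>x. g x \<le> f x * indicator (A \<union> B) x"
    "integral\<^sup>N M g = (\<integral>\<^sup>+x\<in>A \<union> B. f x \<partial>M)"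
    using nn_integral_attained[of M "\<lambda>x. f x * indicator (A \<union> B) x"] by blast
  have eq: "g x = g x * indicator A x + g x * indicator B x" for x
    using g(1)[of x] AB by (auto simp: indicator_def split: if_splits)
  have "integral\<^sup>N M g = (\<integral>\<^sup>+x. g x * indicator A x + g x * indicator B x \<partial>M)"
    using eq by (intro nn_integral_cong) auto
  also have "\<dots> = (\<integral>\<^sup>+x. g x * indicator A x \<partial>M) + (\<integral>\<^sup>+x. g x * indicator B x \<partial>M)"
    by (intro nn_integral_add) auto
  also have "\<dots> \<le> (\<integral>\<^sup>+x\<in>A. f x \<partial>M) + (\<integral>\<^sup>+x\<in>B. f x \<partial>M)"
  proof (intro add_mono nn_integral_mono)
    show "g x * indicator A x \<le> f x * indicator A x" "g x * indicator B x \<le> f x * indicator B x" for x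
      using g(1)[of x] by (auto simp: indicator_def split: if_splits)
  qed
  finally show "(\<integral>\<^sup>+x\<in>A \<union> B. f x \<partial>M) \<le> (\<integral>\<^sup>+x\<in>A. f x \<partial>M) + (\<integral>\<^sup>+x\<in>B. f x \<partial>M)"
    using g by simp
next
  obtain g where [measurable]: "g \<in> borel_measurable M"
    and g: "\<And>x. g x \<le> f x * indicator A x" "integral\<^sup>N M g = (\<integral>\<^sup>+x\<in>A. f x \<partial>M)"
    using nn_integral_attained[of M "\<lambda>x. f x * indicator A x"] by blast
  obtain h where [measurable]: "h \<in> borel_measurable M"
    and h: "\<And>x. h x \<le> f x * indicator B x" "integral\<^sup>N M h = (\<integral>\<^sup>+x\<in>B. f x \<partial>M)"
    using nn_integral_attained[of M "\<lambda>x. f x * indicator B x"] by blast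
  have le: "g x + h x \<le> f x * indicator (A \<union> B) x" for x
    using g(1)[of x] h(1)[of x] AB by (cases "x \<in> A"; cases "x \<in> B") auto
  have "integral\<^sup>N M g + integral\<^sup>N M h = (\<integral>\<^sup>+x. g x + h x \<partial>M)"
    by (intro nn_integral_add[symmetric]) auto
  also have "\<dots> \<le> (\<integral>\<^sup>+x\<in>A \<union> B. f x \<partial>M)" by (intro nn_integral_mono le)
  finally show "(\<integral>\<^sup>+x\<in>A. f x \<partial>M) + (\<integral>\<^sup>+x\<in>B. f x \<partial>M) \<le> (\<integral>\<^sup>+x\<in>A \<union> B. f x \<partial>M)"
    using g h by simp
qed

lemma nn_integral_Icc_split:
  fixes f :: "real \<Rightarrow> ennreal"
  assumes "a \<le> b" "b \<le> c"
  shows "(\<integral>\<^sup>+x\<in>{a..c}. f x \<partial>lebesgue) = (\<integral>\<^sup>+x\<in>{a..b}. f x \<partial>lebesgue) + (\<integral>\<^sup>+x\<in>{b..c}. f x \<partial>lebesgue)"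
proof -
  have "{a..c} = {a..b} \<union> {b<..c}" using assms by auto
  then have "(\<integral>\<^sup>+x\<in>{a..c}. f x \<partial>lebesgue) = (\<integral>\<^sup>+x\<in>{a..b}. f x \<partial>lebesgue) + (\<integral>\<^sup>+x\<in>{b<..c}. f x \<partial>lebesgue)"
    using nn_integral_split_set[of "{a..b}" lebesgue "{b<..c}" f] by (simp add: ivl_disj_int)
  also have "(\<integral>\<^sup>+x\<in>{b<..c}. f x \<partial>lebesgue) = (\<integral>\<^sup>+x\<in>{b..c}. f x \<partial>lebesgue)"
  proof (rule nn_integral_cong_AE)
    have "AE x in lebesgue. x \<noteq> b" by (rule AE_completion) (rule AE_lborel_singleton)
    then show "AE x in lebesgue. f x * indicator {b<..c} x = f x * indicator {b..c} x"
      by eventually_elim (auto simp: indicator_def)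
  qed
  finally show ?thesis .
qed

lemma nn_integral_affine:
  fixes f :: "real \<Rightarrow> ennreal"
  assumes c: "c \<noteq> 0"
  shows "(\<integral>\<^sup>+x. f x \<partial>lebesgue) = (\<integral>\<^sup>+x. ennreal \<bar>c\<bar> * f (t + c * x) \<partial>lebesgue)"
proof -
  have *: "(\<integral>\<^sup>+x. f x \<partial>lebesgue) \<le> (\<integral>\<^sup>+x. ennreal \<bar>c\<bar> * f (t + c * x) \<partial>lebesgue)"
    if c: "c \<noteq> 0" for f :: "real \<Rightarrow> ennreal" and c t :: real
  proof -
    obtain g where g: "g \<in> borel_measurable lebesgue" "\<And>x. g x \<le> f x"
      "integral\<^sup>N lebesgue g = integral\<^sup>N lebesgue f"
      using nn_integral_attained[of lebesgue f] by blast
    have "(\<lambda>x. g (t + c * x)) \<in> borel_measurable lebesgue"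
      using measurable_compose[OF lebesgue_affine_measurable[of "\<lambda>_. c" t] g(1)] c by simp
    then have "integral\<^sup>N lebesgue g = (\<integral>\<^sup>+x. ennreal \<bar>c\<bar> * g (t + c * x) \<partial>lebesgue)"
      unfolding nn_integral_real_affine_lebesgue[OF g(1) c, of t] by (intro nn_integral_cmult[symmetric])
    also have "\<dots> \<le> (\<integral>\<^sup>+x. ennreal \<bar>c\<bar> * f (t + c * x) \<partial>lebesgue)"
      by (intro nn_integral_mono mult_left_mono g) auto
    finally show ?thesis using g(3) by simp
  qed
  have "(\<integral>\<^sup>+x. ennreal \<bar>c\<bar> * f (t + c * x) \<partial>lebesgue)
      \<le> (\<integral>\<^sup>+x. ennreal \<bar>1/c\<bar> * (ennreal \<bar>c\<bar> * f (t + c * (-t/c + (1/c) * x))) \<partial>lebesgue)"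
    using c by (intro *) auto
  also have "(\<lambda>x. ennreal \<bar>1/c\<bar> * (ennreal \<bar>c\<bar> * f (t + c * (-t/c + (1/c) * x)))) = f"
  proof
    fix x
    have "t + c * (-t/c + (1/c) * x) = x" using c by (simp add: field_simps)
    then show "ennreal \<bar>1/c\<bar> * (ennreal \<bar>c\<bar> * f (t + c * (-t/c + (1/c) * x))) = f x"
      using c by (simp add: mult.assoc[symmetric] ennreal_mult[symmetric])
  qed
  finally show ?thesis using *[OF c] by (intro antisym) auto
qed

lemma nn_integral_mono_negligible:
  assumes N: "negligible N" and le: "\<And>x. x \<in> A - N \<Longrightarrow> f x \<le> g x"
  shows "(\<integral>\<^sup>+x\<in>A. f x \<partial>lebesgue) \<le> (\<integral>\<^sup>+x\<in>A. g x \<partial>lebesgue)"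
proof (rule nn_integral_mono_AE)
  have "AE x in lebesgue. x \<notin> N"
    using N by (intro AE_not_in) (simp add: negligible_iff_null_sets)
  then show "AE x in lebesgue. f x * indicator A x \<le> g x * indicator A x"
    by eventually_elim (use le in \<open>auto simp: indicator_def\<close>)
qed

lemma negligible_affine_vimage:
  fixes N :: "real set"
  assumes "negligible N" "c \<noteq> 0"
  shows "negligible {s. t + c * s \<in> N}"
proof -
  have "{s. t + c * s \<in> N} = (\<lambda>x. (x - t) / c) ` N"
    using assms(2) by (force simp: image_iff field_simps)
  moreover have "negligible ((\<lambda>x. (x - t) / c) ` N)"
    using assms(1)
    by (rule negligible_differentiable_image_negligible[rotated])
      (auto simp: differentiable_on_def intro!: derivative_intros differentiable_divide assms)
  ultimately show ?thesis by simp
qed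

section \<open>Absolutely continuous functions\<close>

text \<open>Names the families of intervals over which \<open>abs_continuous_on\<close> quantifies.\<close>

definition nonoverlapping :: "real \<Rightarrow> real \<Rightarrow> nat \<Rightarrow> (nat \<Rightarrow> real) \<Rightarrow> (nat \<Rightarrow> real) \<Rightarrow> bool" where
  "nonoverlapping a b n l r \<longleftrightarrow> (\<forall>i<n. a \<le> l i \<and> l i \<le> r i \<and> r i \<le> b) \<and>
     (\<forall>i<n. \<forall>j<n. i \<noteq> j \<longrightarrow> {l i<..<r i} \<inter> {l j<..<r j} = {})"

lemma abs_continuous_on_altdef:
  "abs_continuous_on a b f \<longleftrightarrow> (\<forall>\<epsilon>>0. \<exists>\<delta>>0. \<forall>n l r. nonoverlapping a b n l r \<longrightarrow>
     (\<Sum>i<n. r i - l i) < \<delta> \<longrightarrow> (\<Sum>i<n. norm (f (r i) - f (l i))) < \<epsilon>)"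
  unfolding abs_continuous_on_def nonoverlapping_def by (simp only: conj_assoc imp_conjL)

lemma nonoverlapping_mono:
  "nonoverlapping a b n l r \<Longrightarrow> a' \<le> a \<Longrightarrow> b \<le> b' \<Longrightarrow> nonoverlapping a' b' n l r"
  unfolding nonoverlapping_def by force

text \<open>Cutting every interval at \<open>m\<close> by \<open>min\<close> and \<open>max\<close>, instead of sorting the intervals into those left and
right of \<open>m\<close>, keeps the index set: an interval on the wrong side degenerates to \<open>{m}\<close> and contributes \<open>0\<close>.\<close>

lemma nonoverlapping_cut:
  assumes "nonoverlapping a b n l r" "a \<le> m" "m \<le> b"
  shows "nonoverlapping a m n (\<lambda>i. min (l i) m) (\<lambda>i. min (r i) m)"
    and "nonoverlapping m b n (\<lambda>i. max (l i) m) (\<lambda>i. max (r i) m)"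
proof -
  have "{min (l i) m<..<min (r i) m} \<inter> {min (l j) m<..<min (r j) m} \<subseteq> {l i<..<r i} \<inter> {l j<..<r j}"
    "{max (l i) m<..<max (r i) m} \<inter> {max (l j) m<..<max (r j) m} \<subseteq> {l i<..<r i} \<inter> {l j<..<r j}"
    for i j by (auto simp: min_def max_def split: if_splits)
  then have "{min (l i) m<..<min (r i) m} \<inter> {min (l j) m<..<min (r j) m} = {}"
    "{max (l i) m<..<max (r i) m} \<inter> {max (l j) m<..<max (r j) m} = {}" if "i < n" "j < n" "i \<noteq> j" for i j
    using that assms(1) unfolding nonoverlapping_def by blast+
  moreover have "a \<le> min (l i) m \<and> min (l i) m \<le> min (r i) m \<and> min (r i) m \<le> m"
    "m \<le> max (l i) m \<and> max (l i) m \<le> max (r i) m \<and> max (r i) m \<le> b" if "i < n" for i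
    using that assms unfolding nonoverlapping_def by (auto simp: min_def max_def)
  ultimately show "nonoverlapping a m n (\<lambda>i. min (l i) m) (\<lambda>i. min (r i) m)"
    "nonoverlapping m b n (\<lambda>i. max (l i) m) (\<lambda>i. max (r i) m)"
    unfolding nonoverlapping_def by simp_all
qed

lemma sum_cut:
  fixes f :: "real \<Rightarrow> 'b::real_normed_vector"
  assumes "\<forall>i<n. l i \<le> r i"
  shows "(\<Sum>i<n. norm (f (r i) - f (l i))) \<le>
    (\<Sum>i<n. norm (f (min (r i) m) - f (min (l i) m))) + (\<Sum>i<n. norm (f (max (r i) m) - f (max (l i) m)))"
proof -
  have "norm (f (r i) - f (l i)) \<le>
    norm (f (min (r i) m) - f (min (l i) m)) + norm (f (max (r i) m) - f (max (l i) m))" if "i < n" for i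
    using assms that norm_triangle_ineq[of "f (r i) - f m" "f m - f (l i)"]
    by (auto simp: min_def max_def)
  then show ?thesis unfolding sum.distrib[symmetric] by (intro sum_mono) auto
qed

lemma abs_continuous_on_subinterval:
  "abs_continuous_on a b f \<Longrightarrow> a \<le> a' \<Longrightarrow> b' \<le> b \<Longrightarrow> abs_continuous_on a' b' f"
  unfolding abs_continuous_on_altdef by (meson nonoverlapping_mono)

lemma abs_continuous_on_trans:
  fixes f :: "real \<Rightarrow> 'b::real_normed_vector"
  assumes 1: "abs_continuous_on a m f" and 2: "abs_continuous_on m b f" and am: "a \<le> m" "m \<le> b"
  shows "abs_continuous_on a b f"
  unfolding abs_continuous_on_altdef
proof (intro allI impI)
  fix e :: real assume "e > 0"
  then have e: "e/2 > 0" by simp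
  obtain d1 where d1: "d1 > 0" "\<And>n l r. nonoverlapping a m n l r \<Longrightarrow>
     (\<Sum>i<n. r i - l i) < d1 \<Longrightarrow> (\<Sum>i<n. norm (f (r i) - f (l i))) < e/2"
    using 1 e unfolding abs_continuous_on_altdef by meson
  obtain d2 where d2: "d2 > 0" "\<And>n l r. nonoverlapping m b n l r \<Longrightarrow>
     (\<Sum>i<n. r i - l i) < d2 \<Longrightarrow> (\<Sum>i<n. norm (f (r i) - f (l i))) < e/2"
    using 2 e unfolding abs_continuous_on_altdef by meson
  show "\<exists>d>0. \<forall>n l r. nonoverlapping a b n l r \<longrightarrow>
     (\<Sum>i<n. r i - l i) < d \<longrightarrow> (\<Sum>i<n. norm (f (r i) - f (l i))) < e"
  proof (intro exI[of _ "min d1 d2"] conjI allI impI)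
    fix n l r assume no: "nonoverlapping a b n l r" and s: "(\<Sum>i<n. r i - l i) < min d1 d2"
    have le: "\<forall>i<n. l i \<le> r i" using no by (auto simp: nonoverlapping_def)
    have "(\<Sum>i<n. min (r i) m - min (l i) m) \<le> (\<Sum>i<n. r i - l i)"
      "(\<Sum>i<n. max (r i) m - max (l i) m) \<le> (\<Sum>i<n. r i - l i)"
      using le by (auto intro!: sum_mono simp: min_def max_def)
    then have "(\<Sum>i<n. norm (f (min (r i) m) - f (min (l i) m))) < e/2"
      "(\<Sum>i<n. norm (f (max (r i) m) - f (max (l i) m))) < e/2"
      using s by (intro d1(2) d2(2) nonoverlapping_cut[OF no am]; linarith)+
    then show "(\<Sum>i<n. norm (f (r i) - f (l i))) < e"
      using sum_cut[OF le, of f m] by linarith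
  qed (use d1(1) d2(1) in auto)
qed

lemma abs_continuous_on_cong:
  assumes "abs_continuous_on a b f" "\<And>x. a \<le> x \<Longrightarrow> x \<le> b \<Longrightarrow> f x = g x"
  shows "abs_continuous_on a b g"
proof -
  have "(\<Sum>i<n. norm (f (r i) - f (l i))) = (\<Sum>i<n. norm (g (r i) - g (l i)))"
    if no: "nonoverlapping a b n l r" for n l r
  proof (rule sum.cong)
    fix i assume "i \<in> {..<n}"
    then have "a \<le> l i" "l i \<le> r i" "r i \<le> b" using no by (auto simp: nonoverlapping_def)
    then show "norm (f (r i) - f (l i)) = norm (g (r i) - g (l i))"
      using assms(2)[of "l i"] assms(2)[of "r i"] by simp
  qed simp
  then show ?thesis using assms(1) unfolding abs_continuous_on_altdef by metis
qed

lemma abs_continuous_on_dominated: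
  fixes f :: "real \<Rightarrow> 'b::real_normed_vector" and g :: "real \<Rightarrow> 'c::real_normed_vector"
  assumes f: "abs_continuous_on a b f"
    and le: "\<And>x y. a \<le> x \<Longrightarrow> x \<le> y \<Longrightarrow> y \<le> b \<Longrightarrow> norm (g y - g x) \<le> B * norm (f y - f x)"
  shows "abs_continuous_on a b g"
  unfolding abs_continuous_on_altdef
proof (intro allI impI)
  fix e :: real assume e: "e > 0"
  let ?B = "\<bar>B\<bar> + 1"
  have "e / ?B > 0" using e by auto
  then obtain d where d: "d > 0" "\<And>n l r. nonoverlapping a b n l r \<Longrightarrow>
     (\<Sum>i<n. r i - l i) < d \<Longrightarrow> (\<Sum>i<n. norm (f (r i) - f (l i))) < e / ?B"
    using f unfolding abs_continuous_on_altdef by meson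
  show "\<exists>d>0. \<forall>n l r. nonoverlapping a b n l r \<longrightarrow>
     (\<Sum>i<n. r i - l i) < d \<longrightarrow> (\<Sum>i<n. norm (g (r i) - g (l i))) < e"
  proof (intro exI[of _ d] conjI allI impI d)
    fix n l r assume no: "nonoverlapping a b n l r" and s: "(\<Sum>i<n. r i - l i) < d"
    have "(\<Sum>i<n. norm (g (r i) - g (l i))) \<le> (\<Sum>i<n. ?B * norm (f (r i) - f (l i)))"
    proof (rule sum_mono)
      fix i assume "i \<in> {..<n}"
      then have "norm (g (r i) - g (l i)) \<le> B * norm (f (r i) - f (l i))"
        using no le by (auto simp: nonoverlapping_def)
      also have "\<dots> \<le> ?B * norm (f (r i) - f (l i))" by (intro mult_right_mono) auto
      finally show "norm (g (r i) - g (l i)) \<le> ?B * norm (f (r i) - f (l i))" .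
    qed
    also have "\<dots> = ?B * (\<Sum>i<n. norm (f (r i) - f (l i)))" by (simp add: sum_distrib_left)
    also have "\<dots> < ?B * (e / ?B)" using d(2)[OF no s] by (intro mult_strict_left_mono) auto
    finally show "(\<Sum>i<n. norm (g (r i) - g (l i))) < e" by simp
  qed
qed

lemma abs_continuous_on_ident: "abs_continuous_on a b (\<lambda>x::real. x)"
proof -
  have "(\<Sum>i<n. norm (r i - l i)) = (\<Sum>i<n. r i - l i)" if "nonoverlapping a b n l r" for n l r
    using that by (intro sum.cong) (auto simp: nonoverlapping_def)
  then show ?thesis unfolding abs_continuous_on_altdef by metis
qed

lemma abs_continuous_on_lipschitz:
  fixes g :: "real \<Rightarrow> 'c::real_normed_vector"
  assumes "\<And>x y. a \<le> x \<Longrightarrow> x \<le> y \<Longrightarrow> y \<le> b \<Longrightarrow> norm (g y - g x) \<le> B * (y - x)"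
  shows "abs_continuous_on a b g"
  using assms by (intro abs_continuous_on_dominated[OF abs_continuous_on_ident, where B=B]) auto

lemma abs_continuous_on_const: "abs_continuous_on a b (\<lambda>_. c)"
  by (rule abs_continuous_on_lipschitz[where B=0]) auto

lemma abs_continuous_on_imp_continuous_on:
  assumes "abs_continuous_on a b f" shows "continuous_on {a..b} f"
  unfolding continuous_on_iff
proof (intro ballI allI impI)
  fix x e :: real assume x: "x \<in> {a..b}" and "e > 0"
  then obtain d where d: "d > 0" "\<And>n l r. nonoverlapping a b n l r \<Longrightarrow>
     (\<Sum>i<n. r i - l i) < d \<Longrightarrow> (\<Sum>i<n. norm (f (r i) - f (l i))) < e"
    using assms unfolding abs_continuous_on_altdef by meson
  show "\<exists>d>0. \<forall>y\<in>{a..b}. dist y x < d \<longrightarrow> dist (f y) (f x) < e"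
  proof (intro exI[of _ d] conjI ballI impI d)
    fix y assume y: "y \<in> {a..b}" "dist y x < d"
    show "dist (f y) (f x) < e"
      using d(2)[of 1 "\<lambda>_. min x y" "\<lambda>_. max x y"] x y
      by (cases "x \<le> y") (auto simp: nonoverlapping_def dist_norm min_def max_def norm_minus_commute)
  qed
qed

text \<open>Absolute continuity is additive over adjacent intervals, so the bisection principle \<open>Bolzano\<close> makes it a
local property. The same principle localises finiteness of length, regularity of curves, and the chain rule.\<close>

lemma abs_continuous_on_local:
  fixes f :: "real \<Rightarrow> 'b::real_normed_vector"
  assumes "a \<le> b" "\<And>x. a \<le> x \<Longrightarrow> x \<le> b \<Longrightarrow>
     \<exists>d>0. \<forall>u v. u \<le> x \<and> x \<le> v \<and> v - u < d \<and> a \<le> u \<and> v \<le> b \<longrightarrow> abs_continuous_on u v f"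
  shows "abs_continuous_on a b f"
proof -
  define P where "P u v \<longleftrightarrow> (a \<le> u \<and> v \<le> b \<longrightarrow> abs_continuous_on u v f)" for u v
  have "P a b"
    using assms(1)
  proof (induct rule: Bolzano)
    case (trans u m v) then show ?case using abs_continuous_on_trans[of u m f v] by (auto simp: P_def)
  next
    case (local x)
    then obtain d where "d > 0" "\<forall>u v. u \<le> x \<and> x \<le> v \<and> v - u < d \<and> a \<le> u \<and> v \<le> b \<longrightarrow> abs_continuous_on u v f"
      using assms(2)[of x] by blast
    then show ?case by (intro exI[of _ d]) (auto simp: P_def)
  qed
  then show ?thesis by (simp add: P_def)
qed

lemma abs_continuous_on_affine:
  fixes f :: "real \<Rightarrow> 'b::real_normed_vector"
  assumes f: "abs_continuous_on a b f" and c: "c \<noteq> 0"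
    and ab: "\<And>x. a' \<le> x \<Longrightarrow> x \<le> b' \<Longrightarrow> a \<le> t + c * x \<and> t + c * x \<le> b"
  shows "abs_continuous_on a' b' (\<lambda>x. f (t + c * x))"
  unfolding abs_continuous_on_altdef
proof (intro allI impI)
  fix e :: real assume e: "e > 0"
  then obtain d where d: "d > 0" "\<And>n l r. nonoverlapping a b n l r \<Longrightarrow>
     (\<Sum>i<n. r i - l i) < d \<Longrightarrow> (\<Sum>i<n. norm (f (r i) - f (l i))) < e"
    using f unfolding abs_continuous_on_altdef by meson
  show "\<exists>d>0. \<forall>n l r. nonoverlapping a' b' n l r \<longrightarrow>
     (\<Sum>i<n. r i - l i) < d \<longrightarrow> (\<Sum>i<n. norm (f (t + c * r i) - f (t + c * l i))) < e"
  proof (intro exI[of _ "d / \<bar>c\<bar>"] conjI allI impI)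
    fix n l r assume no: "nonoverlapping a' b' n l r" and s: "(\<Sum>i<n. r i - l i) < d / \<bar>c\<bar>"
    define l' r' where "l' i = min (t + c * l i) (t + c * r i)" and "r' i = max (t + c * l i) (t + c * r i)" for i
    have inv: "l i < (x - t) / c \<and> (x - t) / c < r i" if "l' i < x" "x < r' i" "l i \<le> r i" for x i
    proof (cases "c > 0")
      case True
      then have "c * l i \<le> c * r i" using that by simp
      then have "c * l i < x - t" "x - t < c * r i" using that unfolding l'_def r'_def by linarith+
      then show ?thesis using True by (simp add: field_simps)
    next
      case False
      then have c0: "c < 0" using c by simp
      then have "c * r i \<le> c * l i" using that by simp
      then have "c * r i < x - t" "x - t < c * l i" using that unfolding l'_def r'_def by linarith+
      then show ?thesis using c0 by (simp add: field_simps)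
    qed
    have "nonoverlapping a b n l' r'"
      unfolding nonoverlapping_def
    proof (intro conjI allI impI)
      fix i assume i: "i < n"
      then have "a' \<le> l i" "l i \<le> r i" "r i \<le> b'" using no by (auto simp: nonoverlapping_def)
      then show "a \<le> l' i" "l' i \<le> r' i" "r' i \<le> b"
        using ab[of "l i"] ab[of "r i"] by (auto simp: l'_def r'_def)
    next
      fix i j assume ij: "i < n" "j < n" "i \<noteq> j"
      then have 1: "{l i<..<r i} \<inter> {l j<..<r j} = {}" "l i \<le> r i" "l j \<le> r j"
        using no by (auto simp: nonoverlapping_def)
      show "{l' i<..<r' i} \<inter> {l' j<..<r' j} = {}"
      proof (rule equals0I)
        fix x assume "x \<in> {l' i<..<r' i} \<inter> {l' j<..<r' j}"
        then have "(x - t) / c \<in> {l i<..<r i} \<inter> {l j<..<r j}"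
          using inv[of i x] inv[of j x] 1(2,3) by simp
        then show False using 1(1) by blast
      qed
    qed
    moreover have "(\<Sum>i<n. r' i - l' i) < d"
    proof -
      have "(\<Sum>i<n. r' i - l' i) = (\<Sum>i<n. \<bar>c\<bar> * (r i - l i))"
      proof (rule sum.cong)
        fix i assume "i \<in> {..<n}"
        then have "l i \<le> r i" using no by (auto simp: nonoverlapping_def)
        then show "r' i - l' i = \<bar>c\<bar> * (r i - l i)"
          using c mult_left_mono[of "l i" "r i" c] mult_left_mono_neg[of "l i" "r i" c]
          unfolding l'_def r'_def right_diff_distrib by linarith
      qed simp
      also have "\<dots> = \<bar>c\<bar> * (\<Sum>i<n. r i - l i)" by (simp add: sum_distrib_left)
      also have "\<dots> < d" using s c by (simp add: field_simps)
      finally show ?thesis .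
    qed
    ultimately have "(\<Sum>i<n. norm (f (r' i) - f (l' i))) < e" by (rule d)
    also have "(\<Sum>i<n. norm (f (r' i) - f (l' i))) = (\<Sum>i<n. norm (f (t + c * r i) - f (t + c * l i)))"
      by (intro sum.cong) (auto simp: l'_def r'_def min_def max_def norm_minus_commute)
    finally show "(\<Sum>i<n. norm (f (t + c * r i) - f (t + c * l i))) < e" .
  qed (use d(1) c in auto)
qed

lemma nonoverlapping_length_le:
  assumes no: "nonoverlapping a b n l r" and U: "U \<in> lmeasurable" "\<And>i. i < n \<Longrightarrow> {l i<..<r i} \<subseteq> U"
  shows "(\<Sum>i<n. r i - l i) \<le> measure lebesgue U"
proof -
  have "(\<Sum>i<n. r i - l i) = (\<Sum>i<n. measure lebesgue {l i<..<r i})"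
    using no by (intro sum.cong) (auto simp: nonoverlapping_def)
  also have "\<dots> = measure lebesgue (\<Union>i<n. {l i<..<r i})"
    using no by (intro measure_finite_Union[symmetric])
      (auto simp: nonoverlapping_def disjoint_family_on_def)
  also have "\<dots> \<le> measure lebesgue U"
    using U by (intro measure_mono_fmeasurable) auto
  finally show ?thesis .
qed

section \<open>Variation of absolutely continuous functions\<close>

text \<open>Variation is taken over families of nonoverlapping intervals rather than over partitions, so that it is
directly comparable with the definition of absolute continuity.\<close>

definition family_variation :: "(real \<Rightarrow> 'b::real_normed_vector) \<Rightarrow> real \<Rightarrow> real \<Rightarrow> real set" where
  "family_variation f a b = {\<Sum>i<n. norm (f (r i) - f (l i)) | n l r. nonoverlapping a b n l r}"

definition total_variation :: "(real \<Rightarrow> 'b::real_normed_vector) \<Rightarrow> real \<Rightarrow> real \<Rightarrow> real" where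
  "total_variation f a b = Sup (family_variation f a b)"

lemma family_variationI:
  "nonoverlapping a b n l r \<Longrightarrow> (\<Sum>i<n. norm (f (r i) - f (l i))) \<in> family_variation f a b"
  unfolding family_variation_def mem_Collect_eq
  by (rule exI[of _ n], rule exI[of _ l], rule exI[of _ r]) simp

lemma family_variationE:
  assumes "s \<in> family_variation f a b"
  obtains n l r where "nonoverlapping a b n l r" "s = (\<Sum>i<n. norm (f (r i) - f (l i)))"
proof -
  have "\<exists>n l r. s = (\<Sum>i<n. norm (f (r i) - f (l i))) \<and> nonoverlapping a b n l r"
    using assms unfolding family_variation_def mem_Collect_eq .
  then show ?thesis using that by (elim exE conjE)
qed

lemma zero_in_family_variation: "0 \<in> family_variation f a b"
  unfolding family_variation_def by (auto intro!: exI[of _ "0::nat"] simp: nonoverlapping_def)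

lemma family_variation_mono:
  "a' \<le> a \<Longrightarrow> b \<le> b' \<Longrightarrow> family_variation f a b \<subseteq> family_variation f a' b'"
  unfolding family_variation_def using nonoverlapping_mono by blast

lemma family_variation_split:
  assumes "s \<in> family_variation f a b" "a \<le> m" "m \<le> b"
  obtains s1 s2 where "s1 \<in> family_variation f a m" "s2 \<in> family_variation f m b" "s \<le> s1 + s2"
proof -
  obtain n l r where no: "nonoverlapping a b n l r" and s: "s = (\<Sum>i<n. norm (f (r i) - f (l i)))"
    using assms(1) by (rule family_variationE)
  have "s \<le> (\<Sum>i<n. norm (f (min (r i) m) - f (min (l i) m))) + (\<Sum>i<n. norm (f (max (r i) m) - f (max (l i) m)))"
    unfolding s by (rule sum_cut) (use no in \<open>auto simp: nonoverlapping_def\<close>)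
  moreover have "(\<Sum>i<n. norm (f (min (r i) m) - f (min (l i) m))) \<in> family_variation f a m"
    by (rule family_variationI[OF nonoverlapping_cut(1)[OF no assms(2,3)]])
  moreover have "(\<Sum>i<n. norm (f (max (r i) m) - f (max (l i) m))) \<in> family_variation f m b"
    by (rule family_variationI[OF nonoverlapping_cut(2)[OF no assms(2,3)]])
  ultimately show ?thesis using that by blast
qed

text \<open>Adding one more interval makes the total variation grow by at least the increment of \<open>f\<close>; hence both the
total variation and its difference with \<open>f\<close> are monotone.\<close>

lemma family_variation_append:
  assumes "s \<in> family_variation f a u" "u \<le> v" "a \<le> u"
  shows "s + norm (f v - f u) \<in> family_variation f a v"
proof -
  obtain n l r where no: "nonoverlapping a u n l r" and s: "s = (\<Sum>i<n. norm (f (r i) - f (l i)))"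
    using assms(1) by (rule family_variationE)
  define l' r' where "l' = (\<lambda>i. if i < n then l i else u)" and "r' = (\<lambda>i. if i < n then r i else v)"
  have bd: "a \<le> l i \<and> l i \<le> r i \<and> r i \<le> u" if "i < n" for i
    using no that by (auto simp: nonoverlapping_def)
  have dj: "{l i<..<r i} \<inter> {l j<..<r j} = {}" if "i < n" "j < n" "i \<noteq> j" for i j
    using no that unfolding nonoverlapping_def by blast
  have dj': "{l i<..<r i} \<inter> {u<..<v} = {}" if "i < n" for i
    using bd[OF that] by auto
  have "nonoverlapping a v (Suc n) l' r'"
    unfolding nonoverlapping_def
  proof (intro conjI allI impI)
    fix i assume "i < Suc n"
    then show "a \<le> l' i" "l' i \<le> r' i" "r' i \<le> v"
      using bd[of i] assms by (auto simp: l'_def r'_def)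
  next
    fix i j assume "i < Suc n" "j < Suc n" "i \<noteq> j"
    then show "{l' i<..<r' i} \<inter> {l' j<..<r' j} = {}"
      using dj[of i j] dj'[of i] dj'[of j] by (auto simp: l'_def r'_def less_Suc_eq)
  qed
  moreover have "s + norm (f v - f u) = (\<Sum>i<Suc n. norm (f (r' i) - f (l' i)))"
    by (simp add: s l'_def r'_def)
  ultimately show ?thesis using family_variationI[of a v "Suc n" l' r' f] by simp
qed

lemma abs_continuous_on_bounded_variation:
  fixes f :: "real \<Rightarrow> 'b::real_normed_vector"
  assumes f: "abs_continuous_on a b f" and "a \<le> b"
  shows "bdd_above (family_variation f a b)"
proof -
  obtain d where d: "d > 0" "\<And>n l r. nonoverlapping a b n l r \<Longrightarrow>
     (\<Sum>i<n. r i - l i) < d \<Longrightarrow> (\<Sum>i<n. norm (f (r i) - f (l i))) < 1"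
    using f unfolding abs_continuous_on_altdef by (meson zero_less_one)
  define P where "P u v \<longleftrightarrow> (a \<le> u \<and> v \<le> b \<longrightarrow> bdd_above (family_variation f u v))" for u v
  have "P a b"
    using assms(2)
  proof (induct rule: Bolzano)
    case (trans u m v)
    show ?case
      unfolding P_def
    proof
      assume "a \<le> u \<and> v \<le> b"
      then obtain B1 B2 where B: "\<And>s. s \<in> family_variation f u m \<Longrightarrow> s \<le> B1"
          "\<And>s. s \<in> family_variation f m v \<Longrightarrow> s \<le> B2"
        using trans unfolding P_def bdd_above_def by force
      show "bdd_above (family_variation f u v)"
      proof (rule bdd_aboveI)
        fix s assume "s \<in> family_variation f u v"
        then show "s \<le> B1 + B2"
          using trans B by (elim family_variation_split[of _ f u v m]) force+
      qed
    qed
  next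
    case (local x)
    show ?case
    proof (intro exI[of _ "d/2"] conjI allI impI)
      fix u v assume uv: "u \<le> x \<and> x \<le> v \<and> v - u < d/2"
      show "P u v" unfolding P_def
      proof
        assume ab: "a \<le> u \<and> v \<le> b"
        have "s \<le> 1" if sf: "s \<in> family_variation f u v" for s
        proof -
          obtain n l r where no: "nonoverlapping u v n l r" and s: "s = (\<Sum>i<n. norm (f (r i) - f (l i)))"
            using sf by (rule family_variationE)
          have "(\<Sum>i<n. r i - l i) \<le> measure lebesgue {u..v}"
            using no by (intro nonoverlapping_length_le[OF no]) (auto simp: nonoverlapping_def intro: order_trans less_imp_le)
          also have "\<dots> < d" using uv d(1) by simp
          finally show ?thesis
            using d(2)[OF nonoverlapping_mono[OF no, of a b]] ab s by auto
        qed
        then show "bdd_above (family_variation f u v)" by (rule bdd_aboveI)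
      qed
    qed (use d(1) in auto)
  qed
  then show ?thesis by (simp add: P_def)
qed

lemma total_variation_increment:
  assumes f: "abs_continuous_on a b f" and uv: "a \<le> u" "u \<le> v" "v \<le> b"
  shows "norm (f v - f u) \<le> total_variation f a v - total_variation f a u"
proof -
  have bd: "bdd_above (family_variation f a v)"
    using abs_continuous_on_bounded_variation[of a b f] f uv family_variation_mono[of a a v b f]
    by (meson bdd_above_mono order_refl order_trans)
  have "total_variation f a u \<le> total_variation f a v - norm (f v - f u)"
    unfolding total_variation_def[of f a u]
  proof (rule cSup_least)
    fix s assume "s \<in> family_variation f a u"
    then have "s + norm (f v - f u) \<le> total_variation f a v"
      unfolding total_variation_def using bd uv by (intro cSup_upper family_variation_append) auto
    then show "s \<le> total_variation f a v - norm (f v - f u)" by simp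
  qed (use zero_in_family_variation in blast)
  then show ?thesis by simp
qed

lemma total_variation_continuous:
  assumes f: "abs_continuous_on a b f" and ab: "a \<le> b"
  shows "continuous_on {a..b} (total_variation f a)"
  unfolding continuous_on_iff
proof (intro ballI allI impI)
  fix x e :: real assume x: "x \<in> {a..b}" and "e > 0"
  then obtain d where d: "d > 0" "\<And>n l r. nonoverlapping a b n l r \<Longrightarrow>
     (\<Sum>i<n. r i - l i) < d \<Longrightarrow> (\<Sum>i<n. norm (f (r i) - f (l i))) < e/2"
    using f unfolding abs_continuous_on_altdef by (meson half_gt_zero)
  have key: "total_variation f a v - total_variation f a u \<le> e/2"
    if uv: "a \<le> u" "u \<le> v" "v \<le> b" "v - u < d" for u v
  proof -
    have bd: "bdd_above (family_variation f a u)"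
      using abs_continuous_on_bounded_variation[of a b f] f uv family_variation_mono[of a a u b f]
      by (meson bdd_above_mono order_refl order_trans)
    have "total_variation f a v \<le> total_variation f a u + e/2"
      unfolding total_variation_def[of f a v]
    proof (rule cSup_least)
      fix s assume "s \<in> family_variation f a v"
      then obtain s1 s2 where s: "s1 \<in> family_variation f a u" "s2 \<in> family_variation f u v" "s \<le> s1 + s2"
        using family_variation_split[of s f a v u] uv by blast
      have "s1 \<le> total_variation f a u"
        unfolding total_variation_def using s bd by (intro cSup_upper)
      moreover obtain n l r where no: "nonoverlapping u v n l r" and s2: "s2 = (\<Sum>i<n. norm (f (r i) - f (l i)))"
        using s(2) by (rule family_variationE)
      have "(\<Sum>i<n. r i - l i) \<le> measure lebesgue {u..v}"
        using no by (intro nonoverlapping_length_le[OF no]) (auto simp: nonoverlapping_def intro: order_trans less_imp_le)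
      then have "s2 < e/2"
        unfolding s2 using uv by (intro d(2) nonoverlapping_mono[OF no]) auto
      ultimately show "s \<le> total_variation f a u + e/2" using s by linarith
    qed (use zero_in_family_variation in blast)
    then show ?thesis by simp
  qed
  show "\<exists>d>0. \<forall>y\<in>{a..b}. dist y x < d \<longrightarrow> dist (total_variation f a y) (total_variation f a x) < e"
  proof (intro exI[of _ d] conjI ballI impI d(1))
    fix y assume y: "y \<in> {a..b}" "dist y x < d"
    have "\<bar>total_variation f a y - total_variation f a x\<bar> \<le> e/2"
    proof (cases "x \<le> y")
      case True
      then show ?thesis using key[of x y] total_variation_increment[OF f, of x y] x y norm_ge_zero[of "f y - f x"]
        unfolding dist_real_def atLeastAtMost_iff by linarith
    next
      case False
      then show ?thesis using key[of y x] total_variation_increment[OF f, of y x] x y norm_ge_zero[of "f x - f y"]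
        unfolding dist_real_def atLeastAtMost_iff by linarith
    qed
    then show "dist (total_variation f a y) (total_variation f a x) < e"
      using \<open>e > 0\<close> by (simp add: dist_real_def)
  qed
qed

section \<open>Monotone functions are differentiable almost everywhere\<close>

text \<open>The Vitali covering theorem with the closed balls of the real line written as intervals. Closed balls
matter: the intervals given by difference quotients have \<open>x\<close> as an end point.\<close>

lemma Vitali_interval_cover:
  fixes A U :: "real set"
  assumes U: "open U" "A \<subseteq> U"
    and fine: "\<And>x d. x \<in> A \<Longrightarrow> d > 0 \<Longrightarrow> \<exists>u v. u \<le> x \<and> x \<le> v \<and> u < v \<and> v - u < d \<and> Q u v"
  obtains C where "countable C" "\<And>u v. (u, v) \<in> C \<Longrightarrow> u < v \<and> {u..v} \<subseteq> U \<and> Q u v"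
    "disjoint_family_on (\<lambda>(u,v). {u..v}) C" "negligible (A - (\<Union>(u,v)\<in>C. {u..v}))"
proof -
  define K where "K = {(u,v). u < v \<and> {u..v} \<subseteq> U \<and> Q u v}"
  let ?a = "\<lambda>(u::real,v::real). (u + v)/2" and ?r = "\<lambda>(u::real,v::real). (v - u)/2"
  have cb: "cball (?a i) (?r i) = (\<lambda>(u,v). {u..v}) i" for i
    by (cases i) (auto simp: cball_eq_atLeastAtMost field_simps)
  obtain C where C: "countable C" "C \<subseteq> K"
     "pairwise (\<lambda>i j. disjnt (cball (?a i) (?r i)) (cball (?a j) (?r j))) C"
     "negligible(A - (\<Union>i \<in> C. cball (?a i) (?r i)))"
  proof (rule Vitali_covering_theorem_cballs[of K ?r A ?a])
    show "0 < ?r i" if "i \<in> K" for i using that by (auto simp: K_def)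
    fix x d assume x: "x \<in> A" and d: "(0::real) < d"
    then obtain e where e: "e > 0" "cball x e \<subseteq> U" using U open_contains_cball by blast
    obtain u v where uv: "u \<le> x" "x \<le> v" "u < v" "v - u < min d e" "Q u v"
      using fine[OF x, of "min d e"] d e by auto
    have "{u..v} \<subseteq> cball x e" using uv by (auto simp: dist_real_def)
    then have "(u,v) \<in> K" using uv e by (auto simp: K_def)
    then show "\<exists>i. i \<in> K \<and> x \<in> cball (?a i) (?r i) \<and> ?r i < d"
      using uv d by (intro exI[of _ "(u,v)"]) (simp only: cb, auto)
  qed
  show ?thesis
  proof (rule that[OF C(1)])
    show "u < v \<and> {u..v} \<subseteq> U \<and> Q u v" if "(u,v) \<in> C" for u v
      using that C(2) by (auto simp: K_def)
    show "disjoint_family_on (\<lambda>(u,v). {u..v}) C"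
      using C(3) unfolding cb disjoint_family_on_def pairwise_def disjnt_def by blast
    show "negligible (A - (\<Union>(u,v)\<in>C. {u..v}))" using C(4) unfolding cb .
  qed
qed

text \<open>The sets of points at which difference quotients oscillate are handled by their outer measure, which
spares a proof that they are measurable.\<close>

definition outer_lebesgue :: "real set \<Rightarrow> ennreal" where
  "outer_lebesgue A = (INF U\<in>{U. open U \<and> A \<subseteq> U}. emeasure lebesgue U)"

lemma outer_lebesgue_le:
  assumes S: "S \<in> sets lebesgue" and "negligible (A - S)"
  shows "outer_lebesgue A \<le> emeasure lebesgue S"
proof (rule ennreal_le_epsilon)
  fix e :: real assume e: "e > 0"
  let ?S = "S \<union> (A - S)"
  have m: "?S \<in> sets lebesgue" "emeasure lebesgue ?S = emeasure lebesgue S"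
    using assms by (auto simp: negligible_imp_sets negligible_iff_null_sets emeasure_Un_null_set simp del: Un_Diff_cancel)
  obtain T where T: "open T" "?S \<subseteq> T" "(T - ?S) \<in> lmeasurable" "emeasure lebesgue (T - ?S) < ennreal e"
    using sets_lebesgue_outer_open[OF m(1) e] by blast
  have "outer_lebesgue A \<le> emeasure lebesgue T"
    unfolding outer_lebesgue_def using T by (intro INF_lower) auto
  also have "T = ?S \<union> (T - ?S)" using T by auto
  also have "emeasure lebesgue \<dots> \<le> emeasure lebesgue ?S + emeasure lebesgue (T - ?S)"
    using m T by (intro emeasure_subadditive) auto
  also have "\<dots> \<le> emeasure lebesgue S + ennreal e" using m T by (intro add_mono) auto
  finally show "outer_lebesgue A \<le> emeasure lebesgue S + ennreal e" .
qed

lemma open_superset_of_small_measure: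
  assumes "outer_lebesgue A < ennreal e"
  obtains U where "open U" "A \<subseteq> U" "U \<in> lmeasurable" "measure lebesgue U < e"
proof -
  obtain U where U: "open U" "A \<subseteq> U" "emeasure lebesgue U < ennreal e"
    using assms unfolding outer_lebesgue_def INF_less_iff by blast
  have "e > 0" using assms by (cases "e > 0") (auto simp: ennreal_neg)
  have "U \<in> lmeasurable" using U by (intro fmeasurableI) (auto simp: less_top intro: order.strict_trans)
  moreover have "measure lebesgue U < e"
    using U(3) \<open>e > 0\<close> calculation by (simp add: emeasure_eq_measure2 ennreal_less_iff)
  ultimately show ?thesis using U that by blast
qed

lemma negligible_iff_outer_lebesgue_0: "negligible A \<longleftrightarrow> outer_lebesgue A = 0"
proof
  assume "negligible A"
  then have "outer_lebesgue A \<le> emeasure lebesgue ({}::real set)" by (intro outer_lebesgue_le) auto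
  then show "outer_lebesgue A = 0" by simp
next
  assume 0: "outer_lebesgue A = 0"
  show "negligible A"
    unfolding negligible_outer
  proof (intro allI impI)
    fix e :: real assume "e > 0"
    then have "outer_lebesgue A < ennreal e" using 0 by simp
    then show "\<exists>S. A \<subseteq> S \<and> S \<in> lmeasurable \<and> measure lebesgue S < e"
      using open_superset_of_small_measure by blast
  qed
qed

context
  fixes F :: "real \<Rightarrow> real"
  assumes F: "mono F" "continuous_on UNIV F"
begin

lemma interval_measure_Icc: "u \<le> v \<Longrightarrow> emeasure (interval_measure F) {u..v} = F v - F u"
  using F by (intro emeasure_interval_measure_Icc) (auto simp: mono_def)

lemma interval_cover_measures:
  assumes C: "countable C" "\<And>u v. (u,v) \<in> C \<Longrightarrow> u < v" "disjoint_family_on (\<lambda>(u,v). {u..v}) C"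
  shows "(\<Union>(u,v)\<in>C. {u..v}) \<in> sets borel"
    and "(\<And>u v. (u,v) \<in> C \<Longrightarrow> F v - F u \<le> c * (v - u)) \<Longrightarrow> c \<ge> 0 \<Longrightarrow>
      emeasure (interval_measure F) (\<Union>(u,v)\<in>C. {u..v}) \<le> ennreal c * emeasure lebesgue (\<Union>(u,v)\<in>C. {u..v})"
    and "(\<And>u v. (u,v) \<in> C \<Longrightarrow> F v - F u \<ge> c * (v - u)) \<Longrightarrow> c \<ge> 0 \<Longrightarrow>
      ennreal c * emeasure lebesgue (\<Union>(u,v)\<in>C. {u..v}) \<le> emeasure (interval_measure F) (\<Union>(u,v)\<in>C. {u..v})"
proof -
  show "(\<Union>(u,v)\<in>C. {u..v}) \<in> sets borel" using C(1) by (intro sets.countable_UN'') auto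
  have 1: "emeasure (interval_measure F) (\<Union>(u,v)\<in>C. {u..v}) = (\<integral>\<^sup>+i. ennreal (F (snd i) - F (fst i)) \<partial>count_space C)"
  proof -
    have "emeasure (interval_measure F) (\<Union>(u,v)\<in>C. {u..v}) =
       (\<integral>\<^sup>+i. emeasure (interval_measure F) ((\<lambda>(u,v). {u..v}) i) \<partial>count_space C)"
      using C by (intro emeasure_UN_countable) auto
    also have "\<dots> = (\<integral>\<^sup>+i. ennreal (F (snd i) - F (fst i)) \<partial>count_space C)"
      using C(2) by (intro nn_integral_cong) (auto simp: interval_measure_Icc less_imp_le)
    finally show ?thesis .
  qed
  have 2: "emeasure lebesgue (\<Union>(u,v)\<in>C. {u..v}) = (\<integral>\<^sup>+i. ennreal (snd i - fst i) \<partial>count_space C)"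
  proof -
    have "emeasure lebesgue (\<Union>(u,v)\<in>C. {u..v}) =
       (\<integral>\<^sup>+i. emeasure lebesgue ((\<lambda>(u,v). {u..v}) i) \<partial>count_space C)"
      using C by (intro emeasure_UN_countable) auto
    also have "\<dots> = (\<integral>\<^sup>+i. ennreal (snd i - fst i) \<partial>count_space C)"
      using C(2) by (intro nn_integral_cong) (auto simp: less_imp_le)
    finally show ?thesis .
  qed
  have 3: "ennreal c * emeasure lebesgue (\<Union>(u,v)\<in>C. {u..v}) = (\<integral>\<^sup>+i. ennreal (c * (snd i - fst i)) \<partial>count_space C)" if "c \<ge> 0"
  proof -
    have "ennreal c * emeasure lebesgue (\<Union>(u,v)\<in>C. {u..v}) = (\<integral>\<^sup>+i. ennreal c * ennreal (snd i - fst i) \<partial>count_space C)"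
      unfolding 2 by (rule nn_integral_cmult[symmetric]) auto
    also have "\<dots> = (\<integral>\<^sup>+i. ennreal (c * (snd i - fst i)) \<partial>count_space C)"
      using that C(2) by (intro nn_integral_cong) (auto simp: ennreal_mult less_imp_le)
    finally show ?thesis .
  qed
  show "emeasure (interval_measure F) (\<Union>(u,v)\<in>C. {u..v}) \<le> ennreal c * emeasure lebesgue (\<Union>(u,v)\<in>C. {u..v})"
    if "\<And>u v. (u,v) \<in> C \<Longrightarrow> F v - F u \<le> c * (v - u)" "c \<ge> 0"
    unfolding 1 3[OF that(2)] using that(1) by (intro nn_integral_mono ennreal_leI) auto
  show "ennreal c * emeasure lebesgue (\<Union>(u,v)\<in>C. {u..v}) \<le> emeasure (interval_measure F) (\<Union>(u,v)\<in>C. {u..v})"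
    if "\<And>u v. (u,v) \<in> C \<Longrightarrow> F v - F u \<ge> c * (v - u)" "c \<ge> 0"
    unfolding 1 3[OF that(2)] using that(1) by (intro nn_integral_mono ennreal_leI) auto
qed

definition quot :: "real \<Rightarrow> real \<Rightarrow> real" where "quot x y = (F y - F x) / (y - x)"

lemma quot_nonneg: "y \<noteq> x \<Longrightarrow> quot x y \<ge> 0"
  using F(1) unfolding quot_def mono_def
  by (cases "x < y") (auto simp: divide_nonpos_neg not_less)

lemma frequently_quot_interval:
  assumes "\<exists>\<^sub>F y in at x. P (quot x y)" "d > 0"
  obtains u v where "u \<le> x" "x \<le> v" "u < v" "v - u < d" "P ((F v - F u) / (v - u))"
proof -
  have "\<exists>\<^sub>F y in at x. P (quot x y) \<and> (y \<noteq> x \<and> dist y x < d)"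
    using frequently_eventually_conj[OF assms(1), of "\<lambda>y. y \<noteq> x \<and> dist y x < d"] assms(2)
    by (auto simp: eventually_at conj_commute)
  then obtain y where y: "P (quot x y)" "y \<noteq> x" "dist y x < d"
    using frequently_ex by blast
  show ?thesis
  proof (cases "x < y")
    case True
    then show ?thesis using y that[of x y] by (auto simp: quot_def dist_real_def)
  next
    case False
    have "quot x y = (F x - F y) / (x - y)" unfolding quot_def by (metis minus_diff_eq minus_divide_divide)
    then show ?thesis using y that[of y x] False by (auto simp: dist_real_def)
  qed
qed

text \<open>A Vitali cover by intervals on which \<open>F\<close> grows by more than \<open>\<beta>\<close> times their length shows that \<open>F\<close> grows
by at least \<open>\<beta>\<close> times the outer measure of \<open>A\<close>.\<close>

lemma upper_quot_cover:
  assumes W: "open W" "A \<subseteq> W" and up: "\<And>x. x \<in> A \<Longrightarrow> \<exists>\<^sub>F y in at x. quot x y > \<beta>" and "\<beta> \<ge> 0"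
  shows "ennreal \<beta> * outer_lebesgue A \<le> emeasure (interval_measure F) W"
proof -
  obtain C where C: "countable C" "\<And>u v. (u, v) \<in> C \<Longrightarrow> u < v \<and> {u..v} \<subseteq> W \<and> (F v - F u) / (v - u) > \<beta>"
    "disjoint_family_on (\<lambda>(u,v). {u..v}) C" "negligible (A - (\<Union>(u,v)\<in>C. {u..v}))"
    using Vitali_interval_cover[OF W, of "\<lambda>u v. (F v - F u) / (v - u) > \<beta>"]
      frequently_quot_interval[where P="\<lambda>q. q > \<beta>"] up by metis
  let ?S = "\<Union>(u,v)\<in>C. {u..v}"
  have C2: "u < v" if "(u,v) \<in> C" for u v using C(2) that by blast
  note IC = interval_cover_measures[OF C(1) C2 C(3)]
  have "outer_lebesgue A \<le> emeasure lebesgue ?S"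
    using IC(1) C(4) by (intro outer_lebesgue_le) auto
  then have "ennreal \<beta> * outer_lebesgue A \<le> ennreal \<beta> * emeasure lebesgue ?S"
    by (intro mult_left_mono) auto
  also have "\<dots> \<le> emeasure (interval_measure F) ?S"
    by (intro IC(3)) (use C(2) assms in \<open>force simp: pos_less_divide_eq\<close>)+
  also have "\<dots> \<le> emeasure (interval_measure F) W"
    using C(2) W by (intro emeasure_mono) auto
  finally show ?thesis .
qed

text \<open>A Vitali cover by intervals of slow growth. Only their interiors are retained, as the second cover, by
intervals of fast growth, has to lie in an open set; this drops countably many end points.\<close>

lemma lower_quot_cover:
  assumes U: "open U" "A \<subseteq> U" and low: "\<And>x. x \<in> A \<Longrightarrow> \<exists>\<^sub>F y in at x. quot x y < \<alpha>" and "\<alpha> \<ge> 0"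
  obtains W where "open W" "W \<subseteq> U" "negligible (A - W)"
    "emeasure (interval_measure F) W \<le> ennreal \<alpha> * emeasure lebesgue U"
proof -
  obtain C where C: "countable C" "\<And>u v. (u, v) \<in> C \<Longrightarrow> u < v \<and> {u..v} \<subseteq> U \<and> (F v - F u) / (v - u) < \<alpha>"
    "disjoint_family_on (\<lambda>(u,v). {u..v}) C" "negligible (A - (\<Union>(u,v)\<in>C. {u..v}))"
    using Vitali_interval_cover[OF U, of "\<lambda>u v. (F v - F u) / (v - u) < \<alpha>"]
      frequently_quot_interval[where P="\<lambda>q. q < \<alpha>"] low by metis
  let ?S = "\<Union>(u,v)\<in>C. {u..v}" and ?W = "\<Union>(u,v)\<in>C. {u<..<v}"
  have C2: "u < v" if "(u,v) \<in> C" for u v using C(2) that by blast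
  note IC = interval_cover_measures[OF C(1) C2 C(3)]
  have "emeasure (interval_measure F) ?W \<le> emeasure (interval_measure F) ?S"
    using IC(1) by (intro emeasure_mono) (auto intro!: bexI)
  also have "\<dots> \<le> ennreal \<alpha> * emeasure lebesgue ?S"
    by (intro IC(2)) (use C(2) assms in \<open>force simp: pos_divide_less_eq\<close>)+
  also have "\<dots> \<le> ennreal \<alpha> * emeasure lebesgue U"
    using C(2) U by (intro mult_left_mono emeasure_mono) auto
  finally have 1: "emeasure (interval_measure F) ?W \<le> ennreal \<alpha> * emeasure lebesgue U" .
  have "A - ?W \<subseteq> (A - ?S) \<union> (fst ` C \<union> snd ` C)"
    by (force simp: image_iff)
  moreover have "negligible (fst ` C \<union> snd ` C)" using C(1)
    unfolding negligible_iff_null_sets by (intro null_sets_completionI countable_imp_null_set_lborel) auto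
  ultimately have "negligible (A - ?W)" using C(4) by (meson negligible_Un negligible_subset)
  then show ?thesis using 1 C(2) by (intro that[of ?W]) (auto intro!: open_UN, force)
qed

text \<open>Cover \<open>A\<close> first by slow intervals inside an open \<open>U\<close>, then by fast intervals inside the slow ones: this gives
\<open>\<beta> * outer_lebesgue A \<le> \<alpha> * emeasure lebesgue U\<close> for every \<open>U\<close>, which forces outer measure \<open>0\<close> as \<open>\<alpha> < \<beta>\<close>.\<close>

lemma negligible_quot_oscillates:
  assumes A: "A \<subseteq> {-c<..<c}" and ab: "0 < \<alpha>" "\<alpha> < \<beta>"
    and low: "\<And>x. x \<in> A \<Longrightarrow> \<exists>\<^sub>F y in at x. quot x y < \<alpha>"
    and up: "\<And>x. x \<in> A \<Longrightarrow> \<exists>\<^sub>F y in at x. quot x y > \<beta>"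
  shows "negligible A"
proof (rule negligible_iff_outer_lebesgue_0[THEN iffD2])
  have le: "ennreal (\<beta>/\<alpha>) * outer_lebesgue A \<le> emeasure lebesgue U" if U: "open U" "A \<subseteq> U" for U
  proof -
    obtain W where W: "open W" "W \<subseteq> U" "negligible (A - W)"
      "emeasure (interval_measure F) W \<le> ennreal \<alpha> * emeasure lebesgue U"
      using lower_quot_cover[OF U low] ab by auto
    have "outer_lebesgue A \<le> outer_lebesgue (A \<inter> W)"
      unfolding outer_lebesgue_def[of "A \<inter> W"]
    proof (rule INF_greatest)
      fix T assume "T \<in> {U. open U \<and> A \<inter> W \<subseteq> U}"
      then have T: "open T" "A \<inter> W \<subseteq> T" by auto
      have "A - T \<subseteq> A - W" using T by auto
      then show "outer_lebesgue A \<le> emeasure lebesgue T"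
        using T W(3) by (intro outer_lebesgue_le negligible_subset[OF W(3)]) auto
    qed
    then have "ennreal \<beta> * outer_lebesgue A \<le> ennreal \<beta> * outer_lebesgue (A \<inter> W)" by (intro mult_left_mono) auto
    also have "\<dots> \<le> emeasure (interval_measure F) W"
      using up W ab by (intro upper_quot_cover) auto
    also note W(4)
    finally have "ennreal (1/\<alpha>) * (ennreal \<beta> * outer_lebesgue A) \<le> ennreal (1/\<alpha>) * (ennreal \<alpha> * emeasure lebesgue U)"
      by (intro mult_left_mono) auto
    then show ?thesis using ab
      by (simp add: mult.assoc[symmetric] ennreal_mult[symmetric])
  qed
  then have 1: "ennreal (\<beta>/\<alpha>) * outer_lebesgue A \<le> outer_lebesgue A"
    unfolding outer_lebesgue_def[of A] by (intro INF_greatest) (auto simp: outer_lebesgue_def)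
  have "outer_lebesgue A \<le> emeasure lebesgue {-c<..<c}"
    using A by (intro outer_lebesgue_le) (auto simp: Diff_eq_empty_iff[THEN iffD2])
  also have "\<dots> < \<infinity>" by (cases "-c \<le> c") auto
  finally obtain m where m: "outer_lebesgue A = ennreal m" "m \<ge> 0"
    by (cases "outer_lebesgue A") auto
  have "\<beta>/\<alpha> * m \<le> m" using 1 m ab by (simp add: ennreal_mult[symmetric])
  then have "(\<beta> - \<alpha>) * m \<le> 0" using ab by (simp add: field_simps)
  then have "m = 0" using m ab by (simp add: mult_le_0_iff)
  then show "outer_lebesgue A = 0" using m by simp
qed

lemma negligible_quot_unbounded:
  assumes A: "A \<subseteq> {-c<..<c}"
    and up: "\<And>x \<beta>. x \<in> A \<Longrightarrow> \<exists>\<^sub>F y in at x. quot x y > \<beta>"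
  shows "negligible A"
proof (rule negligible_iff_outer_lebesgue_0[THEN iffD2])
  have le: "ennreal \<beta> * outer_lebesgue A \<le> ennreal (F \<bar>c\<bar> - F (-\<bar>c\<bar>))" if "\<beta> \<ge> 0" for \<beta>
  proof -
    have "ennreal \<beta> * outer_lebesgue A \<le> emeasure (interval_measure F) {-c<..<c}"
      using A up that by (intro upper_quot_cover) auto
    also have "\<dots> \<le> emeasure (interval_measure F) {-\<bar>c\<bar>..\<bar>c\<bar>}"
      by (intro emeasure_mono) auto
    finally show ?thesis by (simp add: interval_measure_Icc)
  qed
  have "outer_lebesgue A \<le> ennreal (F \<bar>c\<bar> - F (-\<bar>c\<bar>))" using le[of 1] by simp
  also have "\<dots> < \<infinity>" by simp
  finally obtain m where m: "outer_lebesgue A = ennreal m" "m \<ge> 0"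
    by (cases "outer_lebesgue A") auto
  have F0: "F \<bar>c\<bar> - F (-\<bar>c\<bar>) \<ge> 0" using F(1) by (auto simp: mono_def)
  have "\<beta> * m \<le> F \<bar>c\<bar> - F (-\<bar>c\<bar>)" if "\<beta> \<ge> 0" for \<beta>
    using le[OF that] m that F0 by (simp add: ennreal_mult[symmetric])
  \<comment> \<open>The choice of \<open>\<beta>\<close> that makes \<open>\<beta> * m\<close> exceed the bound by \<open>1\<close>.\<close>
  from this[of "(F \<bar>c\<bar> - F (-\<bar>c\<bar>) + 1) / m"] have "m = 0" using F0 m(2)
    by (cases "m = 0") auto
  then show "outer_lebesgue A = 0" using m by simp
qed

text \<open>The limit is the infimum of the eventual upper bounds; rational levels suffice to exclude oscillation,
which leaves only countably many exceptional sets.\<close>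

lemma differentiable_if_quot_converges:
  assumes bd: "\<not> (\<forall>\<beta>. \<exists>\<^sub>F y in at x. quot x y > \<beta>)"
    and osc: "\<And>\<alpha> \<beta>. \<alpha> \<in> \<rat> \<Longrightarrow> \<beta> \<in> \<rat> \<Longrightarrow> 0 < \<alpha> \<Longrightarrow> \<alpha> < \<beta> \<Longrightarrow>
      \<not> ((\<exists>\<^sub>F y in at x. quot x y < \<alpha>) \<and> (\<exists>\<^sub>F y in at x. quot x y > \<beta>))"
  shows "F differentiable (at x)"
proof -
  let ?S = "{\<beta>. \<forall>\<^sub>F y in at x. quot x y \<le> \<beta>}"
  obtain \<beta>0 where b0: "\<beta>0 \<in> ?S" using bd by (auto simp: not_frequently not_less)
  have nn: "\<forall>\<^sub>F y in at x. quot x y \<ge> 0"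
    by (simp add: eventually_at_filter quot_nonneg)
  have S0: "\<beta> \<ge> 0" if "\<beta> \<in> ?S" for \<beta>
  proof -
    have "\<forall>\<^sub>F y in at x. quot x y \<le> \<beta> \<and> quot x y \<ge> 0" using that nn by (auto intro: eventually_conj)
    then obtain y where "quot x y \<le> \<beta> \<and> quot x y \<ge> 0" using eventually_happens by force
    then show ?thesis by linarith
  qed
  have bdd: "bdd_below ?S" using S0 by (intro bdd_belowI) auto
  define L where "L = Inf ?S"
  have "(quot x \<longlongrightarrow> L) (at x)"
  proof (rule order_tendstoI)
    fix a assume "L < a"
    then have "\<exists>\<beta>\<in>?S. \<beta> < a" unfolding L_def using cInf_less_iff[of ?S a] b0 bdd by auto
    then obtain \<beta> where "\<beta> \<in> ?S" "\<beta> < a" by (elim bexE)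
    then show "\<forall>\<^sub>F y in at x. quot x y < a" by (auto elim: eventually_mono)
  next
    fix a assume aL: "a < L"
    show "\<forall>\<^sub>F y in at x. quot x y > a"
    proof (cases "a < 0")
      case True then show ?thesis using nn by (auto elim: eventually_mono)
    next
      case False
      obtain \<alpha> where \<alpha>: "\<alpha> \<in> \<rat>" "a < \<alpha>" "\<alpha> < L" using Rats_dense_in_real[OF aL] by blast
      obtain \<beta> where \<beta>: "\<beta> \<in> \<rat>" "\<alpha> < \<beta>" "\<beta> < L" using Rats_dense_in_real[OF \<alpha>(3)] by blast
      have "\<beta> \<notin> ?S" using \<beta>(3) bdd cInf_lower[of \<beta> ?S] unfolding L_def by linarith
      then have "\<exists>\<^sub>F y in at x. quot x y > \<beta>" by (simp add: frequently_def not_less)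
      then have "\<forall>\<^sub>F y in at x. quot x y \<ge> \<alpha>"
        using osc[OF \<alpha>(1) \<beta>(1)] \<alpha> \<beta> False by (auto simp: not_frequently not_less)
      then show ?thesis by (rule eventually_mono) (use \<alpha> in auto)
    qed
  qed
  then have "(F has_field_derivative L) (at x)"
    by (simp add: has_field_derivative_iff quot_def[abs_def])
  then show ?thesis using field_differentiable_def field_differentiable_imp_differentiable by blast
qed

theorem monotone_differentiable_AE: "negligible {x. \<not> F differentiable (at x)}"
proof -
  define A where "A n p = {x \<in> {-real n<..<real n}. (\<exists>\<^sub>F y in at x. quot x y < fst p) \<and> (\<exists>\<^sub>F y in at x. quot x y > snd p)}" for n and p :: "real \<times> real"
  define B where "B n = {x \<in> {-real n<..<real n}. \<forall>\<beta>. \<exists>\<^sub>F y in at x. quot x y > \<beta>}" for n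
  define R where "R = {p. fst p \<in> \<rat> \<and> snd p \<in> \<rat> \<and> 0 < fst p \<and> fst p < (snd p :: real)}"
  have cR: "countable R"
  proof (rule countable_subset)
    show "R \<subseteq> \<rat> \<times> \<rat>" by (auto simp: R_def)
  qed (auto intro: countable_rat)
  have "negligible (\<Union>n. B n)"
    by (rule negligible_countable_Union) (auto simp: B_def intro!: negligible_quot_unbounded)
  moreover have "negligible (\<Union>(n,p)\<in>UNIV \<times> R. A n p)"
  proof (rule negligible_countable_Union)
    show "countable ((\<lambda>(n, p). A n p) ` (UNIV \<times> R))" using cR by auto
    fix S assume "S \<in> (\<lambda>(n, p). A n p) ` (UNIV \<times> R)"
    then obtain n p where "S = A n p" "p \<in> R" by auto
    then show "negligible S"
      by (intro negligible_quot_oscillates[of S "real n" "fst p" "snd p"]) (auto simp: A_def R_def)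
  qed
  moreover have "{x. \<not> F differentiable (at x)} \<subseteq> (\<Union>n. B n) \<union> (\<Union>(n,p)\<in>UNIV \<times> R. A n p)"
  proof
    fix x assume "x \<in> {x. \<not> F differentiable (at x)}"
    then have nd: "\<not> F differentiable (at x)" by simp
    obtain n where "\<bar>x\<bar> < real n" using reals_Archimedean2 by blast
    then have n: "x \<in> {-real n<..<real n}" by auto
    show "x \<in> (\<Union>n. B n) \<union> (\<Union>(n,p)\<in>UNIV \<times> R. A n p)"
    proof (rule ccontr)
      assume no: "\<not> ?thesis"
      have "x \<notin> B n" using no by auto
      moreover have "x \<notin> A n (\<alpha>,\<beta>)" if "(\<alpha>,\<beta>) \<in> R" for \<alpha> \<beta> using no that by auto
      ultimately have "F differentiable (at x)"
        using n by (intro differentiable_if_quot_converges) (auto simp: B_def A_def R_def)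
      then show False using nd by simp
    qed
  qed
  ultimately show ?thesis by (meson negligible_Un negligible_subset)
qed

end

section \<open>The fundamental theorem of calculus for absolutely continuous functions\<close>

lemma nonoverlapping_enumeration:
  assumes fin: "finite P" and bd: "\<And>p. p \<in> P \<Longrightarrow> a \<le> L p \<and> L p \<le> R p \<and> R p \<le> b"
    and dj: "\<And>p q. p \<in> P \<Longrightarrow> q \<in> P \<Longrightarrow> p \<noteq> q \<Longrightarrow> {L p<..<R p} \<inter> {L q<..<R q} = {}"
  obtains n l r where "nonoverlapping a b n l r" "\<forall>i<n. \<exists>p\<in>P. l i = L p \<and> r i = R p"
    "\<forall>h. (\<Sum>i<n. h (l i) (r i)) = (\<Sum>p\<in>P. h (L p) (R p) :: real)"
proof -
  obtain e where e: "bij_betw e {0..<card P} P" using ex_bij_betw_nat_finite[OF fin] by blast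
  have eP: "e i \<in> P" if "i < card P" for i using e that by (auto simp: bij_betw_def)
  have inj: "e i \<noteq> e j" if "i < card P" "j < card P" "i \<noteq> j" for i j
    using e that by (auto simp: bij_betw_def inj_on_def)
  show ?thesis
  proof (rule that[of "card P" "\<lambda>i. L (e i)" "\<lambda>i. R (e i)"])
    show "nonoverlapping a b (card P) (\<lambda>i. L (e i)) (\<lambda>i. R (e i))"
      unfolding nonoverlapping_def using bd eP dj inj by meson
    show "\<forall>i<card P. \<exists>p\<in>P. L (e i) = L p \<and> R (e i) = R p"
      using eP by auto
    show "\<forall>h. (\<Sum>i<card P. h (L (e i)) (R (e i))) = (\<Sum>p\<in>P. h (L p) (R p) :: real)"
      using sum.reindex_bij_betw[OF e, of "\<lambda>p. h (L p) (R p)" for h :: "real \<Rightarrow> real \<Rightarrow> real"] by (simp add: atLeast0LessThan)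
  qed
qed

text \<open>With \<open>F\<close> the total variation, \<open>f = F - (F - f)\<close> is a difference of continuous monotone functions.\<close>

lemma abs_continuous_on_real_differentiable_AE:
  fixes f :: "real \<Rightarrow> real"
  assumes f: "abs_continuous_on a b f" and ab: "a \<le> b"
  shows "negligible {x \<in> {a<..<b}. \<not> f differentiable (at x)}"
proof -
  define c where "c x = max a (min b x)" for x
  have c: "a \<le> c x" "c x \<le> b" "x \<le> y \<Longrightarrow> c x \<le> c y" "a \<le> x \<Longrightarrow> x \<le> b \<Longrightarrow> c x = x" for x y
    using ab by (auto simp: c_def)
  have cc: "continuous_on UNIV c" unfolding c_def by (intro continuous_intros)
  define F where "F x = total_variation f a (c x)" for x
  define G where "G x = F x - f (c x)" for x
  have inc: "norm (f (c y) - f (c x)) \<le> F y - F x" if "x \<le> y" for x y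
    unfolding F_def using c that by (intro total_variation_increment[OF f]) auto
  have mF: "mono F" "mono G"
    unfolding mono_def G_def
    using inc norm_ge_zero abs_ge_self abs_ge_minus_self by (force simp: abs_le_iff)+
  have cF: "continuous_on UNIV F" unfolding F_def
    using c by (intro continuous_on_compose2[OF total_variation_continuous[OF f ab] cc]) auto
  have "continuous_on UNIV (\<lambda>x. f (c x))"
    using c by (intro continuous_on_compose2[OF abs_continuous_on_imp_continuous_on[OF f] cc]) auto
  then have cG: "continuous_on UNIV G" unfolding G_def using cF by (intro continuous_intros)
  have "{x \<in> {a<..<b}. \<not> f differentiable (at x)} \<subseteq> {x. \<not> F differentiable (at x)} \<union> {x. \<not> G differentiable (at x)}"
  proof safe
    fix x assume x: "x \<in> {a<..<b}" and nf: "\<not> f differentiable (at x)" and F: "F differentiable (at x)" and G: "G differentiable (at x)"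
    have "(\<lambda>x. F x - G x) differentiable (at x)" using F G by (rule differentiable_diff)
    then have "f differentiable (at x)"
    proof (rule differentiable_transform_within[of _ _ _ "min (x - a) (b - x)"])
      fix y assume "dist y x < min (x - a) (b - x)"
      then have "a \<le> y" "y \<le> b" by (auto simp: dist_real_def)
      then show "F y - G y = f y" by (simp add: G_def c)
    qed (use x in auto)
    then show False using nf by simp
  qed
  then show ?thesis
    using monotone_differentiable_AE[OF mF(1) cF] monotone_differentiable_AE[OF mF(2) cG]
    by (meson negligible_Un negligible_subset)
qed

theorem abs_continuous_on_differentiable_AE:
  fixes f :: "real \<Rightarrow> 'b::euclidean_space"
  assumes f: "abs_continuous_on a b f" and ab: "a \<le> b"
  shows "negligible {x \<in> {a<..<b}. \<not> f differentiable (at x)}"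
proof -
  have "{x \<in> {a<..<b}. \<not> f differentiable (at x)} = (\<Union>i\<in>Basis. {x \<in> {a<..<b}. \<not> (\<lambda>x. f x \<bullet> i) differentiable (at x)})"
    unfolding differentiable_componentwise_within[of f] by auto
  moreover have "negligible {x \<in> {a<..<b}. \<not> (\<lambda>x. f x \<bullet> i) differentiable (at x)}" if "i \<in> Basis" for i
  proof (rule abs_continuous_on_real_differentiable_AE[OF _ ab])
    show "abs_continuous_on a b (\<lambda>x. f x \<bullet> i)"
      using that by (intro abs_continuous_on_dominated[OF f, where B=1])
        (auto simp: inner_diff_left[symmetric] intro: Basis_le_norm)
  qed
  ultimately show ?thesis by (auto intro: negligible_Union)
qed

text \<open>The gauge argument of the fundamental theorem of calculus, except at tags in the null set \<open>N\<close>: there the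
gauge keeps the intervals inside an open set of small measure, and absolute continuity makes their total
increment small.\<close>

theorem abs_continuous_on_has_integral:
  fixes f :: "real \<Rightarrow> 'b::euclidean_space"
  assumes f: "abs_continuous_on a b f" and ab: "a \<le> b" and N: "negligible N"
    and deriv: "\<And>x. x \<in> {a..b} - N \<Longrightarrow> (f has_vector_derivative f' x) (at x within {a..b})"
  shows "(f' has_integral (f b - f a)) {a..b}"
proof -
  define g where "g x = (if x \<in> N then 0 else f' x)" for x
  have "(g has_integral (f b - f a)) {a..b}"
    unfolding has_integral_real
  proof (intro allI impI)
    fix e :: real assume e: "e > 0"
    \<comment> \<open>The summand \<open>1\<close> covers the case \<open>a = b\<close>.\<close>
    define e1 where "e1 = e / (2 * (b - a + 1))"
    have e1: "e1 > 0" "e1 * (b - a) < e/2" using e ab by (auto simp: e1_def field_simps)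
    have "\<forall>x. \<exists>d>0. x \<in> {a..b} - N \<longrightarrow>
         (\<forall>y\<in>{a..b}. norm (y-x) < d \<longrightarrow> norm (f y - f x - (y-x) *\<^sub>R f' x) \<le> e1 * norm (y-x))"
      using deriv e1(1) unfolding has_vector_derivative_def has_derivative_within_alt
      by (metis zero_less_one)
    then obtain d where d: "\<And>x. 0 < d x"
       "\<And>x y. \<lbrakk>x \<in> {a..b} - N; y \<in> {a..b}; norm (y-x) < d x\<rbrakk>
            \<Longrightarrow> norm (f y - f x - (y-x) *\<^sub>R f' x) \<le> e1 * norm (y-x)"
      by metis
    obtain \<delta> where \<delta>: "\<delta> > 0" "\<And>n l r. nonoverlapping a b n l r \<Longrightarrow>
     (\<Sum>i<n. r i - l i) < \<delta> \<Longrightarrow> (\<Sum>i<n. norm (f (r i) - f (l i))) < e/2"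
      using f e unfolding abs_continuous_on_altdef by (meson half_gt_zero)
    obtain U where U: "open U" "N \<subseteq> U" "U \<in> lmeasurable" "measure lebesgue U < \<delta>"
      using open_superset_of_small_measure[of N \<delta>] N \<delta>(1) by (auto simp: negligible_iff_outer_lebesgue_0)
    define \<gamma> where "\<gamma> x = (if x \<in> N then U else ball x (d x))" for x
    have "norm ((\<Sum>(x, k)\<in>p. measure lborel k *\<^sub>R g x) - (f b - f a)) < e"
      if p: "p tagged_division_of {a..b}" and fine: "\<gamma> fine p" for p
    proof -
      note pD = tagged_division_ofD[OF p]
      have K: "\<exists>u v. K = {u..v} \<and> u \<le> x \<and> x \<le> v \<and> a \<le> u \<and> v \<le> b" if "(x,K) \<in> p" for x K
        using pD(2,3,4)[OF that] by fastforce
      have fK: "f b - f a = (\<Sum>(x,K)\<in>p. f (Sup K) - f (Inf K))"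
        using additive_tagged_division_1[OF ab p, of f] by simp
      define p1 p2 where "p1 = {(x,K) \<in> p. x \<notin> N}" and "p2 = {(x,K) \<in> p. x \<in> N}"
      have p12: "p = p1 \<union> p2" "p1 \<inter> p2 = {}" "finite p1" "finite p2" "p1 \<subseteq> p" "p2 \<subseteq> p"
        using pD(1) by (auto simp: p1_def p2_def intro: finite_subset[of _ p])
      have "norm ((\<Sum>(x, k)\<in>p. measure lborel k *\<^sub>R g x) - (f b - f a))
         = norm (\<Sum>(x,K)\<in>p. measure lborel K *\<^sub>R g x - (f (Sup K) - f (Inf K)))"
        unfolding fK by (simp add: sum_subtractf[symmetric] case_prod_unfold)
      also have "\<dots> \<le> (\<Sum>(x,K)\<in>p. norm (measure lborel K *\<^sub>R g x - (f (Sup K) - f (Inf K))))"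
        by (rule order_trans[OF norm_sum]) (simp add: case_prod_unfold)
      also have "\<dots> = (\<Sum>(x,K)\<in>p1. norm (measure lborel K *\<^sub>R g x - (f (Sup K) - f (Inf K)))) +
          (\<Sum>(x,K)\<in>p2. norm (measure lborel K *\<^sub>R g x - (f (Sup K) - f (Inf K))))"
        using p12 by (metis (no_types, lifting) sum.union_disjoint)
      also have "(\<Sum>(x,K)\<in>p1. norm (measure lborel K *\<^sub>R g x - (f (Sup K) - f (Inf K)))) < e/2"
      proof -
        have "(\<Sum>(x,K)\<in>p1. norm (measure lborel K *\<^sub>R g x - (f (Sup K) - f (Inf K)))) \<le> (\<Sum>(x,K)\<in>p1. e1 * (Sup K - Inf K))"
        proof (rule sum_mono, clarify)
          fix x K assume "(x,K) \<in> p1"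
          then have xK: "(x,K) \<in> p" "x \<notin> N" by (auto simp: p1_def)
          then obtain u v where uv: "K = {u..v}" "u \<le> x" "x \<le> v" "a \<le> u" "v \<le> b" using K by blast
          have "K \<subseteq> \<gamma> x" using fineD[OF fine xK(1)] .
          then have "K \<subseteq> ball x (d x)" using xK(2) by (simp add: \<gamma>_def)
          moreover have "u \<in> K" "v \<in> K" using uv by auto
          ultimately have "u \<in> ball x (d x)" "v \<in> ball x (d x)" by blast+
          then have du: "norm (f u - f x - (u-x) *\<^sub>R f' x) \<le> e1 * (x - u)"
            and dv: "norm (f v - f x - (v-x) *\<^sub>R f' x) \<le> e1 * (v - x)"
            using d(2)[of x u] d(2)[of x v] uv xK(2) by (auto simp: dist_real_def)
          have "norm ((v - u) *\<^sub>R f' x - (f v - f u)) = norm ((f u - f x - (u - x) *\<^sub>R f' x) - (f v - f x - (v - x) *\<^sub>R f' x))"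
            by (auto simp: algebra_simps)
          also have "\<dots> \<le> e1 * (x - u) + e1 * (v - x)"
            using norm_triangle_ineq4 du dv by (smt (verit))
          finally show "norm (measure lborel K *\<^sub>R g x - (f (Sup K) - f (Inf K))) \<le> e1 * (Sup K - Inf K)"
            using uv xK by (simp add: g_def algebra_simps)
        qed
        also have "\<dots> \<le> (\<Sum>(x,K)\<in>p. e1 * (Sup K - Inf K))"
        proof (rule sum_mono2[OF pD(1) p12(5)])
          fix b assume "b \<in> p - p1"
          then show "0 \<le> (case b of (x, K) \<Rightarrow> e1 * (Sup K - Inf K))"
            using K[of "fst b" "snd b"] e1(1) by (cases b) auto
        qed
        also have "\<dots> = e1 * (b - a)"
          using additive_tagged_division_1[OF ab p, of "\<lambda>x. x"] by (simp add: sum_distrib_left[symmetric] case_prod_unfold)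
        finally show ?thesis using e1(2) by linarith
      qed
      also have "(\<Sum>(x,K)\<in>p2. norm (measure lborel K *\<^sub>R g x - (f (Sup K) - f (Inf K)))) < e/2"
      proof -
        obtain n l r where no: "nonoverlapping a b n l r" "\<forall>i<n. \<exists>q\<in>p2. l i = Inf (snd q) \<and> r i = Sup (snd q)"
          "\<forall>h. (\<Sum>i<n. h (l i) (r i)) = (\<Sum>q\<in>p2. h (Inf (snd q)) (Sup (snd q)) :: real)"
        proof (rule nonoverlapping_enumeration[OF p12(4), of a "\<lambda>q. Inf (snd q)" "\<lambda>q. Sup (snd q)" b])
          show "a \<le> Inf (snd q) \<and> Inf (snd q) \<le> Sup (snd q) \<and> Sup (snd q) \<le> b" if q2: "q \<in> p2" for q
          proof -
            have "(fst q, snd q) \<in> p" using q2 p12(6) by auto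
            then obtain u v where "snd q = {u..v}" "u \<le> fst q" "fst q \<le> v" "a \<le> u" "v \<le> b" using K by blast
            then show ?thesis by auto
          qed
          show "{Inf (snd q)<..<Sup (snd q)} \<inter> {Inf (snd q')<..<Sup (snd q')} = {}"
            if qq: "q \<in> p2" "q' \<in> p2" "q \<noteq> q'" for q q'
          proof -
            obtain x K x' K' where q: "q = (x,K)" "q' = (x',K')" by (cases q, cases q')
            have m: "(x,K) \<in> p" "(x',K') \<in> p" using qq q p12(6) by auto
            have "interior K \<inter> interior K' = {}" using pD(5)[OF m] qq q by auto
            then show ?thesis using K[OF m(1)] K[OF m(2)] unfolding q by auto
          qed
        qed
        have "{l i<..<r i} \<subseteq> U" if i: "i < n" for i
        proof -
          obtain q where q: "q \<in> p2" "l i = Inf (snd q)" "r i = Sup (snd q)" using no(2)[rule_format, OF i] by blast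
          obtain x K where xK: "q = (x,K)" by (cases q)
          have m: "(x,K) \<in> p" "x \<in> N" using q xK by (auto simp: p2_def)
          then have "K \<subseteq> U" using fineD[OF fine m(1)] by (simp add: \<gamma>_def)
          then show ?thesis using K[OF m(1)] q xK by auto
        qed
        then have "(\<Sum>i<n. r i - l i) \<le> measure lebesgue U"
          by (intro nonoverlapping_length_le[OF no(1) U(3)])
        then have "(\<Sum>i<n. norm (f (r i) - f (l i))) < e/2" using U by (intro \<delta>(2)[OF no(1)]) auto
        also have "(\<Sum>i<n. norm (f (r i) - f (l i))) = (\<Sum>(x,K)\<in>p2. norm (measure lborel K *\<^sub>R g x - (f (Sup K) - f (Inf K))))"
          unfolding no(3)[rule_format, of "\<lambda>u v. norm (f v - f u)"]
          by (intro sum.cong) (auto simp: p2_def g_def norm_minus_commute)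
        finally show ?thesis .
      qed
      finally show ?thesis by simp
    qed
    moreover have "gauge \<gamma>" using U d(1) by (auto simp: gauge_def \<gamma>_def)
    ultimately show "\<exists>\<gamma>. gauge \<gamma> \<and> (\<forall>\<D>. \<D> tagged_division_of {a..b} \<and> \<gamma> fine \<D> \<longrightarrow>
        norm ((\<Sum>(x, k)\<in>\<D>. measure lborel k *\<^sub>R g x) - (f b - f a)) < e)" by blast
  qed
  then show ?thesis
    by (rule has_integral_spike[OF N, rotated]) (auto simp: g_def)
qed

theorem abs_continuous_on_vector_derivative:
  fixes f :: "real \<Rightarrow> 'b::euclidean_space"
  assumes f: "abs_continuous_on a b f" and ab: "a \<le> b"
  shows "((\<lambda>x. vector_derivative f (at x)) has_integral (f b - f a)) {a..b}"
    and "(\<lambda>x. vector_derivative f (at x)) absolutely_integrable_on {a..b}"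
proof -
  let ?f' = "\<lambda>x. vector_derivative f (at x)"
  define N where "N = {x \<in> {a<..<b}. \<not> f differentiable (at x)} \<union> {a,b}"
  have N: "negligible N"
    unfolding N_def by (intro negligible_Un abs_continuous_on_differentiable_AE[OF f ab]) auto
  have int: "(?f' has_integral (f v - f u)) {u..v}" if "a \<le> u" "u \<le> v" "v \<le> b" for u v
  proof (rule abs_continuous_on_has_integral[OF abs_continuous_on_subinterval[OF f that(1,3)] that(2) N])
    fix x assume "x \<in> {u..v} - N"
    then have "f differentiable (at x)" using that by (auto simp: N_def)
    then show "(f has_vector_derivative ?f' x) (at x within {u..v})"
      unfolding vector_derivative_works by (rule has_vector_derivative_at_within)
  qed
  show "(?f' has_integral (f b - f a)) {a..b}" using int ab by auto
  obtain B where B: "\<And>s. s \<in> family_variation f a b \<Longrightarrow> s \<le> B"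
    using abs_continuous_on_bounded_variation[OF f ab] by (auto simp: bdd_above_def)
  have "?f' absolutely_integrable_on cbox a b"
  proof (rule bounded_variation_absolutely_integrable_interval[where B=B])
    show "?f' integrable_on cbox a b" using int[of a b] ab by (auto simp: integrable_on_def)
    fix d assume d: "d division_of cbox a b"
    note dD = division_ofD[OF d]
    have K: "\<exists>u v. K = {u..v} \<and> u \<le> v \<and> a \<le> u \<and> v \<le> b" if "K \<in> d" for K
      using dD(2,3,4)[OF that] by fastforce
    obtain n l r where no: "nonoverlapping a b n l r"
      "\<forall>h. (\<Sum>i<n. h (l i) (r i)) = (\<Sum>K\<in>d. h (Inf K) (Sup K) :: real)"
    proof (rule nonoverlapping_enumeration[OF dD(1), of a Inf Sup b])
      show "a \<le> Inf K \<and> Inf K \<le> Sup K \<and> Sup K \<le> b" if "K \<in> d" for K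
        using K[OF that] by auto
      show "{Inf K<..<Sup K} \<inter> {Inf K'<..<Sup K'} = {}" if k: "K \<in> d" "K' \<in> d" "K \<noteq> K'" for K K'
        using dD(5)[OF k] K[OF k(1)] K[OF k(2)] by auto
    qed
    have "(\<Sum>K\<in>d. norm (integral K ?f')) = (\<Sum>K\<in>d. norm (f (Sup K) - f (Inf K)))"
    proof (rule sum.cong)
      fix K assume "K \<in> d"
      then obtain u v where "K = {u..v}" "u \<le> v" "a \<le> u" "v \<le> b" using K by blast
      then show "norm (integral K ?f') = norm (f (Sup K) - f (Inf K))"
        using integral_unique[OF int[of u v]] by simp
    qed simp
    also have "\<dots> = (\<Sum>i<n. norm (f (r i) - f (l i)))" using no(2)[rule_format, of "\<lambda>u v. norm (f v - f u)"] by simp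
    also have "\<dots> \<le> B" by (intro B family_variationI no(1))
    finally show "(\<Sum>K\<in>d. norm (integral K ?f')) \<le> B" .
  qed
  then show "?f' absolutely_integrable_on {a..b}" by simp
qed

lemma abs_continuous_on_nn_integral:
  fixes f :: "real \<Rightarrow> 'b::euclidean_space"
  assumes f: "abs_continuous_on a b f" and ab: "a \<le> b"
  shows "(\<integral>\<^sup>+x\<in>{a..b}. ennreal (norm (vector_derivative f (at x))) \<partial>lebesgue) < \<infinity>"
    and "ennreal (norm (f b - f a)) \<le> (\<integral>\<^sup>+x\<in>{a..b}. ennreal (norm (vector_derivative f (at x))) \<partial>lebesgue)"
proof -
  let ?f' = "\<lambda>x. vector_derivative f (at x)"
  have ai: "?f' absolutely_integrable_on {a..b}" by (rule abs_continuous_on_vector_derivative[OF f ab])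
  have eq: "(\<integral>\<^sup>+x\<in>{a..b}. ennreal (norm (?f' x)) \<partial>lebesgue) = ennreal (LINT x:{a..b}|lebesgue. norm (?f' x))"
  proof -
    have "integrable lebesgue (\<lambda>x. norm (indicator {a..b} x *\<^sub>R ?f' x))"
      using ai unfolding set_integrable_def by (rule integrable_norm)
    then have "(\<integral>\<^sup>+x. ennreal (norm (indicat_real {a..b} x *\<^sub>R ?f' x)) \<partial>lebesgue) = ennreal (\<integral>x. norm (indicator {a..b} x *\<^sub>R ?f' x) \<partial>lebesgue)"
      by (intro nn_integral_eq_integral) auto
    moreover have "(\<integral>\<^sup>+x\<in>{a..b}. ennreal (norm (?f' x)) \<partial>lebesgue) = (\<integral>\<^sup>+x. ennreal (norm (indicator {a..b} x *\<^sub>R ?f' x)) \<partial>lebesgue)"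
      by (intro nn_integral_cong) (auto simp: indicator_def)
    ultimately show ?thesis by (simp add: set_lebesgue_integral_def)
  qed
  show "(\<integral>\<^sup>+x\<in>{a..b}. ennreal (norm (?f' x)) \<partial>lebesgue) < \<infinity>" unfolding eq by simp
  have "f b - f a = (LINT x:{a..b}|lebesgue. ?f' x)"
    using abs_continuous_on_vector_derivative(1)[OF f ab] ai
    by (metis has_integral_unique has_integral_set_lebesgue)
  then have "norm (f b - f a) \<le> (LINT x:{a..b}|lebesgue. norm (?f' x))"
    using set_integral_norm_bound[OF ai] by simp
  then show "ennreal (norm (f b - f a)) \<le> (\<integral>\<^sup>+x\<in>{a..b}. ennreal (norm (?f' x)) \<partial>lebesgue)"
    unfolding eq by (rule ennreal_leI)
qed

lemma abs_continuous_on_nn_integral_scaled: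
  fixes f :: "real \<Rightarrow> 'b::euclidean_space"
  assumes f: "abs_continuous_on a b f" and ab: "a \<le> b" and c: "c \<ge> 0"
  shows "(\<integral>\<^sup>+x\<in>{a..b}. ennreal (c * norm (vector_derivative f (at x))) \<partial>lebesgue) < \<infinity>"
    and "ennreal (c * norm (f b - f a)) \<le> (\<integral>\<^sup>+x\<in>{a..b}. ennreal (c * norm (vector_derivative f (at x))) \<partial>lebesgue)"
proof -
  let ?f' = "\<lambda>x. vector_derivative f (at x)"
  have "?f' absolutely_integrable_on {a..b}" by (rule abs_continuous_on_vector_derivative[OF f ab])
  then have "(\<lambda>x. norm (indicat_real {a..b} x *\<^sub>R ?f' x)) \<in> borel_measurable lebesgue"
    unfolding set_integrable_def by (rule borel_measurable_integrable[OF integrable_norm])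
  then have m: "(\<lambda>x. ennreal (norm (indicat_real {a..b} x *\<^sub>R ?f' x))) \<in> borel_measurable lebesgue"
    by (rule measurable_compose[OF _ measurable_ennreal])
  have *: "(\<lambda>x. ennreal (norm (indicat_real {a..b} x *\<^sub>R ?f' x))) = (\<lambda>x. ennreal (norm (?f' x)) * indicator {a..b} x)"
    by (auto simp: indicator_def)
  have "(\<integral>\<^sup>+x\<in>{a..b}. ennreal (c * norm (?f' x)) \<partial>lebesgue) =
    (\<integral>\<^sup>+x. ennreal c * (ennreal (norm (?f' x)) * indicator {a..b} x) \<partial>lebesgue)"
    using c by (intro nn_integral_cong) (auto simp: ennreal_mult indicator_def)
  also have "\<dots> = ennreal c * (\<integral>\<^sup>+x\<in>{a..b}. ennreal (norm (?f' x)) \<partial>lebesgue)"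
    using m unfolding * by (rule nn_integral_cmult)
  finally have eq: "(\<integral>\<^sup>+x\<in>{a..b}. ennreal (c * norm (?f' x)) \<partial>lebesgue) =
    ennreal c * (\<integral>\<^sup>+x\<in>{a..b}. ennreal (norm (?f' x)) \<partial>lebesgue)" .
  show "(\<integral>\<^sup>+x\<in>{a..b}. ennreal (c * norm (?f' x)) \<partial>lebesgue) < \<infinity>"
    unfolding eq using abs_continuous_on_nn_integral(1)[OF f ab] by (simp add: ennreal_mult_less_top)
  show "ennreal (c * norm (f b - f a)) \<le> (\<integral>\<^sup>+x\<in>{a..b}. ennreal (c * norm (?f' x)) \<partial>lebesgue)"
    unfolding eq by (subst ennreal_mult[OF c norm_ge_zero]) (intro mult_left_mono abs_continuous_on_nn_integral(2)[OF f ab], simp)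
qed

section \<open>Continuously differentiable maps\<close>

lemma continuous_on_directional:
  fixes A :: "'a::topological_space \<Rightarrow> 'e::euclidean_space \<Rightarrow> 'b::real_normed_vector"
  assumes cont: "\<And>v. continuous_on S (\<lambda>x. A x v)" and lin: "\<And>x. x \<in> S \<Longrightarrow> linear (A x)"
  shows "continuous_on (S \<times> UNIV) (\<lambda>(x, w). A x w)"
proof -
  have eq: "A x w = (\<Sum>b\<in>Basis. (w \<bullet> b) *\<^sub>R A x b)" if "x \<in> S" for x w
  proof -
    interpret linear "A x" by (rule lin[OF that])
    have "A x w = A x (\<Sum>b\<in>Basis. (w \<bullet> b) *\<^sub>R b)" by (simp add: euclidean_representation)
    also have "\<dots> = (\<Sum>b\<in>Basis. (w \<bullet> b) *\<^sub>R A x b)" by (simp only: sum scale)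
    finally show ?thesis .
  qed
  have "continuous_on (S \<times> UNIV) (\<lambda>z. \<Sum>b\<in>Basis. (snd z \<bullet> b) *\<^sub>R A (fst z) b)"
    by (intro continuous_intros continuous_on_compose2[OF cont continuous_on_fst[OF continuous_on_id]]) auto
  then show ?thesis
    by (rule continuous_on_cong[THEN iffD1, rotated -1]) (auto simp: eq)
qed

text \<open>Continuity of the derivative is required in each fixed direction only, as in \<open>Ck_on\<close> and \<open>C1_on\<close>; in finite
dimension this amounts to joint continuity (\<open>continuous_on_directional\<close>).\<close>

definition directionally_C1 :: "'e::euclidean_space set \<Rightarrow> ('e \<Rightarrow> 'b::real_normed_vector) \<Rightarrow> bool" where
  "directionally_C1 S f \<longleftrightarrow> open S \<and> (\<forall>x\<in>S. f differentiable (at x)) \<and>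
     (\<forall>v. continuous_on S (\<lambda>x. frechet_derivative f (at x) v))"

lemma directionally_C1_lipschitz:
  fixes f :: "'e::euclidean_space \<Rightarrow> 'b::real_normed_vector"
  assumes f: "directionally_C1 S f" and x: "x \<in> S"
  obtains r B where "r > 0" "cball x r \<subseteq> S"
    "\<And>y z. y \<in> cball x r \<Longrightarrow> z \<in> cball x r \<Longrightarrow> norm (f y - f z) \<le> B * norm (y - z)"
proof -
  let ?D = "\<lambda>x. frechet_derivative f (at x)"
  have S: "open S" "\<And>x. x \<in> S \<Longrightarrow> (f has_derivative ?D x) (at x)"
    "\<And>v. continuous_on S (\<lambda>x. ?D x v)"
    using f by (auto simp: directionally_C1_def frechet_derivative_works)
  obtain r where r: "r > 0" "cball x r \<subseteq> S" using S(1) x open_contains_cball by blast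
  have lin: "linear (?D y)" if "y \<in> S" for y using S(2)[OF that] by (rule has_derivative_linear)
  have "continuous_on (cball x r \<times> sphere 0 1) (\<lambda>(y, w). ?D y w)"
    using continuous_on_directional[OF S(3) lin] by (rule continuous_on_subset) (use r in auto)
  then have "compact ((\<lambda>(y, w). ?D y w) ` (cball x r \<times> sphere 0 1))"
    by (intro compact_continuous_image compact_Times) auto
  then obtain B where B: "\<And>y w. y \<in> cball x r \<Longrightarrow> norm w = 1 \<Longrightarrow> norm (?D y w) \<le> B"
    using compact_imp_bounded by (force simp: bounded_iff)
  have bound: "norm (?D y w) \<le> B * norm w" if y: "y \<in> cball x r" for y w
  proof (cases "w = 0")
    case True
    then show ?thesis using linear_0[OF lin[of y]] y r by auto
  next
    case False
    have "norm (?D y (w /\<^sub>R norm w)) \<le> B" using False by (intro B y) simp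
    moreover have "?D y (w /\<^sub>R norm w) = ?D y w /\<^sub>R norm w"
      using y r by (intro linear_scale lin) auto
    ultimately show ?thesis using False by (simp add: field_simps)
  qed
  show ?thesis
  proof (rule that[OF r])
    have der: "(f has_derivative ?D u) (at u within cball x r)" if "u \<in> cball x r" for u
    proof -
      have "u \<in> S" using that r(2) by (rule subsetD[rotated])
      then show ?thesis by (rule has_derivative_at_withinI[OF S(2)])
    qed
    have on: "onorm (?D u) \<le> B" if "u \<in> cball x r" for u
      using bound[OF that] by (rule onorm_le)
    show "norm (f y - f z) \<le> B * norm (y - z)" if "y \<in> cball x r" "z \<in> cball x r" for y z
      using differentiable_bound[where f'="?D", OF convex_cball der on that] .
  qed
qed

lemma abs_continuous_on_compose_C1:
  fixes f :: "real \<Rightarrow> 'e::euclidean_space" and g :: "'e \<Rightarrow> 'b::real_normed_vector"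
  assumes f: "abs_continuous_on a b f" and ab: "a \<le> b" and g: "directionally_C1 S g" and S: "f ` {a..b} \<subseteq> S"
  shows "abs_continuous_on a b (\<lambda>x. g (f x))"
proof (rule abs_continuous_on_local[OF ab])
  fix x assume x: "a \<le> x" "x \<le> b"
  then obtain r B where r: "r > 0"
    "\<And>y z. y \<in> cball (f x) r \<Longrightarrow> z \<in> cball (f x) r \<Longrightarrow> norm (g y - g z) \<le> B * norm (y - z)"
  proof -
    have "f x \<in> S" using S x by auto
    then show ?thesis using directionally_C1_lipschitz[OF g] that by (metis (no_types, lifting))
  qed
  obtain d where d: "d > 0" "\<And>y. y \<in> {a..b} \<Longrightarrow> dist y x < d \<Longrightarrow> dist (f y) (f x) < r"
    using abs_continuous_on_imp_continuous_on[OF f] x r(1) unfolding continuous_on_iff by (metis atLeastAtMost_iff)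
  show "\<exists>d>0. \<forall>u v. u \<le> x \<and> x \<le> v \<and> v - u < d \<and> a \<le> u \<and> v \<le> b \<longrightarrow> abs_continuous_on u v (\<lambda>x. g (f x))"
  proof (intro exI[of _ d] conjI allI impI d(1))
    fix u v assume uv: "u \<le> x \<and> x \<le> v \<and> v - u < d \<and> a \<le> u \<and> v \<le> b"
    have fb: "f y \<in> cball (f x) r" if "u \<le> y" "y \<le> v" for y
      using d(2)[of y] uv that by (force simp: dist_real_def dist_commute)
    show "abs_continuous_on u v (\<lambda>x. g (f x))"
      using uv
      by (intro abs_continuous_on_dominated[OF abs_continuous_on_subinterval[OF f], where B=B])
        (auto intro!: r(2) fb)
  qed
qed

section \<open>Charts and tangent vectors\<close>

context smooth_manifold
begin

lemma chartD:
  assumes "(U, \<phi>) \<in> atlas"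
  shows "open U" "open (\<phi> ` U)" "continuous_on U \<phi>" "continuous_on (\<phi> ` U) (inv_into U \<phi>)"
    "\<And>x. x \<in> U \<Longrightarrow> inv_into U \<phi> (\<phi> x) = x"
    "\<And>x. x \<in> \<phi> ` U \<Longrightarrow> inv_into U \<phi> x \<in> U" "\<And>x. x \<in> \<phi> ` U \<Longrightarrow> \<phi> (inv_into U \<phi> x) = x"
  using chart[OF assms] by (auto simp: homeomorphism_def f_inv_into_f inv_into_into)

lemma charts_at_iff: "(U, \<phi>) \<in> charts_at q \<longleftrightarrow> (U, \<phi>) \<in> atlas \<and> q \<in> U"
  by (auto simp: charts_at_def)

lemma charts_at_nonempty: obtains U \<phi> where "(U, \<phi>) \<in> charts_at q"
proof -
  have "q \<in> (\<Union>c\<in>atlas. fst c)" using cover by simp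
  then obtain c where "c \<in> atlas" "q \<in> fst c" by blast
  then show ?thesis using that[of "fst c" "snd c"] by (simp add: charts_at_def)
qed

lemma open_chart_image:
  assumes "(U, \<phi>) \<in> atlas" "open W"
  shows "open (\<phi> ` (U \<inter> W))"
proof -
  have "openin (top_of_set (\<phi> ` U)) (\<phi> ` (U \<inter> W))"
    using assms chart[OF assms(1)]
    by (intro homeomorphism_imp_open_map[of U "\<phi> ` U" \<phi> "inv_into U \<phi>"]) (auto simp: openin_open)
  then show ?thesis using chartD(2)[OF assms(1)] openin_open_trans by blast
qed

lemma transition_C1:
  assumes "(U, \<phi>) \<in> atlas" "(V, \<psi>) \<in> atlas"
  shows "directionally_C1 (\<phi> ` (U \<inter> V)) (\<psi> \<circ> inv_into U \<phi>)"
proof -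
  have "Ck_on (Suc 0) (\<phi> ` (U \<inter> V)) (\<psi> \<circ> inv_into U \<phi>)"
    using compatible[OF assms] unfolding smooth_on_def by blast
  then show ?thesis
    unfolding directionally_C1_def
    using open_chart_image[OF assms(1), of V] chartD(1)[OF assms(2)] by simp
qed

lemma transition_has_derivative:
  assumes "(U, \<phi>) \<in> charts_at q" "(V, \<psi>) \<in> charts_at q"
  shows "((\<psi> \<circ> inv_into U \<phi>) has_derivative frechet_derivative (\<psi> \<circ> inv_into U \<phi>) (at (\<phi> q))) (at (\<phi> q))"
  using transition_C1[of U \<phi> V \<psi>] assms
  by (auto simp: directionally_C1_def charts_at_iff frechet_derivative_works[symmetric])

text \<open>Stated for maps \<open>h\<close> from any normed space: with \<open>h\<close> an inverse chart it is the cocycle rule for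
coordinate changes, and with \<open>h\<close> a curve it is the transformation rule for velocities.\<close>

lemma chart_change_has_derivative:
  fixes h :: "'a::real_normed_vector \<Rightarrow> 'q"
  assumes c: "(U, \<phi>) \<in> charts_at (h s)" "(V, \<psi>) \<in> charts_at (h s)" and h: "isCont h s"
    and d: "((\<phi> \<circ> h) has_derivative A) (at s)"
  shows "((\<psi> \<circ> h) has_derivative (\<lambda>w. frechet_derivative (\<psi> \<circ> inv_into U \<phi>) (at (\<phi> (h s))) (A w))) (at s)"
proof -
  have at: "(U, \<phi>) \<in> atlas" "(V, \<psi>) \<in> atlas" "h s \<in> U" "h s \<in> V" using c by (auto simp: charts_at_iff)
  have "((\<psi> \<circ> inv_into U \<phi>) \<circ> (\<phi> \<circ> h) has_derivative
      frechet_derivative (\<psi> \<circ> inv_into U \<phi>) (at (\<phi> (h s))) \<circ> A) (at s)"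
    using transition_has_derivative[OF c] by (intro diff_chain_at d) auto
  then have "((\<psi> \<circ> inv_into U \<phi>) \<circ> (\<phi> \<circ> h) has_derivative
      (\<lambda>w. frechet_derivative (\<psi> \<circ> inv_into U \<phi>) (at (\<phi> (h s))) (A w))) (at s)"
    unfolding comp_def[of "frechet_derivative _ _"] .
  moreover have "\<forall>\<^sub>F x in at s. ((\<psi> \<circ> inv_into U \<phi>) \<circ> (\<phi> \<circ> h)) x = (\<psi> \<circ> h) x"
  proof -
    have "\<forall>\<^sub>F x in at s. h x \<in> U"
      using topological_tendstoD[OF h[unfolded isCont_def] chartD(1)[OF at(1)] at(3)] .
    then show ?thesis by eventually_elim (simp add: chartD(5)[OF at(1)])
  qed
  ultimately show ?thesis
    by (rule has_derivative_transform_eventually) (simp_all add: chartD(5)[OF at(1,3)])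
qed

text \<open>The tangent vector at \<open>q\<close> with coordinate vector \<open>w\<close> in the chart \<open>(U, \<phi>)\<close>.\<close>

definition tangent_of :: "'q set \<Rightarrow> ('q \<Rightarrow> 'e) \<Rightarrow> 'q \<Rightarrow> 'e \<Rightarrow> ('q, 'e) tangent" where
  "tangent_of U \<phi> q w = (\<lambda>c. if c \<in> charts_at q
      then frechet_derivative (snd c \<circ> inv_into U \<phi>) (at (\<phi> q)) w else 0)"

lemma tangent_of_chart:
  assumes "(U, \<phi>) \<in> charts_at q"
  shows "tangent_of U \<phi> q w (U, \<phi>) = w"
proof -
  have at: "(U, \<phi>) \<in> atlas" "q \<in> U" using assms by (auto simp: charts_at_iff)
  have "((\<lambda>x. x) has_derivative (\<lambda>x. x)) (at (\<phi> q))" by (rule has_derivative_ident)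
  then have "((\<phi> \<circ> inv_into U \<phi>) has_derivative (\<lambda>x. x)) (at (\<phi> q))"
    by (rule has_derivative_transform_within_open[OF _ chartD(2)[OF at(1)]])
       (use at chartD(7)[OF at(1)] in auto)
  then have "frechet_derivative (\<phi> \<circ> inv_into U \<phi>) (at (\<phi> q)) = (\<lambda>x. x)"
    by (rule frechet_derivative_at[symmetric])
  then show ?thesis using assms by (simp add: tangent_of_def)
qed

lemma tangent_of_in_tangent_space:
  assumes c: "(U, \<phi>) \<in> charts_at q"
  shows "tangent_of U \<phi> q w \<in> tangent_space q"
proof -
  have at: "(U, \<phi>) \<in> atlas" "q \<in> U" using c by (auto simp: charts_at_iff)
  have "tangent_of U \<phi> q w (W, \<eta>) = frechet_derivative (\<eta> \<circ> inv_into V \<psi>) (at (\<psi> q)) (tangent_of U \<phi> q w (V, \<psi>))"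
    if cs: "(V, \<psi>) \<in> charts_at q" "(W, \<eta>) \<in> charts_at q" for V \<psi> W \<eta>
  proof -
    have q: "inv_into U \<phi> (\<phi> q) = q" using at chartD(5) by auto
    have ic: "isCont (inv_into U \<phi>) (\<phi> q)"
      using chartD(2,4)[OF at(1)] at(2) by (simp add: continuous_on_eq_continuous_at)
    have "((\<eta> \<circ> inv_into U \<phi>) has_derivative (\<lambda>w. frechet_derivative (\<eta> \<circ> inv_into V \<psi>) (at (\<psi> q))
        (frechet_derivative (\<psi> \<circ> inv_into U \<phi>) (at (\<phi> q)) w))) (at (\<phi> q))"
      using chart_change_has_derivative[of V \<psi> "inv_into U \<phi>" "\<phi> q" W \<eta>, OF _ _ ic transition_has_derivative[OF c cs(1)]] cs
      by (simp add: q)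
    then have "frechet_derivative (\<eta> \<circ> inv_into U \<phi>) (at (\<phi> q)) = (\<lambda>w. frechet_derivative (\<eta> \<circ> inv_into V \<psi>) (at (\<psi> q))
        (frechet_derivative (\<psi> \<circ> inv_into U \<phi>) (at (\<phi> q)) w))"
      by (rule frechet_derivative_at[symmetric])
    then show ?thesis using cs by (simp add: tangent_of_def)
  qed
  then have "\<forall>(V, \<psi>) \<in> charts_at q. \<forall>(W, \<eta>) \<in> charts_at q. tangent_of U \<phi> q w (W, \<eta>) =
      frechet_derivative (\<eta> \<circ> inv_into V \<psi>) (at (\<psi> q)) (tangent_of U \<phi> q w (V, \<psi>))" by blast
  moreover have "\<forall>c. c \<notin> charts_at q \<longrightarrow> tangent_of U \<phi> q w c = 0" by (simp add: tangent_of_def)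
  ultimately show ?thesis unfolding tangent_space_def mem_Collect_eq by (rule conjI[rotated])
qed

lemma tangent_of_surj:
  assumes "(U, \<phi>) \<in> charts_at q" "v \<in> tangent_space q"
  shows "v = tangent_of U \<phi> q (v (U, \<phi>))"
proof
  fix c
  have v: "\<forall>c. c \<notin> charts_at q \<longrightarrow> v c = 0"
    "\<forall>(U, \<phi>) \<in> charts_at q. \<forall>(V, \<psi>) \<in> charts_at q.
        v (V, \<psi>) = frechet_derivative (\<psi> \<circ> inv_into U \<phi>) (at (\<phi> q)) (v (U, \<phi>))"
    using assms(2) unfolding tangent_space_def by blast+
  show "v c = tangent_of U \<phi> q (v (U, \<phi>)) c"
  proof (cases "c \<in> charts_at q")
    case True
    then have "v c = frechet_derivative (snd c \<circ> inv_into U \<phi>) (at (\<phi> q)) (v (U, \<phi>))"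
      using bspec[OF v(2) assms(1)] by (cases c) auto
    then show ?thesis using True by (simp add: tangent_of_def)
  qed (use v(1)[rule_format, of c] in \<open>simp add: tangent_of_def\<close>)
qed

lemma tangent_of_linear:
  assumes c: "(U, \<phi>) \<in> charts_at q"
  shows "tangent_of U \<phi> q (a *\<^sub>R w) = (\<lambda>c. a *\<^sub>R tangent_of U \<phi> q w c)"
proof
  fix c' show "tangent_of U \<phi> q (a *\<^sub>R w) c' = a *\<^sub>R tangent_of U \<phi> q w c'"
    using linear_scale[OF has_derivative_linear[OF transition_has_derivative[OF c, of "fst c'" "snd c'"]]]
    by (auto simp: tangent_of_def)
qed

lemma tangent_of_eq_0_iff:
  assumes c: "(U, \<phi>) \<in> charts_at q"
  shows "tangent_of U \<phi> q w = (\<lambda>_. 0) \<longleftrightarrow> w = 0"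
proof
  assume "tangent_of U \<phi> q w = (\<lambda>_. 0)"
  then show "w = 0" using tangent_of_chart[OF c, of w] by simp
next
  assume "w = 0"
  then show "tangent_of U \<phi> q w = (\<lambda>_. 0)" using tangent_of_linear[OF c, of 0 0] by simp
qed

lemma velocity_chart:
  assumes c: "(U, \<phi>) \<in> charts_at (y s)" and s: "0 < s" "s < 1" and y: "isCont y s"
    and d: "(\<phi> \<circ> y has_vector_derivative w) (at s)"
  shows "velocity y s = tangent_of U \<phi> (y s) w"
proof
  fix c'
  show "velocity y s c' = tangent_of U \<phi> (y s) w c'"
  proof (cases "c' \<in> charts_at (y s)")
    case True
    obtain V \<psi> where c': "c' = (V, \<psi>)" by (cases c')
    let ?D = "frechet_derivative (\<psi> \<circ> inv_into U \<phi>) (at (\<phi> (y s)))"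
    have "((\<psi> \<circ> y) has_derivative (\<lambda>r. ?D (r *\<^sub>R w))) (at s)"
      using True c' chart_change_has_derivative[OF c _ y d[unfolded has_vector_derivative_def]] by blast
    moreover have "?D (r *\<^sub>R w) = r *\<^sub>R ?D w" for r
      using True c' by (intro linear_scale has_derivative_linear[OF transition_has_derivative[OF c]]) auto
    ultimately have "(\<psi> \<circ> y has_vector_derivative ?D w) (at s)"
      by (simp add: has_vector_derivative_def)
    then have "vector_derivative (\<psi> \<circ> y) (at s within {0..1}) = ?D w"
      using s by (intro vector_derivative_at_within_ivl[where a=0 and b=1]) auto
    then show ?thesis using True c' by (simp add: velocity_def tangent_of_def)
  qed (simp add: velocity_def tangent_of_def)
qed

text \<open>The local trivialisation of the tangent bundle. Through it the continuity of \<open>R1\<close> on the bundle becomes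
continuity of \<open>chart_norm\<close> in coordinates.\<close>

lemma continuous_map_tangent_of:
  assumes at: "(U, \<phi>) \<in> atlas"
  shows "continuous_map (top_of_set (\<phi> ` U \<times> UNIV)) tangent_topology
     (\<lambda>(x, w). (inv_into U \<phi> x, tangent_of U \<phi> (inv_into U \<phi> x) w))"
  unfolding tangent_topology_def
proof (rule continuous_on_generated_topo)
  let ?F = "\<lambda>(x, w). (inv_into U \<phi> x, tangent_of U \<phi> (inv_into U \<phi> x) w)"
  have ch: "(U, \<phi>) \<in> charts_at (inv_into U \<phi> x)" if "x \<in> \<phi> ` U" for x
    using chartD(6)[OF at that] at by (simp add: charts_at_iff)
  fix O1 assume "O1 \<in> {{(q, v) \<in> tangent_bundle. q \<in> V \<and> (\<psi> q, v (V, \<psi>)) \<in> W} | V \<psi> W.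
        (V, \<psi>) \<in> atlas \<and> open W}"
  then obtain V \<psi> W where O1: "O1 = {(q, v) \<in> tangent_bundle. q \<in> V \<and> (\<psi> q, v (V, \<psi>)) \<in> W}"
    and at': "(V, \<psi>) \<in> atlas" and W: "open W" by blast
  let ?D = "\<lambda>x. frechet_derivative (\<psi> \<circ> inv_into U \<phi>) (at x)"
  let ?S = "\<phi> ` (U \<inter> V)"
  have C1: "open ?S" "\<And>x. x \<in> ?S \<Longrightarrow> (\<psi> \<circ> inv_into U \<phi>) differentiable (at x)"
     "\<And>v. continuous_on ?S (\<lambda>x. ?D x v)"
    using transition_C1[OF at at'] by (auto simp: directionally_C1_def)
  have c1: "continuous_on (?S \<times> UNIV) (\<lambda>(x,w). ?D x w)"
    using C1 by (intro continuous_on_directional) (auto simp: frechet_derivative_works intro: has_derivative_linear)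
  have c2: "continuous_on ?S (\<psi> \<circ> inv_into U \<phi>)"
    using C1(2) by (intro differentiable_imp_continuous_on) (auto simp: differentiable_on_def intro: differentiable_at_withinI)
  have c3: "continuous_on (?S \<times> UNIV) (\<lambda>z. ((\<psi> \<circ> inv_into U \<phi>) (fst z), ?D (fst z) (snd z)))"
    using c1 by (intro continuous_intros continuous_on_compose2[OF c2]) (auto simp: case_prod_unfold)
  have iff: "x \<in> ?S \<longleftrightarrow> x \<in> \<phi> ` U \<and> inv_into U \<phi> x \<in> V" for x
    using chartD(5,6,7)[OF at] by (auto simp: image_iff)
  have "?F -` O1 \<inter> (\<phi> ` U \<times> UNIV) = (?S \<times> UNIV) \<inter> (\<lambda>z. ((\<psi> \<circ> inv_into U \<phi>) (fst z), ?D (fst z) (snd z))) -` W"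
  proof (intro set_eqI)
    fix z :: "'e \<times> 'e"
    obtain x w where z: "z = (x, w)" by (cases z)
    show "z \<in> ?F -` O1 \<inter> (\<phi> ` U \<times> UNIV) \<longleftrightarrow> z \<in> (?S \<times> UNIV) \<inter> (\<lambda>z. ((\<psi> \<circ> inv_into U \<phi>) (fst z), ?D (fst z) (snd z))) -` W"
    proof (cases "x \<in> ?S")
      case True
      then have x: "x \<in> \<phi> ` U" "inv_into U \<phi> x \<in> V" using iff by auto
      have "tangent_of U \<phi> (inv_into U \<phi> x) w (V, \<psi>) = ?D x w"
        using x at' chartD(7)[OF at x(1)] by (simp add: tangent_of_def charts_at_iff)
      then show ?thesis using x True tangent_of_in_tangent_space[OF ch[OF x(1)]]
        by (auto simp: z O1 tangent_bundle_def)
    next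
      case False
      then show ?thesis using iff by (auto simp: z O1)
    qed
  qed
  moreover have "open ((?S \<times> UNIV) \<inter> (\<lambda>z. ((\<psi> \<circ> inv_into U \<phi>) (fst z), ?D (fst z) (snd z))) -` W)"
    using c3 W C1(1) by (intro continuous_open_preimage open_Times) auto
  ultimately have "open (?F -` O1 \<inter> (\<phi> ` U \<times> UNIV))" by simp
  then show "openin (top_of_set (\<phi> ` U \<times> UNIV)) (?F -` O1 \<inter> topspace (top_of_set (\<phi> ` U \<times> UNIV)))"
    by (simp add: open_subset)
next
  have "(inv_into U \<phi> x, tangent_of U \<phi> (inv_into U \<phi> x) w)
    \<in> {(q, v) \<in> tangent_bundle. q \<in> U \<and> (\<phi> q, v (U, \<phi>)) \<in> UNIV}" if "x \<in> \<phi> ` U" for x w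
    using chartD(6)[OF at that] at
    by (auto simp: tangent_bundle_def charts_at_iff intro!: tangent_of_in_tangent_space)
  moreover have "{(q, v) \<in> tangent_bundle. q \<in> U \<and> (\<phi> q, v (U, \<phi>)) \<in> UNIV}
     \<in> {{(q, v) \<in> tangent_bundle. q \<in> U \<and> (\<phi> q, v (U, \<phi>)) \<in> W} |U \<phi> W. (U, \<phi>) \<in> atlas \<and> open W}"
    using at open_UNIV by blast
  ultimately show "(\<lambda>(x, w). (inv_into U \<phi> x, tangent_of U \<phi> (inv_into U \<phi> x) w)) ` topspace (top_of_set (\<phi> ` U \<times> UNIV))
    \<subseteq> \<Union> {{(q, v) \<in> tangent_bundle. q \<in> U \<and> (\<phi> q, v (U, \<phi>)) \<in> W} |U \<phi> W. (U, \<phi>) \<in> atlas \<and> open W}"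
    by (intro image_subsetI) (clarsimp simp del: UNIV_I, blast)
qed

end

section \<open>Absolutely continuous curves in a manifold\<close>

lemma continuous_curve_local:
  fixes y :: "real \<Rightarrow> 'q::topological_space"
  assumes y: "continuous_on {0..1} y" and s: "0 \<le> s" "s \<le> 1" and G: "open G" "y s \<in> G"
  obtains e where "e > 0" "\<And>u v. u \<le> s \<Longrightarrow> s \<le> v \<Longrightarrow> v - u < e \<Longrightarrow> 0 \<le> u \<Longrightarrow> v \<le> 1 \<Longrightarrow> y ` {u..v} \<subseteq> G"
proof -
  obtain A where A: "open A" "s \<in> A" "\<And>x. x \<in> {0..1} \<Longrightarrow> x \<in> A \<Longrightarrow> y x \<in> G"
    using y[unfolded continuous_on_topological, rule_format, of s G] s G by auto
  then obtain e where e: "e > 0" "ball s e \<subseteq> A" using open_contains_ball by blast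
  show ?thesis
  proof (rule that[OF e(1)])
    fix u v assume uv: "u \<le> s" "s \<le> v" "v - u < e" "0 \<le> u" "v \<le> 1"
    show "y ` {u..v} \<subseteq> G"
    proof (rule image_subsetI)
      fix x assume x: "x \<in> {u..v}"
      then have "x \<in> ball s e" using uv by (auto simp: dist_real_def)
      then show "y x \<in> G" using A(3)[of x] e(2) x uv by auto
    qed
  qed
qed

context smooth_manifold
begin

lemma ac_curvesD:
  assumes "y \<in> ac_curves"
  shows "continuous_on {0..1} y"
    "\<And>U \<phi> a b. (U, \<phi>) \<in> atlas \<Longrightarrow> 0 \<le> a \<Longrightarrow> a \<le> b \<Longrightarrow> b \<le> 1 \<Longrightarrow> y ` {a..b} \<subseteq> U \<Longrightarrow> abs_continuous_on a b (\<phi> \<circ> y)"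
  using assms unfolding ac_curves_def by blast+

lemma ac_curvesI:
  assumes "continuous_on {0..1} y"
    "\<And>U \<phi> a b. (U, \<phi>) \<in> atlas \<Longrightarrow> 0 \<le> a \<Longrightarrow> a \<le> b \<Longrightarrow> b \<le> 1 \<Longrightarrow> y ` {a..b} \<subseteq> U \<Longrightarrow> abs_continuous_on a b (\<phi> \<circ> y)"
  shows "y \<in> ac_curves"
  using assms unfolding ac_curves_def by blast

text \<open>At a regular time the velocity is a genuine tangent vector. Elsewhere \<open>vector_derivative\<close> is an
unspecified value, so that scaling laws for \<open>velocity\<close> and \<open>speed\<close> fail.\<close>

definition regular_time :: "(real \<Rightarrow> 'q) \<Rightarrow> real \<Rightarrow> bool" where
  "regular_time y s \<longleftrightarrow> 0 < s \<and> s < 1 \<and> isCont y s \<and>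
     (\<exists>U \<phi>. (U, \<phi>) \<in> charts_at (y s) \<and> (\<phi> \<circ> y) differentiable (at s))"

lemma regular_time_chart:
  assumes "regular_time y s" "(V, \<psi>) \<in> charts_at (y s)"
  shows "(\<psi> \<circ> y has_vector_derivative vector_derivative (\<psi> \<circ> y) (at s)) (at s)"
    and "velocity y s = tangent_of V \<psi> (y s) (vector_derivative (\<psi> \<circ> y) (at s))"
proof -
  obtain U \<phi> where c: "(U, \<phi>) \<in> charts_at (y s)" and s: "0 < s" "s < 1" and y: "isCont y s"
    and d: "(\<phi> \<circ> y) differentiable (at s)"
    using assms(1) unfolding regular_time_def by blast
  obtain A where A: "((\<phi> \<circ> y) has_derivative A) (at s)" using d by (auto simp: differentiable_def)
  have "(\<psi> \<circ> y) differentiable (at s)"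
    using chart_change_has_derivative[OF c assms(2) y A] by (auto simp: differentiable_def)
  then show 1: "(\<psi> \<circ> y has_vector_derivative vector_derivative (\<psi> \<circ> y) (at s)) (at s)"
    by (simp only: vector_derivative_works)
  show "velocity y s = tangent_of V \<psi> (y s) (vector_derivative (\<psi> \<circ> y) (at s))"
    by (rule velocity_chart[OF assms(2) s y 1])
qed

lemma regular_time_AE:
  assumes y: "y \<in> ac_curves"
  shows "negligible {s \<in> {0..1}. \<not> regular_time y s}"
proof -
  note yD = ac_curvesD[OF y]
  define B where "B = {s \<in> {0..1}. \<not> regular_time y s}"
  have cont: "isCont y s" if "0 < s" "s < 1" for s
    using continuous_on_interior[OF yD(1), of s] that by simp
  define P where "P u v \<longleftrightarrow> (0 \<le> u \<and> v \<le> 1 \<longrightarrow> negligible ({u..v} \<inter> B))" for u v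
  have "P 0 1"
  proof (rule Bolzano[of 0 1 P])
    show "P u w" if "P u v" "P v w" "u \<le> v" "v \<le> w" for u v w
    proof -
      have "{u..w} \<inter> B \<subseteq> ({u..v} \<inter> B) \<union> ({v..w} \<inter> B)" by auto
      then show ?thesis using that unfolding P_def
        by (meson negligible_Un negligible_subset order_trans)
    qed
    fix s :: real assume s: "0 \<le> s" "s \<le> 1"
    obtain U \<phi> where c: "(U, \<phi>) \<in> charts_at (y s)" by (rule charts_at_nonempty)
    then have at: "(U, \<phi>) \<in> atlas" "y s \<in> U" by (auto simp: charts_at_iff)
    obtain e where e: "e > 0" "\<And>u v. u \<le> s \<Longrightarrow> s \<le> v \<Longrightarrow> v - u < e \<Longrightarrow> 0 \<le> u \<Longrightarrow> v \<le> 1 \<Longrightarrow> y ` {u..v} \<subseteq> U"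
      using continuous_curve_local[OF yD(1) s chartD(1)[OF at(1)] at(2)] by blast
    show "\<exists>d>0. \<forall>a b. a \<le> s \<and> s \<le> b \<and> b - a < d \<longrightarrow> P a b"
    proof (intro exI[of _ e] conjI allI impI e(1))
      fix u v assume uv: "u \<le> s \<and> s \<le> v \<and> v - u < e"
      show "P u v"
        unfolding P_def
      proof
        assume 01: "0 \<le> u \<and> v \<le> 1"
        then have yU: "y ` {u..v} \<subseteq> U" using e(2) uv by blast
        then have ac: "abs_continuous_on u v (\<phi> \<circ> y)" using yD(2)[OF at(1)] uv 01 by auto
        have "negligible ({x \<in> {u<..<v}. \<not> (\<phi> \<circ> y) differentiable (at x)} \<union> {u,v})"
          using abs_continuous_on_differentiable_AE[OF ac] uv by (intro negligible_Un) auto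
        moreover have "{u..v} \<inter> B \<subseteq> {x \<in> {u<..<v}. \<not> (\<phi> \<circ> y) differentiable (at x)} \<union> {u,v}"
        proof
          fix x assume x: "x \<in> {u..v} \<inter> B"
          show "x \<in> {x \<in> {u<..<v}. \<not> (\<phi> \<circ> y) differentiable (at x)} \<union> {u,v}"
          proof (rule ccontr)
            assume no: "\<not> ?thesis"
            then have xx: "u < x" "x < v" "(\<phi> \<circ> y) differentiable (at x)" using x by auto
            moreover have "(U, \<phi>) \<in> charts_at (y x)" using yU xx at by (auto simp: charts_at_iff)
            ultimately have "regular_time y x"
              unfolding regular_time_def using 01 cont[of x] by auto
            then show False using x by (simp add: B_def)
          qed
        qed
        ultimately show "negligible ({u..v} \<inter> B)" by (rule negligible_subset)
      qed
    qed
  qed auto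
  then show ?thesis unfolding P_def B_def by (simp add: Int_def conj_commute conj_left_commute)
qed

lemma ac_curves_affine_piece:
  assumes y: "y \<in> ac_curves" and c: "c \<noteq> 0" and at: "(U, \<phi>) \<in> atlas" and ab: "a \<le> b"
    and rng: "\<And>x. a \<le> x \<Longrightarrow> x \<le> b \<Longrightarrow> 0 \<le> t + c * x \<and> t + c * x \<le> 1"
    and z: "\<And>x. a \<le> x \<Longrightarrow> x \<le> b \<Longrightarrow> z x = y (t + c * x)" and zU: "z ` {a..b} \<subseteq> U"
  shows "abs_continuous_on a b (\<phi> \<circ> z)"
proof -
  let ?l = "min (t + c * a) (t + c * b)" and ?r = "max (t + c * a) (t + c * b)"
  have mem: "?l \<le> t + c * x \<and> t + c * x \<le> ?r" if "a \<le> x" "x \<le> b" for x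
    using c that mult_left_mono[of a x c] mult_left_mono[of x b c] mult_left_mono_neg[of a x c] mult_left_mono_neg[of x b c]
    by linarith
  have "y u \<in> U" if "u \<in> {?l..?r}" for u
  proof -
    define x where "x = (u - t) / c"
    have u: "u = t + c * x" using c by (simp add: x_def)
    have "a \<le> x \<and> x \<le> b"
    proof (cases "c > 0")
      case True
      then have "c * a \<le> c * b" using ab by simp
      then have "c * a \<le> c * x \<and> c * x \<le> c * b" using that u by auto
      then show ?thesis using True by simp
    next
      case False
      then have c0: "c < 0" using c by simp
      then have "c * b \<le> c * a" using ab by simp
      then have "c * b \<le> c * x \<and> c * x \<le> c * a" using that u by auto
      then show ?thesis using c0 by simp
    qed
    then have "z x \<in> U" using zU by (intro subsetD[OF zU] imageI) simp
    then show ?thesis using z[of x] \<open>a \<le> x \<and> x \<le> b\<close> u by simp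
  qed
  then have "abs_continuous_on ?l ?r (\<phi> \<circ> y)"
    using rng[of a] rng[of b] ab by (intro ac_curvesD(2)[OF y at]) auto
  then have "abs_continuous_on a b (\<lambda>x. (\<phi> \<circ> y) (t + c * x))"
    by (rule abs_continuous_on_affine[OF _ c]) (use mem in auto)
  then show ?thesis by (rule abs_continuous_on_cong) (simp add: z)
qed

lemma ac_curves_reverse:
  assumes y: "y \<in> ac_curves"
  shows "(\<lambda>s. y (1 + (-1) * s)) \<in> ac_curves"
proof (rule ac_curvesI)
  show "continuous_on {0..1} (\<lambda>s. y (1 + (-1) * s))"
    by (intro continuous_on_compose2[OF ac_curvesD(1)[OF y]]) (auto intro!: continuous_intros)
qed (rule ac_curves_affine_piece[OF y, of "-1"], auto)

lemma ac_curves_glue: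
  assumes m: "0 \<le> m" "m \<le> 1" and cont: "continuous_on {0..1} z"
    and l: "\<And>U \<phi> a b. (U, \<phi>) \<in> atlas \<Longrightarrow> 0 \<le> a \<Longrightarrow> a \<le> b \<Longrightarrow> b \<le> m \<Longrightarrow> z ` {a..b} \<subseteq> U \<Longrightarrow> abs_continuous_on a b (\<phi> \<circ> z)"
    and r: "\<And>U \<phi> a b. (U, \<phi>) \<in> atlas \<Longrightarrow> m \<le> a \<Longrightarrow> a \<le> b \<Longrightarrow> b \<le> 1 \<Longrightarrow> z ` {a..b} \<subseteq> U \<Longrightarrow> abs_continuous_on a b (\<phi> \<circ> z)"
  shows "z \<in> ac_curves"
proof (rule ac_curvesI[OF cont])
  fix U \<phi> a b assume at: "(U, \<phi>) \<in> atlas" and ab: "0 \<le> a" "a \<le> b" "b \<le> 1" and zU: "z ` {a..b} \<subseteq> U"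
  consider "b \<le> m" | "m \<le> a" | "a \<le> m" "m \<le> b" by linarith
  then show "abs_continuous_on a b (\<phi> \<circ> z)"
  proof cases
    case 3
    have "z ` {a..m} \<subseteq> U" "z ` {m..b} \<subseteq> U" using zU 3 by auto
    then show ?thesis using 3 ab at by (intro abs_continuous_on_trans[of a m _ b] l r) auto
  qed (use at ab zU l r in auto)
qed

lemma ac_curves_const_piece:
  assumes "\<And>x. a \<le> x \<Longrightarrow> x \<le> b \<Longrightarrow> z x = p"
  shows "abs_continuous_on a b (\<phi> \<circ> z)"
  by (rule abs_continuous_on_cong[OF abs_continuous_on_const[of a b "\<phi> p"]]) (simp add: assms)

lemma velocity_const:
  assumes "0 \<le> a" "b \<le> 1" "a < s" "s < b" "\<And>x. a < x \<Longrightarrow> x < b \<Longrightarrow> z x = p"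
  shows "velocity z s = (\<lambda>_. 0)"
proof -
  obtain U \<phi> where c: "(U, \<phi>) \<in> charts_at (z s)" by (rule charts_at_nonempty)
  have "(\<phi> \<circ> z has_vector_derivative 0) (at s)"
    by (rule has_vector_derivative_transform_within_open[of "\<lambda>_. \<phi> p" _ _ "{a<..<b}"])
      (use assms in \<open>auto intro: derivative_eq_intros\<close>)
  moreover have "isCont z s"
  proof -
    have "continuous_on {a<..<b} z"
      by (rule continuous_on_cong[THEN iffD1, OF refl _ continuous_on_const[of _ p]]) (use assms in auto)
    then show ?thesis using assms by (simp add: continuous_on_eq_continuous_at)
  qed
  ultimately have "velocity z s = tangent_of U \<phi> (z s) 0"
    using assms c by (intro velocity_chart) auto
  then show ?thesis using tangent_of_eq_0_iff[OF c] by simp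
qed

lemma velocity_affine:
  assumes ab: "0 \<le> a" "b \<le> 1" "a < s" "s < b"
    and z: "\<And>x. a < x \<Longrightarrow> x < b \<Longrightarrow> z x = y (t + c * x)" and reg: "regular_time y (t + c * s)"
  shows "velocity z s = (\<lambda>k. c *\<^sub>R velocity y (t + c * s) k)"
proof -
  have zs: "z s = y (t + c * s)" using z ab by auto
  obtain U \<phi> where ch: "(U, \<phi>) \<in> charts_at (y (t + c * s))" by (rule charts_at_nonempty)
  let ?w = "vector_derivative (\<phi> \<circ> y) (at (t + c * s))"
  have "(\<phi> \<circ> y has_vector_derivative ?w) (at (t + c * s))" by (rule regular_time_chart[OF reg ch])
  moreover have "((\<lambda>x. t + c * x) has_vector_derivative c) (at s)"
    by (auto intro!: derivative_eq_intros)
  ultimately have "((\<phi> \<circ> y) \<circ> (\<lambda>x. t + c * x) has_vector_derivative (c *\<^sub>R ?w)) (at s)"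
    by (intro vector_diff_chain_at)
  then have d: "(\<phi> \<circ> z has_vector_derivative (c *\<^sub>R ?w)) (at s)"
    by (rule has_vector_derivative_transform_within_open[of _ _ _ "{a<..<b}"]) (use ab z in auto)
  have "isCont (\<lambda>x. y (t + c * x)) s"
    using reg unfolding regular_time_def by (intro continuous_at_compose[of s "\<lambda>x. t + c * x" y, unfolded comp_def]) (auto intro!: continuous_intros)
  moreover have "\<forall>\<^sub>F x in nhds s. y (t + c * x) = z x"
    using eventually_nhds_in_open[of "{a<..<b}" s] ab by (auto elim!: eventually_mono simp: z)
  ultimately have "isCont z s" by (simp add: isCont_cong)
  then have "velocity z s = tangent_of U \<phi> (z s) (c *\<^sub>R ?w)"
    using ab ch by (intro velocity_chart d) (auto simp: zs)
  also have "\<dots> = (\<lambda>k. c *\<^sub>R tangent_of U \<phi> (y (t + c * s)) ?w k)"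
    unfolding zs by (rule tangent_of_linear[OF ch])
  finally show ?thesis unfolding regular_time_chart(2)[OF reg ch] .
qed

lemma velocity_in_tangent_space:
  "regular_time y s \<Longrightarrow> velocity y s \<in> tangent_space (y s)"
  using charts_at_nonempty[of "y s"] regular_time_chart(2) tangent_of_in_tangent_space by metis

lemma zero_in_tangent_space: "(\<lambda>_. 0) \<in> tangent_space q"
  using charts_at_nonempty[of q] tangent_of_eq_0_iff tangent_of_in_tangent_space by metis

end

section \<open>Finsler length of curves\<close>

context finsler_manifold
begin

definition chart_norm :: "'q set \<Rightarrow> ('q \<Rightarrow> 'e) \<Rightarrow> 'e \<Rightarrow> 'e \<Rightarrow> real" where
  "chart_norm U \<phi> x w = R1 (inv_into U \<phi> x) (tangent_of U \<phi> (inv_into U \<phi> x) w)"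

lemma chart_norm_continuous:
  assumes at: "(U, \<phi>) \<in> atlas"
  shows "continuous_on (\<phi> ` U \<times> UNIV) (\<lambda>(x, w). chart_norm U \<phi> x w)"
proof -
  have "continuous_map (top_of_set (\<phi> ` U \<times> UNIV)) euclideanreal
     ((\<lambda>(q, v). R1 q v) \<circ> (\<lambda>(x, w). (inv_into U \<phi> x, tangent_of U \<phi> (inv_into U \<phi> x) w)))"
    by (rule continuous_map_compose[OF continuous_map_tangent_of[OF at] R1_continuous])
  then show ?thesis
    unfolding continuous_map_iff_continuous by (simp add: comp_def chart_norm_def case_prod_unfold)
qed

lemma chart_norm_scale:
  assumes "(U, \<phi>) \<in> atlas" "x \<in> \<phi> ` U"
  shows "chart_norm U \<phi> x (a *\<^sub>R w) = \<bar>a\<bar> * chart_norm U \<phi> x w"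
proof -
  have c: "(U, \<phi>) \<in> charts_at (inv_into U \<phi> x)"
    using chartD(6)[OF assms] assms(1) by (simp add: charts_at_iff)
  show ?thesis
    unfolding chart_norm_def tangent_of_linear[OF c] by (rule R1_scaleR[OF tangent_of_in_tangent_space[OF c]])
qed

text \<open>A continuous function that is positive on the compact product of a coordinate ball with the unit sphere is
bounded away from \<open>0\<close> and \<open>\<infinity>\<close> there; homogeneity does the rest.\<close>

lemma chart_norm_bounds:
  assumes c: "(U, \<phi>) \<in> charts_at p"
  obtains \<rho> m M where "\<rho> > 0" "m > 0" "M > 0" "cball (\<phi> p) \<rho> \<subseteq> \<phi> ` U"
    "\<And>x w. x \<in> cball (\<phi> p) \<rho> \<Longrightarrow> m * norm w \<le> chart_norm U \<phi> x w \<and> chart_norm U \<phi> x w \<le> M * norm w"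
proof -
  have at: "(U, \<phi>) \<in> atlas" "p \<in> U" using c by (auto simp: charts_at_iff)
  obtain \<rho> where \<rho>: "\<rho> > 0" "cball (\<phi> p) \<rho> \<subseteq> \<phi> ` U"
    using chartD(2)[OF at(1)] at(2) open_contains_cball by blast
  let ?K = "cball (\<phi> p) \<rho> \<times> sphere (0::'e) 1"
  let ?g = "\<lambda>(x, w). chart_norm U \<phi> x w"
  have cont: "continuous_on ?K ?g"
    by (rule continuous_on_subset[OF chart_norm_continuous[OF at(1)]]) (use \<rho> in auto)
  have comp: "compact ?K" by (intro compact_Times) auto
  have ne: "?K \<noteq> {}" using \<rho>(1) by auto
  obtain z0 where z0: "z0 \<in> ?K" "\<And>z. z \<in> ?K \<Longrightarrow> ?g z0 \<le> ?g z" using continuous_attains_inf[OF comp ne cont] by blast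
  obtain z1 where z1: "z1 \<in> ?K" "\<And>z. z \<in> ?K \<Longrightarrow> ?g z \<le> ?g z1" using continuous_attains_sup[OF comp ne cont] by blast
  have pos: "?g z > 0" if "z \<in> ?K" for z
  proof -
    obtain x w where z: "z = (x, w)" by (cases z)
    have x: "x \<in> \<phi> ` U" and w: "w \<noteq> 0" using that \<rho> z by auto
    have ch: "(U, \<phi>) \<in> charts_at (inv_into U \<phi> x)"
      using chartD(6)[OF at(1) x] at(1) by (simp add: charts_at_iff)
    note ts = tangent_of_in_tangent_space[OF ch, of w]
    have "R1 (inv_into U \<phi> x) (tangent_of U \<phi> (inv_into U \<phi> x) w) \<noteq> 0"
      using R1_eq_0_iff[OF ts] tangent_of_eq_0_iff[OF ch, of w] w by simp
    then show ?thesis using R1_nonneg[OF ts] by (simp add: z chart_norm_def)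
  qed
  show ?thesis
  proof (rule that[of \<rho> "?g z0" "?g z1"])
    fix x w assume x: "x \<in> cball (\<phi> p) \<rho>"
    show "?g z0 * norm w \<le> chart_norm U \<phi> x w \<and> chart_norm U \<phi> x w \<le> ?g z1 * norm w"
    proof (cases "w = 0")
      case True
      then show ?thesis using chart_norm_scale[OF at(1), of x 0 0] x \<rho> by auto
    next
      case False
      let ?u = "w /\<^sub>R norm w"
      have "(x, ?u) \<in> ?K" using x False by simp
      then have "?g z0 \<le> chart_norm U \<phi> x ?u" "chart_norm U \<phi> x ?u \<le> ?g z1" using z0(2) z1(2) by auto
      moreover have "chart_norm U \<phi> x w = norm w * chart_norm U \<phi> x ?u"
        using chart_norm_scale[OF at(1), of x "norm w" ?u] x \<rho> False by auto
      ultimately show ?thesis by (simp add: mult.commute mult_left_mono)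
    qed
  qed (use \<rho> pos z0(1) z1(1) in auto)
qed

lemma speed_chart:
  assumes "regular_time y s" "(U, \<phi>) \<in> charts_at (y s)"
  shows "speed y s = chart_norm U \<phi> (\<phi> (y s)) (vector_derivative (\<phi> \<circ> y) (at s))"
  using assms chartD(5)[of U \<phi> "y s"] regular_time_chart(2)[OF assms]
  by (simp add: speed_def chart_norm_def charts_at_iff)

lemma speed_nonneg: "regular_time y s \<Longrightarrow> speed y s \<ge> 0"
  unfolding speed_def by (intro R1_nonneg velocity_in_tangent_space)

definition curve_length :: "(real \<Rightarrow> 'q) \<Rightarrow> real \<Rightarrow> real \<Rightarrow> ennreal" where
  "curve_length y a b = (\<integral>\<^sup>+s\<in>{a..b}. ennreal (speed y s) \<partial>lebesgue)"

text \<open>Needed for \<open>d\<close> to separate points: \<open>enn2real\<close> maps \<open>\<infinity>\<close> to \<open>0\<close>, so two points that were joined only by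
curves of infinite length would have distance \<open>0\<close>.\<close>

lemma curve_length_finite:
  assumes y: "y \<in> ac_curves"
  shows "curve_length y 0 1 < \<infinity>"
proof -
  note yD = ac_curvesD[OF y]
  define P where "P u v \<longleftrightarrow> (0 \<le> u \<and> v \<le> 1 \<longrightarrow> curve_length y u v < \<infinity>)" for u v
  have "P 0 1"
  proof (rule Bolzano[of 0 1 P])
    show "P u w" if "P u v" "P v w" "u \<le> v" "v \<le> w" for u v w
      using that unfolding P_def curve_length_def by (subst nn_integral_Icc_split[of u v w]) auto
    fix s :: real assume s: "0 \<le> s" "s \<le> 1"
    obtain U \<phi> where c: "(U, \<phi>) \<in> charts_at (y s)" by (rule charts_at_nonempty)
    then have at: "(U, \<phi>) \<in> atlas" "y s \<in> U" by (auto simp: charts_at_iff)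
    obtain \<rho> m M where \<rho>: "\<rho> > 0" "m > 0" "M > 0" "cball (\<phi> (y s)) \<rho> \<subseteq> \<phi> ` U"
      "\<And>x w. x \<in> cball (\<phi> (y s)) \<rho> \<Longrightarrow> m * norm w \<le> chart_norm U \<phi> x w \<and> chart_norm U \<phi> x w \<le> M * norm w"
      using chart_norm_bounds[OF c] by metis
    define G where "G = U \<inter> \<phi> -` ball (\<phi> (y s)) \<rho>"
    have G: "open G" "y s \<in> G"
      unfolding G_def using continuous_open_preimage[OF chartD(3)[OF at(1)] chartD(1)[OF at(1)]] at \<rho> by auto
    obtain e where e: "e > 0" "\<And>u v. u \<le> s \<Longrightarrow> s \<le> v \<Longrightarrow> v - u < e \<Longrightarrow> 0 \<le> u \<Longrightarrow> v \<le> 1 \<Longrightarrow> y ` {u..v} \<subseteq> G"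
      using continuous_curve_local[OF yD(1) s G] by blast
    show "\<exists>d>0. \<forall>a b. a \<le> s \<and> s \<le> b \<and> b - a < d \<longrightarrow> P a b"
    proof (intro exI[of _ e] conjI allI impI e(1))
      fix u v assume uv: "u \<le> s \<and> s \<le> v \<and> v - u < e"
      show "P u v"
        unfolding P_def
      proof
        assume 01: "0 \<le> u \<and> v \<le> 1"
        then have yG: "y ` {u..v} \<subseteq> G" using e(2) uv by blast
        then have yU: "y ` {u..v} \<subseteq> U" by (auto simp: G_def)
        then have ac: "abs_continuous_on u v (\<phi> \<circ> y)" using yD(2)[OF at(1)] uv 01 by auto
        have "curve_length y u v \<le> (\<integral>\<^sup>+x\<in>{u..v}. ennreal (M * norm (vector_derivative (\<phi> \<circ> y) (at x))) \<partial>lebesgue)"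
          unfolding curve_length_def
        proof (rule nn_integral_mono_negligible[OF regular_time_AE[OF y]])
          fix x assume x: "x \<in> {u..v} - {s \<in> {0..1}. \<not> regular_time y s}"
          then have reg: "regular_time y x" using 01 by auto
          have "y x \<in> G" using x yG by auto
          then have xU: "(U, \<phi>) \<in> charts_at (y x)" "\<phi> (y x) \<in> cball (\<phi> (y s)) \<rho>"
            using at by (auto simp: G_def charts_at_iff)
          show "ennreal (speed y x) \<le> ennreal (M * norm (vector_derivative (\<phi> \<circ> y) (at x)))"
            unfolding speed_chart[OF reg xU(1)] using \<rho>(5)[OF xU(2)] by (intro ennreal_leI) auto
        qed
        also have "\<dots> < \<infinity>" using abs_continuous_on_nn_integral_scaled(1)[OF ac, of M] uv \<rho> by auto
        finally show "curve_length y u v < \<infinity>" .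
      qed
    qed
  qed auto
  then show ?thesis unfolding P_def by simp
qed

text \<open>Up to the first time at which it leaves the coordinate ball, the curve has coordinate length at least \<open>r\<close>,
and there the Finsler norm dominates \<open>m\<close> times the Euclidean one.\<close>

lemma chart_ball_escape:
  assumes c: "(U, \<phi>) \<in> charts_at p"
  obtains \<rho> m where "\<rho> > 0" "m > 0" "cball (\<phi> p) \<rho> \<subseteq> \<phi> ` U"
    "\<And>r y. 0 < r \<Longrightarrow> r \<le> \<rho> \<Longrightarrow> y \<in> ac_curves \<Longrightarrow> y 0 = p \<Longrightarrow> y 1 \<notin> U \<inter> \<phi> -` ball (\<phi> p) r \<Longrightarrow>
       ennreal (m * r) \<le> curve_length y 0 1"
proof -
  have at: "(U, \<phi>) \<in> atlas" "p \<in> U" using c by (auto simp: charts_at_iff)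
  obtain \<rho> m M where \<rho>: "\<rho> > 0" "m > 0" "M > 0" "cball (\<phi> p) \<rho> \<subseteq> \<phi> ` U"
      "\<And>x w. x \<in> cball (\<phi> p) \<rho> \<Longrightarrow> m * norm w \<le> chart_norm U \<phi> x w \<and> chart_norm U \<phi> x w \<le> M * norm w"
    using chart_norm_bounds[OF c] by metis
  show ?thesis
  proof (rule that[OF \<rho>(1,2,4)])
    fix r y assume r: "0 < r" "r \<le> \<rho>" and y: "y \<in> ac_curves" "y 0 = p" and y1: "y 1 \<notin> U \<inter> \<phi> -` ball (\<phi> p) r"
    note yD = ac_curvesD[OF y(1)]
    define B where "B = U \<inter> \<phi> -` ball (\<phi> p) r"
    define K where "K = inv_into U \<phi> ` cball (\<phi> p) r"
    have cb: "cball (\<phi> p) r \<subseteq> \<phi> ` U" using \<rho>(4) r by auto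
    have "open B" unfolding B_def by (rule continuous_open_preimage[OF chartD(3)[OF at(1)] chartD(1)[OF at(1)]]) simp
    have "compact K" unfolding K_def
      by (intro compact_continuous_image continuous_on_subset[OF chartD(4)[OF at(1)] cb]) auto
    then have "closed K" by (rule compact_imp_closed)
    have BK: "B \<subseteq> K"
    proof
      fix q assume "q \<in> B"
      then show "q \<in> K" unfolding K_def B_def using chartD(5)[OF at(1), of q] by (auto intro!: image_eqI[of q _ "\<phi> q"])
    qed
    have KU: "q \<in> U \<and> \<phi> q \<in> cball (\<phi> p) r" if q: "q \<in> K" for q
    proof -
      obtain x where x: "x \<in> cball (\<phi> p) r" "q = inv_into U \<phi> x" using q unfolding K_def by blast
      then have "x \<in> \<phi> ` U" using cb by blast
      then show ?thesis using x chartD(6,7)[OF at(1), of x] by simp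
    qed
    define S where "S = {0..1} \<inter> y -` (- B)"
    have "closed S" unfolding S_def
      using \<open>open B\<close> by (intro continuous_closed_preimage[OF yD(1)]) auto
    moreover have S1: "1 \<in> S" using y1 by (auto simp: S_def B_def)
    moreover have bdd: "bdd_below S" by (rule bdd_belowI[of _ 0]) (auto simp: S_def)
    ultimately have \<tau>S: "Inf S \<in> S" by (intro closed_contains_Inf) auto
    define \<tau> where "\<tau> = Inf S"
    have \<tau>: "0 \<le> \<tau>" "\<tau> \<le> 1" "y \<tau> \<notin> B" using \<tau>S by (auto simp: S_def \<tau>_def)
    have below: "y s \<in> B" if "0 \<le> s" "s < \<tau>" for s
    proof (rule ccontr)
      assume "y s \<notin> B"
      then have "s \<in> S" using that \<tau> by (auto simp: S_def)
      then show False using that bdd cInf_lower[of s S] by (simp add: \<tau>_def)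
    qed
    have "\<tau> \<noteq> 0" using \<tau>(3) y(2) at r by (auto simp: B_def)
    then have \<tau>0: "0 < \<tau>" using \<tau> by simp
    have "y ` closure {0..<\<tau>} \<subseteq> K"
      using \<tau> \<tau>0 below BK \<open>closed K\<close>
      by (intro image_closure_subset) (auto intro!: continuous_on_subset[OF yD(1)])
    then have yK: "y ` {0..\<tau>} \<subseteq> K" using \<tau>0 by simp
    then have yU: "y ` {0..\<tau>} \<subseteq> U" using KU by blast
    have ac: "abs_continuous_on 0 \<tau> (\<phi> \<circ> y)" using yD(2)[OF at(1)] \<tau> yU by auto
    have "y \<tau> \<in> K" using yK \<tau>0 by auto
    then have "r \<le> norm ((\<phi> \<circ> y) \<tau> - (\<phi> \<circ> y) 0)"
      using KU[of "y \<tau>"] \<tau>(3) y(2) by (auto simp: B_def dist_norm norm_minus_commute)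
    then have "ennreal (m * r) \<le> ennreal (m * norm ((\<phi> \<circ> y) \<tau> - (\<phi> \<circ> y) 0))"
      using \<rho>(2) by (intro ennreal_leI mult_left_mono) auto
    also have "\<dots> \<le> (\<integral>\<^sup>+x\<in>{0..\<tau>}. ennreal (m * norm (vector_derivative (\<phi> \<circ> y) (at x))) \<partial>lebesgue)"
      using \<rho>(2) \<tau> by (intro abs_continuous_on_nn_integral_scaled(2)[OF ac]) auto
    also have "\<dots> \<le> (\<integral>\<^sup>+x\<in>{0..\<tau>}. ennreal (speed y x) \<partial>lebesgue)"
    proof (rule nn_integral_mono_negligible[OF regular_time_AE[OF y(1)]])
      fix x assume x: "x \<in> {0..\<tau>} - {s \<in> {0..1}. \<not> regular_time y s}"
      then have reg: "regular_time y x" using \<tau> by auto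
      have "y x \<in> K" using x yK by auto
      then have xU: "(U, \<phi>) \<in> charts_at (y x)" "\<phi> (y x) \<in> cball (\<phi> p) \<rho>"
        using KU[of "y x"] at r by (auto simp: charts_at_iff)
      show "ennreal (m * norm (vector_derivative (\<phi> \<circ> y) (at x))) \<le> ennreal (speed y x)"
        unfolding speed_chart[OF reg xU(1)] using \<rho>(5)[OF xU(2)] by (intro ennreal_leI) auto
    qed
    also have "\<dots> \<le> curve_length y 0 1"
      unfolding curve_length_def using \<tau> by (intro nn_integral_mono) (auto simp: indicator_def)
    finally show "ennreal (m * r) \<le> curve_length y 0 1" .
  qed
qed

lemma curve_length_affine:
  assumes y: "y \<in> ac_curves" and ab: "0 \<le> a" "b \<le> 1" and c: "c \<noteq> 0"
    and z: "\<And>x. a < x \<Longrightarrow> x < b \<Longrightarrow> z x = y (t + c * x)"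
    and S: "\<And>x. x \<in> {a..b} \<longleftrightarrow> t + c * x \<in> S" and S01: "S \<subseteq> {0..1}"
  shows "curve_length z a b = (\<integral>\<^sup>+s\<in>S. ennreal (speed y s) \<partial>lebesgue)"
proof -
  have "(\<integral>\<^sup>+s\<in>S. ennreal (speed y s) \<partial>lebesgue)
     = (\<integral>\<^sup>+x. ennreal \<bar>c\<bar> * (ennreal (speed y (t + c * x)) * indicator S (t + c * x)) \<partial>lebesgue)"
    by (rule nn_integral_affine[OF c])
  also have "\<dots> = curve_length z a b"
    unfolding curve_length_def
  proof (rule nn_integral_cong_AE)
    \<comment> \<open>At the end points \<open>z\<close> may behave differently on the two sides.\<close>
    let ?N = "{s. t + c * s \<in> {s \<in> {0..1}. \<not> regular_time y s}} \<union> {a, b}"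
    have "negligible ?N" using negligible_affine_vimage[OF regular_time_AE[OF y] c] by (intro negligible_Un) auto
    then have "AE x in lebesgue. x \<notin> ?N" by (intro AE_not_in) (simp add: negligible_iff_null_sets)
    then show "AE x in lebesgue. ennreal \<bar>c\<bar> * (ennreal (speed y (t + c * x)) * indicator S (t + c * x))
       = ennreal (speed z x) * indicator {a..b} x"
    proof eventually_elim
      case (elim x)
      show ?case
      proof (cases "x \<in> {a..b}")
        case True
        then have xS: "t + c * x \<in> S" using S by blast
        then have reg: "regular_time y (t + c * x)" using elim S01 by auto
        have x: "a < x" "x < b" using True elim by auto
        have "velocity z x = (\<lambda>k. c *\<^sub>R velocity y (t + c * x) k)"
          by (rule velocity_affine[OF ab x z reg])
        then have "speed z x = \<bar>c\<bar> * speed y (t + c * x)"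
          unfolding speed_def using R1_scaleR[OF velocity_in_tangent_space[OF reg]] z x by simp
        then show ?thesis using True xS by (simp add: ennreal_mult')
      next
        case False
        then have "t + c * x \<notin> S" using S by blast
        then have "indicator S (t + c * x) = (0::ennreal)" "indicator {a..b} x = (0::ennreal)"
          using False by (simp_all only: indicator_eq_0_iff not_False_eq_True)
        then show ?thesis by (simp only: mult_zero_right)
      qed
    qed
  qed
  finally show ?thesis by simp
qed

lemma curve_length_const:
  assumes "0 \<le> a" "b \<le> 1" "\<And>x. a < x \<Longrightarrow> x < b \<Longrightarrow> z x = p"
  shows "curve_length z a b = 0"
proof -
  have "curve_length z a b \<le> (\<integral>\<^sup>+s\<in>{a..b}. 0 \<partial>lebesgue)"
    unfolding curve_length_def
  proof (rule nn_integral_mono_negligible[of "{a,b}"])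
    fix x assume "x \<in> {a..b} - {a,b}"
    then have x: "a < x" "x < b" by auto
    have "velocity z x = (\<lambda>_. 0)" by (rule velocity_const[OF assms(1,2) x assms(3)])
    then show "ennreal (speed z x) \<le> 0"
      unfolding speed_def using R1_eq_0_iff[OF zero_in_tangent_space] by simp
  qed auto
  then show ?thesis by simp
qed

end

section \<open>The Finsler distance is a metric\<close>

context finsler_manifold
begin

text \<open>Stopping a curve at time \<open>\<theta>\<close> gives a competitor for the distance to \<open>y \<theta>\<close> without reparametrisation.\<close>

lemma curve_length_stop:
  assumes y: "y \<in> ac_curves" and th: "0 \<le> \<theta>" "\<theta> \<le> 1"
  defines "z \<equiv> \<lambda>s. if s \<le> \<theta> then y s else y \<theta>"
  shows "z \<in> admissible (y 0) (y \<theta>)" "curve_length z 0 1 = curve_length y 0 \<theta>"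
proof -
  note yD = ac_curvesD[OF y]
  have eq: "{0..1} = {0..\<theta>} \<union> {\<theta>..1::real}" using th by auto
  have cont: "continuous_on {0..1} z"
    unfolding eq z_def
  proof (rule continuous_on_cases)
    show "continuous_on {0..\<theta>} y" using th by (intro continuous_on_subset[OF yD(1)]) auto
  qed auto
  have z: "x \<le> \<theta> \<Longrightarrow> z x = y (0 + 1 * x)" "\<theta> \<le> x \<Longrightarrow> z x = y \<theta>" for x by (auto simp: z_def)
  have "z \<in> ac_curves"
  proof (rule ac_curves_glue[OF th cont])
    fix U \<phi> a b
    assume "(U, \<phi>) \<in> atlas" "0 \<le> a" "a \<le> b" "b \<le> \<theta>" "z ` {a..b} \<subseteq> U"
    then show "abs_continuous_on a b (\<phi> \<circ> z)"
      using th z by (intro ac_curves_affine_piece[OF y, of 1 U \<phi> a b 0 z]) auto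
  next
    fix U \<phi> a b
    assume "(U, \<phi>) \<in> atlas" "\<theta> \<le> a" "a \<le> b" "b \<le> 1" "z ` {a..b} \<subseteq> U"
    then show "abs_continuous_on a b (\<phi> \<circ> z)"
      using z by (intro ac_curves_const_piece[of a b z "y \<theta>"]) auto
  qed
  then show "z \<in> admissible (y 0) (y \<theta>)" using th z by (auto simp: admissible_def)
  have "curve_length z 0 1 = curve_length z 0 \<theta> + curve_length z \<theta> 1"
    unfolding curve_length_def using th by (rule nn_integral_Icc_split)
  also have "curve_length z \<theta> 1 = 0"
    using th z by (intro curve_length_const[of _ _ _ "y \<theta>"]) auto
  also have "curve_length z 0 \<theta> = curve_length y 0 \<theta>"
    unfolding curve_length_def[of y]
    using th z by (intro curve_length_affine[OF y, where c=1 and t=0]) auto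
  finally show "curve_length z 0 1 = curve_length y 0 \<theta>" by simp
qed

lemma admissible_reverse:
  assumes y: "y \<in> admissible p q"
  obtains z where "z \<in> admissible q p" "curve_length z 0 1 = curve_length y 0 1"
proof -
  have ya: "y \<in> ac_curves" "y 0 = p" "y 1 = q" using y by (auto simp: admissible_def)
  define z where "z s = y (1 + (-1) * s)" for s
  have "z \<in> ac_curves" unfolding z_def by (rule ac_curves_reverse[OF ya(1)])
  moreover have "curve_length z 0 1 = curve_length y 0 1"
    unfolding curve_length_def[of y]
    by (intro curve_length_affine[OF ya(1), where c="-1" and t=1]) (auto simp: z_def)
  ultimately show ?thesis using ya by (intro that[of z]) (auto simp: admissible_def z_def)
qed

lemma admissible_join:
  assumes y1: "y1 \<in> admissible p q" and y2: "y2 \<in> admissible q r"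
  obtains z where "z \<in> admissible p r" "curve_length z 0 1 = curve_length y1 0 1 + curve_length y2 0 1"
proof -
  have ya: "y1 \<in> ac_curves" "y1 0 = p" "y1 1 = q" "y2 \<in> ac_curves" "y2 0 = q" "y2 1 = r"
    using assms by (auto simp: admissible_def)
  define z where "z s = (if s \<le> 1/2 then y1 (0 + 2 * s) else y2 (-1 + 2 * s))" for s
  have eq: "{0..1} = {0..1/2} \<union> {1/2..1::real}" by auto
  have cont: "continuous_on {0..1} z"
    unfolding eq z_def
  proof (rule continuous_on_cases)
    show "continuous_on {0..1/2} (\<lambda>s. y1 (0 + 2 * s))"
      by (intro continuous_on_compose2[OF ac_curvesD(1)[OF ya(1)]]) (auto intro!: continuous_intros)
    show "continuous_on {1/2..1} (\<lambda>s. y2 (-1 + 2 * s))"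
      by (intro continuous_on_compose2[OF ac_curvesD(1)[OF ya(4)]]) (auto intro!: continuous_intros)
  next
    have "y1 (0 + 2 * s) = y2 (- 1 + 2 * s)" if "s = 1/2" for s unfolding that using ya by simp
    moreover have "x = 1/2" if "x \<in> {0..1/2} \<and> \<not> x \<le> 1/2 \<or> x \<in> {1/2..1} \<and> x \<le> 1/2" for x :: real
      using that by force
    ultimately show "\<forall>x. x \<in> {0..1/2} \<and> \<not> x \<le> 1/2 \<or> x \<in> {1/2..1} \<and> x \<le> 1/2 \<longrightarrow> y1 (0 + 2 * x) = y2 (- 1 + 2 * x)" by blast
  qed auto
  have z1: "z x = y1 (0 + 2 * x)" if "x \<le> 1/2" for x using that by (simp add: z_def)
  have z2: "z x = y2 (-1 + 2 * x)" if "1/2 \<le> x" for x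
  proof (cases "x = 1/2")
    case True show ?thesis unfolding True using ya by (simp add: z_def)
  qed (use that in \<open>simp add: z_def\<close>)
  have "z \<in> ac_curves"
  proof (rule ac_curves_glue[OF _ _ cont, of "1/2"])
    fix U \<phi> a b
    assume "(U, \<phi>) \<in> atlas" "0 \<le> a" "a \<le> b" "b \<le> 1/2" "z ` {a..b} \<subseteq> U"
    then show "abs_continuous_on a b (\<phi> \<circ> z)"
      using z1 by (intro ac_curves_affine_piece[OF ya(1), of 2 U \<phi> a b 0 z]) auto
  next
    fix U \<phi> a b
    assume "(U, \<phi>) \<in> atlas" "1/2 \<le> a" "a \<le> b" "b \<le> 1" "z ` {a..b} \<subseteq> U"
    then show "abs_continuous_on a b (\<phi> \<circ> z)"
      using z2 by (intro ac_curves_affine_piece[OF ya(4), of 2 U \<phi> a b "-1" z]) auto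
  qed auto
  moreover have "curve_length z 0 1 = curve_length y1 0 1 + curve_length y2 0 1"
  proof -
    have "curve_length z 0 1 = curve_length z 0 (1/2) + curve_length z (1/2) 1"
      unfolding curve_length_def by (rule nn_integral_Icc_split) auto
    also have "curve_length z 0 (1/2) = curve_length y1 0 1"
      unfolding curve_length_def[of y1]
      using z1 by (intro curve_length_affine[OF ya(1), where c=2 and t=0]) auto
    also have "curve_length z (1/2) 1 = curve_length y2 0 1"
      unfolding curve_length_def[of y2]
      using z2 by (intro curve_length_affine[OF ya(4), where c=2 and t="-1"]) auto
    finally show ?thesis .
  qed
  ultimately show ?thesis using ya by (intro that[of z]) (auto simp: admissible_def z_def)
qed

lemma curve_length_segment:
  fixes x0 k :: 'e
  assumes at: "(U, \<phi>) \<in> atlas" and seg: "\<And>s. 0 \<le> s \<Longrightarrow> s \<le> 1 \<Longrightarrow> x0 + s *\<^sub>R k \<in> \<phi> ` U"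
  defines "y \<equiv> \<lambda>s. inv_into U \<phi> (x0 + s *\<^sub>R k)"
  shows "y \<in> admissible (inv_into U \<phi> x0) (inv_into U \<phi> (x0 + k))"
    and "\<And>L. (\<And>s. 0 \<le> s \<Longrightarrow> s \<le> 1 \<Longrightarrow> chart_norm U \<phi> (x0 + s *\<^sub>R k) k \<le> L) \<Longrightarrow> curve_length y 0 1 \<le> ennreal L"
proof -
  have cont: "continuous_on {0..1} y"
    unfolding y_def
    by (rule continuous_on_compose2[OF chartD(4)[OF at]]) (use seg in \<open>auto intro!: continuous_intros\<close>)
  have yU: "y s \<in> U" "\<phi> (y s) = x0 + s *\<^sub>R k" if "0 \<le> s" "s \<le> 1" for s
    using chartD(6,7)[OF at seg[OF that]] by (auto simp: y_def)
  have ya: "y \<in> ac_curves"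
  proof (rule ac_curvesI[OF cont])
    fix W \<psi> a b assume W: "(W, \<psi>) \<in> atlas" and ab: "0 \<le> a" "a \<le> b" "b \<le> 1" and yW: "y ` {a..b} \<subseteq> W"
    have "abs_continuous_on a b (\<lambda>s. x0 + s *\<^sub>R k)"
      by (rule abs_continuous_on_lipschitz[where B="norm k"])
        (simp add: scaleR_diff_left[symmetric] mult.commute)
    moreover have "(\<lambda>s. x0 + s *\<^sub>R k) ` {a..b} \<subseteq> \<phi> ` (U \<inter> W)"
    proof (rule image_subsetI)
      fix s assume s: "s \<in> {a..b}"
      then have "y s \<in> U \<inter> W" "x0 + s *\<^sub>R k = \<phi> (y s)" using yU[of s] yW ab by auto
      then show "x0 + s *\<^sub>R k \<in> \<phi> ` (U \<inter> W)" by blast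
    qed
    ultimately have "abs_continuous_on a b (\<lambda>s. (\<psi> \<circ> inv_into U \<phi>) (x0 + s *\<^sub>R k))"
      using ab by (intro abs_continuous_on_compose_C1[OF _ _ transition_C1[OF at W]])
    then show "abs_continuous_on a b (\<psi> \<circ> y)" by (simp add: y_def comp_def)
  qed
  then show "y \<in> admissible (inv_into U \<phi> x0) (inv_into U \<phi> (x0 + k))"
    by (simp add: admissible_def y_def)
  show "curve_length y 0 1 \<le> ennreal L"
    if L: "\<And>s. 0 \<le> s \<Longrightarrow> s \<le> 1 \<Longrightarrow> chart_norm U \<phi> (x0 + s *\<^sub>R k) k \<le> L" for L
  proof -
    have "curve_length y 0 1 \<le> (\<integral>\<^sup>+s\<in>{0..1::real}. ennreal L \<partial>lebesgue)"
      unfolding curve_length_def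
    proof (rule nn_integral_mono_negligible[of "{0, 1::real}"])
      fix s :: real assume "s \<in> {0..1} - {0, 1}"
      then have s: "0 < s" "s < 1" by auto
      have ch: "(U, \<phi>) \<in> charts_at (y s)" using yU(1)[of s] s at by (simp add: charts_at_iff)
      have "((\<lambda>s. x0 + s *\<^sub>R k) has_vector_derivative k) (at s)"
        by (auto intro!: derivative_eq_intros)
      then have d: "(\<phi> \<circ> y has_vector_derivative k) (at s)"
        by (rule has_vector_derivative_transform_within_open[of _ _ _ "{0<..<1}"]) (use s yU in auto)
      have "isCont y s" using continuous_on_interior[OF cont, of s] s by simp
      then have "velocity y s = tangent_of U \<phi> (y s) k" by (intro velocity_chart[OF ch s _ d])
      then have "speed y s = chart_norm U \<phi> (x0 + s *\<^sub>R k) k"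
        by (simp add: speed_def chart_norm_def y_def)
      then show "ennreal (speed y s) \<le> ennreal L" using L[of s] s by (intro ennreal_leI) auto
    qed auto
    then show ?thesis by (simp add: nn_integral_cmult_indicator)
  qed
qed

lemma d_le_length:
  assumes "y \<in> admissible p q"
  shows "ennreal (d p q) \<le> curve_length y 0 1"
proof -
  let ?I = "INF y \<in> admissible p q. \<integral>\<^sup>+s\<in>{0..1}. ennreal (speed y s) \<partial>lebesgue"
  have "ennreal (d p q) \<le> ?I" unfolding d_def by (cases ?I) auto
  also have "\<dots> \<le> curve_length y 0 1"
    unfolding curve_length_def using assms by (rule INF_lower)
  finally show ?thesis .
qed

lemma d_nonneg: "d p q \<ge> 0" by (simp add: d_def)

end

context rate_independent_system
begin

lemma d_less_imp_curve:
  assumes "d p q < r"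
  obtains y where "y \<in> admissible p q" "curve_length y 0 1 < ennreal r"
proof -
  let ?I = "INF y \<in> admissible p q. curve_length y 0 1"
  have deq: "d p q = enn2real ?I" by (simp add: d_def curve_length_def)
  obtain y where y: "y \<in> admissible p q" using admissible_nonempty by blast
  then have "?I \<le> curve_length y 0 1" by (rule INF_lower)
  also have "\<dots> < \<infinity>" using y by (intro curve_length_finite) (simp add: admissible_def)
  finally have "?I = ennreal (d p q)" unfolding deq by simp
  also have "\<dots> < ennreal r" using assms d_nonneg[of p q] by (simp add: ennreal_less_iff)
  finally show ?thesis using that by (auto simp: INF_less_iff)
qed

lemma d_leI:
  assumes "\<And>e. e > 0 \<Longrightarrow> \<exists>y\<in>admissible p q. curve_length y 0 1 < ennreal (r + e)" and "r \<ge> 0"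
  shows "d p q \<le> r"
proof (rule field_le_epsilon)
  fix e :: real assume "e > 0"
  then obtain y where "y \<in> admissible p q" "curve_length y 0 1 < ennreal (r + e)" using assms by blast
  then have "ennreal (d p q) < ennreal (r + e)" using d_le_length le_less_trans by blast
  then show "d p q \<le> r + e" using d_nonneg by (simp add: ennreal_less_iff)
qed

lemma d_triangle: "d p r \<le> d p q + d q r"
proof (rule d_leI)
  fix e :: real assume e: "e > 0"
  obtain y1 where y1: "y1 \<in> admissible p q" "curve_length y1 0 1 < ennreal (d p q + e/2)"
    using d_less_imp_curve[of p q "d p q + e/2"] e by auto
  obtain y2 where y2: "y2 \<in> admissible q r" "curve_length y2 0 1 < ennreal (d q r + e/2)"
    using d_less_imp_curve[of q r "d q r + e/2"] e by auto
  obtain z where z: "z \<in> admissible p r" "curve_length z 0 1 = curve_length y1 0 1 + curve_length y2 0 1"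
    using admissible_join[OF y1(1) y2(1)] .
  have "curve_length z 0 1 < ennreal (d p q + e/2) + ennreal (d q r + e/2)"
    unfolding z(2) using y1 y2 by (intro add_strict_mono) auto
  also have "\<dots> = ennreal (d p q + d q r + e)"
    using e d_nonneg by (subst ennreal_plus[symmetric]) (auto simp: algebra_simps add_nonneg_nonneg)
  finally show "\<exists>y\<in>admissible p r. curve_length y 0 1 < ennreal (d p q + d q r + e)" using z by blast
qed (simp add: d_nonneg)

lemma d_commute: "d p q = d q p"
proof -
  have "d q p \<le> d p q" for p q
  proof (rule d_leI)
    fix e :: real assume e: "e > 0"
    obtain y1 where y1: "y1 \<in> admissible p q" "curve_length y1 0 1 < ennreal (d p q + e)"
      using d_less_imp_curve[of p q "d p q + e"] e by auto
    then show "\<exists>y\<in>admissible q p. curve_length y 0 1 < ennreal (d p q + e)"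
      by (metis admissible_reverse)
  qed (simp add: d_nonneg)
  then show ?thesis by (simp add: antisym)
qed

lemma d_refl: "d p p = 0"
proof -
  have "(\<lambda>_. p) \<in> admissible p p"
    by (auto simp: admissible_def intro!: ac_curvesI ac_curves_const_piece)
  moreover have "curve_length (\<lambda>_. p) 0 1 = 0" by (rule curve_length_const) auto
  ultimately have "ennreal (d p p) \<le> 0" using d_le_length by metis
  then show ?thesis using d_nonneg[of p p] by simp
qed

lemma d_ball_in_open:
  assumes G: "open G" "p \<in> G"
  obtains r where "r > 0" "\<And>q. d p q < r \<Longrightarrow> q \<in> G"
proof -
  obtain U \<phi> where c: "(U, \<phi>) \<in> charts_at p" by (rule charts_at_nonempty)
  then have at: "(U, \<phi>) \<in> atlas" "p \<in> U" by (auto simp: charts_at_iff)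
  obtain \<rho> m where \<rho>: "\<rho> > 0" "m > 0"
    "\<And>r y. 0 < r \<Longrightarrow> r \<le> \<rho> \<Longrightarrow> y \<in> ac_curves \<Longrightarrow> y 0 = p \<Longrightarrow> y 1 \<notin> U \<inter> \<phi> -` ball (\<phi> p) r \<Longrightarrow>
       ennreal (m * r) \<le> curve_length y 0 1"
    using chart_ball_escape[OF c] by metis
  obtain r0 where r0: "r0 > 0" "ball (\<phi> p) r0 \<subseteq> \<phi> ` (U \<inter> G)"
    using open_chart_image[OF at(1) G(1)] at G open_contains_ball by blast
  define r where "r = min r0 \<rho>"
  have r: "0 < r" "r \<le> \<rho>" "r \<le> r0" using r0 \<rho> by (auto simp: r_def)
  show ?thesis
  proof (rule that[of "m * r"])
    fix q assume "d p q < m * r"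
    then obtain y where y: "y \<in> admissible p q" "curve_length y 0 1 < ennreal (m * r)"
      by (rule d_less_imp_curve)
    have ya: "y \<in> ac_curves" "y 0 = p" using y(1) by (auto simp: admissible_def)
    have "y 1 \<in> U \<inter> \<phi> -` ball (\<phi> p) r"
    proof (rule ccontr)
      assume "\<not> ?thesis"
      then show False using \<rho>(3)[OF r(1,2) ya] y(2) by (meson not_le)
    qed
    then have q: "q \<in> U" "\<phi> q \<in> ball (\<phi> p) r0" using y r by (auto simp: admissible_def)
    then obtain q' where q': "q' \<in> U" "q' \<in> G" "\<phi> q = \<phi> q'" using r0(2) by blast
    then have "q = q'" using chartD(5)[OF at(1)] q by metis
    then show "q \<in> G" using q' by simp
  qed (use r \<rho> in auto)
qed

lemma d_tendsto_imp_tendsto: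
  assumes "((\<lambda>x. d (f x) p) \<longlongrightarrow> 0) F"
  shows "(f \<longlongrightarrow> p) F"
proof (rule topological_tendstoI)
  fix G assume "open G" "p \<in> G"
  then obtain r where r: "r > 0" "\<And>q. d p q < r \<Longrightarrow> q \<in> G" using d_ball_in_open by metis
  have "\<forall>\<^sub>F x in F. d (f x) p < r" using order_tendstoD(2)[OF assms r(1)] .
  then show "\<forall>\<^sub>F x in F. f x \<in> G" by eventually_elim (use r(2) d_commute in metis)
qed

lemma d_eq_0_iff: "d p q = 0 \<longleftrightarrow> p = q"
proof
  assume 0: "d p q = 0"
  show "p = q"
  proof (rule ccontr)
    assume "p \<noteq> q"
    then have "open (- {q})" "p \<in> - {q}" by auto
    then obtain r where "r > 0" "\<And>q'. d p q' < r \<Longrightarrow> q' \<in> - {q}" using d_ball_in_open by metis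
    then show False using 0 by force
  qed
qed (simp add: d_refl)

lemma Metric_space_d: "Metric_space UNIV d"
  by unfold_locales (auto simp: d_nonneg d_eq_0_iff d_commute d_triangle)

lemma d_Cauchy_converges:
  assumes "\<And>\<epsilon>. \<epsilon> > 0 \<Longrightarrow> \<exists>N. \<forall>n\<ge>N. \<forall>m\<ge>N. d (\<sigma> n) (\<sigma> m) < \<epsilon>"
  obtains p where "(\<lambda>n. d (\<sigma> n) p) \<longlonglongrightarrow> 0"
proof -
  have "Metric_space.MCauchy UNIV d \<sigma>"
    unfolding Metric_space.MCauchy_def[OF Metric_space_d] using assms by auto
  then obtain p where "limitin (Metric_space.mtopology UNIV d) \<sigma> p sequentially"
    using complete unfolding Metric_space.mcomplete_def[OF Metric_space_d] by blast
  then have "(\<lambda>n. d (\<sigma> n) p) \<longlonglongrightarrow> 0"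
    by (simp add: Metric_space.limitin_metric_dist_null[OF Metric_space_d])
  then show ?thesis by (rule that)
qed

section \<open>The energy along curves\<close>

lemma
  assumes at: "(U, \<phi>) \<in> atlas"
  shows energy_space_C1: "\<And>t. t \<in> {0..T} \<Longrightarrow> directionally_C1 (\<phi> ` U) (\<lambda>x. E t (inv_into U \<phi> x))"
    and energy_time_continuous: "continuous_on ({0..T} \<times> \<phi> ` U) (\<lambda>(t, x). dt_E t (inv_into U \<phi> x))"
proof -
  let ?g = "\<lambda>(t, x). E t (inv_into U \<phi> x)"
  let ?S = "{0..T} \<times> \<phi> ` U"
  obtain g' where g': "\<And>z. z \<in> ?S \<Longrightarrow> (?g has_derivative g' z) (at z within ?S)"
    "\<And>v. continuous_on ?S (\<lambda>z. g' z v)"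
    using E_C1[OF at] unfolding C1_on_def by blast
  have oU: "open (\<phi> ` U)" by (rule chartD(2)[OF at])
  have sp: "((\<lambda>x. E t (inv_into U \<phi> x)) has_derivative (\<lambda>w. g' (t, x) (0, w))) (at x)"
    if "t \<in> {0..T}" "x \<in> \<phi> ` U" for t x
  proof -
    have "((\<lambda>x. (t, x)) has_derivative (\<lambda>w. (0, w))) (at x within \<phi> ` U)"
      by (auto intro!: derivative_eq_intros)
    moreover have "(?g has_derivative g' (t, x)) (at (t, x) within (\<lambda>x. (t, x)) ` (\<phi> ` U))"
      using that by (intro has_derivative_subset[OF g'(1)]) auto
    ultimately have "(?g \<circ> (\<lambda>x. (t, x)) has_derivative (g' (t, x) \<circ> (\<lambda>w. (0, w)))) (at x within \<phi> ` U)"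
      by (rule diff_chain_within)
    then have "((\<lambda>x. E t (inv_into U \<phi> x)) has_derivative (\<lambda>w. g' (t, x) (0, w))) (at x within \<phi> ` U)"
      by (simp add: comp_def)
    then show ?thesis using at_within_open[OF that(2) oU] by simp
  qed
  show "directionally_C1 (\<phi> ` U) (\<lambda>x. E t (inv_into U \<phi> x))" if t: "t \<in> {0..T}" for t
    unfolding directionally_C1_def
  proof (intro conjI ballI allI)
    show "(\<lambda>x. E t (inv_into U \<phi> x)) differentiable (at x)" if "x \<in> \<phi> ` U" for x
      using sp[OF t that] by (auto simp: differentiable_def)
    fix v
    have "continuous_on (\<phi> ` U) (\<lambda>x. g' (t, x) (0, v))"
      using t by (intro continuous_on_compose2[OF g'(2)]) (auto intro!: continuous_intros)
    moreover have "frechet_derivative (\<lambda>x. E t (inv_into U \<phi> x)) (at x) v = g' (t, x) (0, v)" if "x \<in> \<phi> ` U" for x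
      using frechet_derivative_at[OF sp[OF t that]] by metis
    ultimately show "continuous_on (\<phi> ` U) (\<lambda>x. frechet_derivative (\<lambda>x. E t (inv_into U \<phi> x)) (at x) v)"
      by (simp cong: continuous_on_cong)
  qed (rule oU)
  have tm: "dt_E t (inv_into U \<phi> x) = g' (t, x) (1, 0)" if "t \<in> {0..T}" "x \<in> \<phi> ` U" for t x
  proof -
    have "((\<lambda>s. (s, x)) has_derivative (\<lambda>w. (w, 0))) (at t within {0..T})"
      by (auto intro!: derivative_eq_intros)
    moreover have "(?g has_derivative g' (t, x)) (at (t, x) within (\<lambda>s. (s, x)) ` {0..T})"
      using that by (intro has_derivative_subset[OF g'(1)]) auto
    ultimately have "(?g \<circ> (\<lambda>s. (s, x)) has_derivative (g' (t, x) \<circ> (\<lambda>w. (w, 0)))) (at t within {0..T})"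
      by (rule diff_chain_within)
    then have d: "((\<lambda>s. E s (inv_into U \<phi> x)) has_derivative (\<lambda>w. g' (t, x) (w, 0))) (at t within {0..T})"
      by (simp add: comp_def)
    have eq: "g' (t, x) (w, 0) = w *\<^sub>R g' (t, x) (1, 0)" for w
      using linear_scale[OF has_derivative_linear[OF g'(1)], of "(t,x)" w "(1,0)"] that by simp
    have "((\<lambda>s. E s (inv_into U \<phi> x)) has_vector_derivative g' (t, x) (1, 0)) (at t within {0..T})"
      unfolding has_vector_derivative_def eq[symmetric] by (rule d)
    then show ?thesis
      unfolding dt_E_def using T_pos that by (intro vector_derivative_within_closed_interval) auto
  qed
  show "continuous_on ?S (\<lambda>(t, x). dt_E t (inv_into U \<phi> x))"
    by (rule continuous_on_cong[THEN iffD1, OF refl _ g'(2)[of "(1,0)"]]) (auto simp: tm)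
qed

definition some_chart :: "'q \<Rightarrow> ('q, 'e) chart" where
  "some_chart q = (SOME c. c \<in> charts_at q)"

lemma some_chart: "(fst (some_chart q), snd (some_chart q)) \<in> charts_at q"
  using charts_at_nonempty[of q] unfolding some_chart_def prod.collapse by (metis someI)

lemma differential_eq:
  "differential f q v = frechet_derivative (\<lambda>x. f (inv_into (fst (some_chart q)) (snd (some_chart q)) x))
     (at (snd (some_chart q) q)) (v (some_chart q))"
  by (simp add: differential_def some_chart_def comp_def Let_def)

lemma energy_has_derivative_chart:
  assumes "(U, \<phi>) \<in> atlas" "t \<in> {0..T}" "x \<in> \<phi> ` U"
  shows "((\<lambda>x. E t (inv_into U \<phi> x)) has_derivative frechet_derivative (\<lambda>x. E t (inv_into U \<phi> x)) (at x)) (at x)"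
proof -
  have "(\<lambda>x. E t (inv_into U \<phi> x)) differentiable (at x)"
    using energy_space_C1[OF assms(1,2)] assms(3) unfolding directionally_C1_def by blast
  then show ?thesis by (rule frechet_derivative_works[THEN iffD1])
qed

text \<open>The supremum in \<open>slope\<close> is one of reals, so it bounds the quotients only because they are bounded above:
the numerator is at most a multiple of the Euclidean norm of the coordinates, the denominator at least one.\<close>

lemma differential_le_slope:
  assumes t: "t \<in> {0..T}" and v: "v \<in> tangent_space q"
  shows "\<bar>differential (E t) q v\<bar> \<le> slope t q * R1 q v"
proof -
  define U \<phi> where "U = fst (some_chart q)" and "\<phi> = snd (some_chart q)"
  have sc: "some_chart q = (U, \<phi>)" by (simp add: U_def \<phi>_def)
  have c: "(U, \<phi>) \<in> charts_at q" using some_chart[of q] by (simp add: U_def \<phi>_def)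
  then have at: "(U, \<phi>) \<in> atlas" "q \<in> U" by (auto simp: charts_at_iff)
  define D where "D = frechet_derivative (\<lambda>x. E t (inv_into U \<phi> x)) (at (\<phi> q))"
  have D: "((\<lambda>x. E t (inv_into U \<phi> x)) has_derivative D) (at (\<phi> q))"
    unfolding D_def using at by (intro energy_has_derivative_chart[OF at(1) t]) auto
  have lin: "linear D" using D by (rule has_derivative_linear)
  obtain K where K: "\<And>w. norm (D w) \<le> norm w * K"
    using bounded_linear.bounded[OF has_derivative_bounded_linear[OF D]] by blast
  have diff: "differential (E t) q u = D (u (U, \<phi>))" for u
    by (simp add: differential_eq sc D_def)
  obtain \<rho> m M where \<rho>: "\<rho> > 0" "m > 0" "M > 0"
      "\<And>x w. x \<in> cball (\<phi> q) \<rho> \<Longrightarrow> m * norm w \<le> chart_norm U \<phi> x w \<and> chart_norm U \<phi> x w \<le> M * norm w"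
    using chart_norm_bounds[OF c] by metis
  have R1: "m * norm (u (U, \<phi>)) \<le> R1 q u" if "u \<in> tangent_space q" for u
    using \<rho>(4)[of "\<phi> q" "u (U, \<phi>)"] \<rho>(1) tangent_of_surj[OF c that] chartD(5)[OF at]
    by (simp add: chart_norm_def)
  have R1pos: "R1 q u > 0" if "u \<in> tangent_space q - {\<lambda>_. 0}" for u
    using R1_nonneg[of u q] R1_eq_0_iff[of u q] that by force
  have bdd: "bdd_above ((\<lambda>v. differential (E t) q v / R1 q v) ` (tangent_space q - {\<lambda>_. 0}))"
  proof (rule bdd_aboveI2)
    fix u assume u: "u \<in> tangent_space q - {\<lambda>_. 0}"
    have "differential (E t) q u \<le> norm (u (U, \<phi>)) * \<bar>K\<bar>"
      using K[of "u (U, \<phi>)"] mult_left_mono[OF abs_ge_self[of K] norm_ge_zero[of "u (U, \<phi>)"]] by (simp add: diff)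
    also have "\<dots> \<le> (R1 q u / m) * \<bar>K\<bar>"
      using R1[of u] u \<rho>(2) by (intro mult_right_mono) (auto simp: field_simps)
    finally show "differential (E t) q u / R1 q u \<le> \<bar>K\<bar> / m"
      using R1pos[OF u] \<rho>(2) by (simp add: field_simps)
  qed
  have le: "differential (E t) q u \<le> slope t q * R1 q u" if u: "u \<in> tangent_space q - {\<lambda>_. 0}" for u
  proof -
    have "differential (E t) q u / R1 q u \<le> slope t q"
      unfolding slope_def using bdd u by (intro cSUP_upper)
    then show ?thesis using R1pos[OF u] by (simp add: field_simps)
  qed
  show ?thesis
  proof (cases "v = (\<lambda>_. 0)")
    case True
    then show ?thesis using linear_0[OF lin] R1_eq_0_iff[OF v] by (simp add: diff)
  next
    case False
    let ?v = "\<lambda>c. (-1) *\<^sub>R v c"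
    have mv: "?v \<in> tangent_space q"
    proof -
      have "?v = tangent_of U \<phi> q ((-1) *\<^sub>R v (U, \<phi>))"
        unfolding tangent_of_linear[OF c] using tangent_of_surj[OF c v] by metis
      then show ?thesis using tangent_of_in_tangent_space[OF c] by metis
    qed
    have "?v \<noteq> (\<lambda>_. 0)" using False by (auto simp: fun_eq_iff)
    then have "differential (E t) q ?v \<le> slope t q * R1 q v"
      using le[of ?v] mv R1_scaleR[OF v, of "-1"] by simp
    moreover have "differential (E t) q ?v = - differential (E t) q v"
      using linear_scale[OF lin, of "-1" "v (U, \<phi>)"] by (simp add: diff)
    ultimately show ?thesis using le[of v] v False by auto
  qed
qed

text \<open>The energy along \<open>z\<close> is absolutely continuous, and its derivative is the differential applied to the
velocity, hence at most slope times speed.\<close>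

lemma energy_chain_bound:
  assumes t: "t \<in> {0..T}" and z: "z \<in> ac_curves" and ab: "0 \<le> a" "a \<le> b" "b \<le> 1"
  shows "ennreal \<bar>E t (z b) - E t (z a)\<bar> \<le> (\<integral>\<^sup>+s\<in>{a..b}. ennreal (slope t (z s) * speed z s) \<partial>lebesgue)"
proof -
  let ?W = "\<lambda>u v. \<integral>\<^sup>+s\<in>{u..v}. ennreal (slope t (z s) * speed z s) \<partial>lebesgue"
  note zD = ac_curvesD[OF z]
  define P where "P u v \<longleftrightarrow> (0 \<le> u \<and> u \<le> v \<and> v \<le> 1 \<longrightarrow>
    ennreal \<bar>E t (z v) - E t (z u)\<bar> \<le> ?W u v)" for u v
  have "P a b"
    using ab(2)
  proof (rule Bolzano[of a b P])
    fix u v w assume P: "P u v" "P v w" and uvw: "u \<le> v" "v \<le> w"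
    show "P u w"
      unfolding P_def
    proof
      assume 01: "0 \<le> u \<and> u \<le> w \<and> w \<le> 1"
      have "ennreal \<bar>E t (z w) - E t (z u)\<bar> \<le> ennreal (\<bar>E t (z v) - E t (z u)\<bar> + \<bar>E t (z w) - E t (z v)\<bar>)"
        by (intro ennreal_leI) linarith
      also have "\<dots> = ennreal \<bar>E t (z v) - E t (z u)\<bar> + ennreal \<bar>E t (z w) - E t (z v)\<bar>"
        by (intro ennreal_plus) auto
      also have "\<dots> \<le> ?W u v
          + ?W v w"
        using P 01 uvw unfolding P_def by (intro add_mono) auto
      also have "\<dots> = ?W u w"
        by (rule nn_integral_Icc_split[OF uvw, symmetric])
      finally show "ennreal \<bar>E t (z w) - E t (z u)\<bar> \<le> ?W u w" .
    qed
  next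
    fix s assume "a \<le> s" "s \<le> b"
    then have s: "0 \<le> s" "s \<le> 1" using ab by auto
    obtain U \<phi> where c: "(U, \<phi>) \<in> charts_at (z s)" by (rule charts_at_nonempty)
    then have at: "(U, \<phi>) \<in> atlas" "z s \<in> U" by (auto simp: charts_at_iff)
    obtain e where e: "e > 0" "\<And>u v. u \<le> s \<Longrightarrow> s \<le> v \<Longrightarrow> v - u < e \<Longrightarrow> 0 \<le> u \<Longrightarrow> v \<le> 1 \<Longrightarrow> z ` {u..v} \<subseteq> U"
      using continuous_curve_local[OF zD(1) s chartD(1)[OF at(1)] at(2)] by blast
    show "\<exists>e>0. \<forall>u v. u \<le> s \<and> s \<le> v \<and> v - u < e \<longrightarrow> P u v"
    proof (intro exI[of _ e] conjI allI impI e(1))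
      fix u v assume uv: "u \<le> s \<and> s \<le> v \<and> v - u < e"
      show "P u v"
        unfolding P_def
      proof
        assume 01: "0 \<le> u \<and> u \<le> v \<and> v \<le> 1"
        then have zU: "z ` {u..v} \<subseteq> U" using e(2) uv by blast
        then have ac: "abs_continuous_on u v (\<phi> \<circ> z)" using zD(2)[OF at(1)] 01 by auto
        have "abs_continuous_on u v (\<lambda>x. E t (inv_into U \<phi> ((\<phi> \<circ> z) x)))"
          using 01 zU by (intro abs_continuous_on_compose_C1[OF ac _ energy_space_C1[OF at(1) t]]) auto
        then have acE: "abs_continuous_on u v (\<lambda>x. E t (z x))"
        proof (rule abs_continuous_on_cong)
          fix x assume "u \<le> x" "x \<le> v"
          then have "z x \<in> U" using zU by (intro subsetD[OF zU] imageI) simp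
          then show "E t (inv_into U \<phi> ((\<phi> \<circ> z) x)) = E t (z x)" by (simp add: chartD(5)[OF at(1)])
        qed
        have "ennreal \<bar>E t (z v) - E t (z u)\<bar>
           \<le> (\<integral>\<^sup>+x\<in>{u..v}. ennreal (norm (vector_derivative (\<lambda>x. E t (z x)) (at x))) \<partial>lebesgue)"
          using abs_continuous_on_nn_integral(2)[OF acE] 01 by simp
        also have "\<dots> \<le> ?W u v"
        proof (rule nn_integral_mono_negligible[OF regular_time_AE[OF z]])
          fix x assume "x \<in> {u..v} - {s \<in> {0..1}. \<not> regular_time z s}"
          then have reg: "regular_time z x" using 01 by auto
          define W \<psi> where "W = fst (some_chart (z x))" and "\<psi> = snd (some_chart (z x))"
          have sc: "some_chart (z x) = (W, \<psi>)" by (simp add: W_def \<psi>_def)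
          have cW: "(W, \<psi>) \<in> charts_at (z x)" using some_chart[of "z x"] by (simp add: W_def \<psi>_def)
          then have atW: "(W, \<psi>) \<in> atlas" "z x \<in> W" by (auto simp: charts_at_iff)
          define D where "D = frechet_derivative (\<lambda>x. E t (inv_into W \<psi> x)) (at (\<psi> (z x)))"
          have D: "((\<lambda>x. E t (inv_into W \<psi> x)) has_derivative D) (at ((\<psi> \<circ> z) x))"
            unfolding D_def comp_def using atW by (intro energy_has_derivative_chart[OF atW(1) t]) auto
          let ?w = "vector_derivative (\<psi> \<circ> z) (at x)"
          have "(\<psi> \<circ> z has_derivative (\<lambda>r. r *\<^sub>R ?w)) (at x)"
            using regular_time_chart(1)[OF reg cW] by (simp add: has_vector_derivative_def)
          from diff_chain_at[OF this D]
          have d1: "((\<lambda>x. E t (inv_into W \<psi> x)) \<circ> (\<psi> \<circ> z) has_derivative (D \<circ> (\<lambda>r. r *\<^sub>R ?w))) (at x)" .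
          have eq: "D (r *\<^sub>R ?w) = r *\<^sub>R D ?w" for r using linear_scale[OF has_derivative_linear[OF D]] .
          have "((\<lambda>x. E t (inv_into W \<psi> x)) \<circ> (\<psi> \<circ> z) has_vector_derivative D ?w) (at x)"
            using d1 unfolding has_vector_derivative_def eq[symmetric] comp_def[of D] .
          moreover have "\<forall>\<^sub>F x' in at x. ((\<lambda>x. E t (inv_into W \<psi> x)) \<circ> (\<psi> \<circ> z)) x' = E t (z x')"
          proof -
            have "isCont z x" using reg by (simp add: regular_time_def)
            then have "\<forall>\<^sub>F x' in at x. z x' \<in> W"
              unfolding isCont_def using chartD(1)[OF atW(1)] atW(2) by (rule topological_tendstoD)
            then show ?thesis by eventually_elim (simp add: chartD(5)[OF atW(1)])
          qed
          ultimately have "((\<lambda>x. E t (z x)) has_vector_derivative D ?w) (at x)"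
            unfolding has_vector_derivative_def
            by (rule has_derivative_transform_eventually) (simp_all add: chartD(5)[OF atW])
          then have "vector_derivative (\<lambda>x. E t (z x)) (at x) = D ?w" by (rule vector_derivative_at)
          also have "\<dots> = differential (E t) (z x) (velocity z x)"
            unfolding differential_eq sc regular_time_chart(2)[OF reg cW] tangent_of_chart[OF cW] by (simp add: D_def)
          finally show "ennreal (norm (vector_derivative (\<lambda>x. E t (z x)) (at x))) \<le> ennreal (slope t (z x) * speed z x)"
            using differential_le_slope[OF t velocity_in_tangent_space[OF reg]]
            by (intro ennreal_leI) (simp add: speed_def)
        qed
        finally show "ennreal \<bar>E t (z v) - E t (z u)\<bar> \<le> ?W u v" .
      qed
    qed
  qed
  then show ?thesis using ab by (simp add: P_def)
qed

lemma dt_E_tendsto: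
  assumes f: "(f \<longlongrightarrow> t) F" and g: "(g \<longlongrightarrow> p) F" and t: "t \<in> {0..T}" and ev: "\<forall>\<^sub>F x in F. f x \<in> {0..T}"
  shows "((\<lambda>x. dt_E (f x) (g x)) \<longlongrightarrow> dt_E t p) F"
proof -
  obtain U \<phi> where c: "(U, \<phi>) \<in> charts_at p" by (rule charts_at_nonempty)
  then have at: "(U, \<phi>) \<in> atlas" "p \<in> U" by (auto simp: charts_at_iff)
  have gU: "\<forall>\<^sub>F x in F. g x \<in> U" using topological_tendstoD[OF g chartD(1)[OF at(1)] at(2)] .
  have "isCont \<phi> p" using chartD(1,3)[OF at(1)] at(2) by (simp add: continuous_on_eq_continuous_at)
  then have "((\<lambda>x. \<phi> (g x)) \<longlongrightarrow> \<phi> p) F" using g by (rule isCont_tendsto_compose)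
  with f have lim: "((\<lambda>x. (f x, \<phi> (g x))) \<longlongrightarrow> (t, \<phi> p)) F" by (rule tendsto_Pair)
  have "((\<lambda>x. (\<lambda>(t, x). dt_E t (inv_into U \<phi> x)) (f x, \<phi> (g x))) \<longlongrightarrow> (\<lambda>(t, x). dt_E t (inv_into U \<phi> x)) (t, \<phi> p)) F"
  proof (rule continuous_on_tendsto_compose[OF energy_time_continuous[OF at(1)] lim])
    show "(t, \<phi> p) \<in> {0..T} \<times> \<phi> ` U" using t at by auto
    show "\<forall>\<^sub>F x in F. (f x, \<phi> (g x)) \<in> {0..T} \<times> \<phi> ` U" using ev gU by eventually_elim auto
  qed
  then have "((\<lambda>x. dt_E (f x) (inv_into U \<phi> (\<phi> (g x)))) \<longlongrightarrow> dt_E t p) F"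
    by (simp add: chartD(5)[OF at])
  then show ?thesis
    by (rule Lim_transform_eventually) (use gU chartD(5)[OF at(1)] in \<open>auto elim!: eventually_mono\<close>)
qed

text \<open>The slope length of the transition splits at \<open>\<theta>\<close>. On either half it is at least the distance of the end
points, because the slope is at least \<open>1\<close>, and at least the absolute value of the energy change. As the sum
equals the total energy drop, estimating one half by the distance and the other by the energy change
leaves the claimed inequalities.\<close>

lemma d_le_slope_length_halves:
  assumes t: "t \<in> {0..T}" and y: "y \<in> admissible p p'" and th: "0 \<le> \<theta>" "\<theta> \<le> 1"
    and ge: "\<And>s. 0 \<le> s \<Longrightarrow> s \<le> 1 \<Longrightarrow> slope t (y s) \<ge> 1"
    and eq: "ereal (E t p' - E t p) = - enn2ereal (slope_length t y)"
  shows "d p (y \<theta>) \<le> E t p - E t (y \<theta>)" "d (y \<theta>) p' \<le> E t (y \<theta>) - E t p'"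
proof -
  have ya: "y \<in> ac_curves" "y 0 = p" "y 1 = p'" using y by (auto simp: admissible_def)
  define w where "w s = ennreal (slope t (y s) * speed y s)" for s
  have total: "slope_length t y = (\<integral>\<^sup>+s\<in>{0..\<theta>}. w s \<partial>lebesgue) + (\<integral>\<^sup>+s\<in>{\<theta>..1}. w s \<partial>lebesgue)"
    unfolding slope_length_def w_def by (rule nn_integral_Icc_split[OF th])
  have sl: "slope_length t y = ennreal (E t p - E t p')" "E t p - E t p' \<ge> 0"
  proof -
    have *: "enn2ereal (slope_length t y) = ereal (E t p - E t p')"
    proof -
      have "enn2ereal (slope_length t y) = - ereal (E t p' - E t p)" unfolding eq by simp
      then show ?thesis by simp
    qed
    show 0: "E t p - E t p' \<ge> 0" using * enn2ereal_nonneg[of "slope_length t y"] by simp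
    show "slope_length t y = ennreal (E t p - E t p')"
      using * 0 by (metis e2ennreal_enn2ereal e2ennreal_ereal)
  qed
  have len: "curve_length y a b \<le> (\<integral>\<^sup>+s\<in>{a..b}. w s \<partial>lebesgue)" if "0 \<le> a" "b \<le> 1" for a b
    unfolding curve_length_def
  proof (rule nn_integral_mono_negligible[OF regular_time_AE[OF ya(1)]])
    fix s assume "s \<in> {a..b} - {s \<in> {0..1}. \<not> regular_time y s}"
    then have "regular_time y s" "0 \<le> s" "s \<le> 1" using that by auto
    then show "ennreal (speed y s) \<le> w s"
      unfolding w_def using speed_nonneg[of y s] ge[of s] mult_right_mono[of 1 "slope t (y s)" "speed y s"]
      by (intro ennreal_leI) simp
  qed
  have left: "ennreal (d p (y \<theta>)) \<le> (\<integral>\<^sup>+s\<in>{0..\<theta>}. w s \<partial>lebesgue)"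
    using d_le_length[OF curve_length_stop(1)[OF ya(1) th]] len[of 0 \<theta>] th
    unfolding curve_length_stop(2)[OF ya(1) th] ya(2) by (auto intro: order_trans)
  have right: "ennreal (d (y \<theta>) p') \<le> (\<integral>\<^sup>+s\<in>{\<theta>..1}. w s \<partial>lebesgue)"
  proof -
    define z where "z s = y (1 + (-1) * s)" for s
    have za: "z \<in> ac_curves" unfolding z_def by (rule ac_curves_reverse[OF ya(1)])
    have th': "0 \<le> 1 - \<theta>" "1 - \<theta> \<le> 1" using th by auto
    have "curve_length z 0 (1 - \<theta>) = curve_length y \<theta> 1"
      unfolding curve_length_def[of y]
      using th by (intro curve_length_affine[OF ya(1), where c="-1" and t=1]) (auto simp: z_def)
    moreover have "z 0 = p'" "z (1 - \<theta>) = y \<theta>" using ya by (auto simp: z_def)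
    ultimately have "ennreal (d p' (y \<theta>)) \<le> curve_length y \<theta> 1"
      using d_le_length[OF curve_length_stop(1)[OF za th']] unfolding curve_length_stop(2)[OF za th'] by simp
    then show ?thesis using len[of \<theta> 1] th d_commute[of p' "y \<theta>"] by (auto intro: order_trans)
  qed
  have el: "ennreal \<bar>E t (y \<theta>) - E t p\<bar> \<le> (\<integral>\<^sup>+s\<in>{0..\<theta>}. w s \<partial>lebesgue)"
    using energy_chain_bound[OF t ya(1), of 0 \<theta>] th ya(2) by (simp add: w_def)
  have er: "ennreal \<bar>E t p' - E t (y \<theta>)\<bar> \<le> (\<integral>\<^sup>+s\<in>{\<theta>..1}. w s \<partial>lebesgue)"
    using energy_chain_bound[OF t ya(1), of \<theta> 1] th ya(3) by (simp add: w_def)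
  have "ennreal (d p (y \<theta>) + \<bar>E t p' - E t (y \<theta>)\<bar>) \<le> ennreal (E t p - E t p')"
    unfolding sl(1)[symmetric] total using left er by (subst ennreal_plus) (auto simp: d_nonneg add_mono)
  then have "d p (y \<theta>) + \<bar>E t p' - E t (y \<theta>)\<bar> \<le> E t p - E t p'"
    using sl(2) by (simp add: ennreal_le_iff)
  then show "d p (y \<theta>) \<le> E t p - E t (y \<theta>)" by linarith
  have "ennreal (\<bar>E t (y \<theta>) - E t p\<bar> + d (y \<theta>) p') \<le> ennreal (E t p - E t p')"
    unfolding sl(1)[symmetric] total using right el by (subst ennreal_plus) (auto simp: d_nonneg add_mono)
  then have "\<bar>E t (y \<theta>) - E t p\<bar> + d (y \<theta>) p' \<le> E t p - E t p'"
    using sl(2) by (simp add: ennreal_le_iff)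
  then show "d (y \<theta>) p' \<le> E t (y \<theta>) - E t p'" by linarith
qed

lemma energy_drop_le_S0:
  assumes t: "t \<in> {0..T}"
  shows "ennreal (E t p - E t p') \<le> S0 t p p'"
  unfolding S0_def
proof (rule INF_greatest)
  fix z assume "z \<in> admissible p p'"
  then have z: "z \<in> ac_curves" "z 0 = p" "z 1 = p'" by (auto simp: admissible_def)
  have "ennreal (E t p - E t p') \<le> ennreal \<bar>E t (z 1) - E t (z 0)\<bar>"
    using z by (intro ennreal_leI) auto
  also have "\<dots> \<le> slope_length t z"
    unfolding slope_length_def by (rule energy_chain_bound[OF t z(1)]) auto
  finally show "ennreal (E t p - E t p') \<le> slope_length t z" .
qed

text \<open>Test stability with the end points of the coordinate segments from \<open>q\<close> in direction \<open>- k\<close>, shrunk by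
\<open>h\<close>, and let \<open>h\<close> tend to \<open>0\<close>.\<close>

lemma stable_imp_slope_le_1:
  assumes t: "t \<in> {0..T}" and st: "\<And>p. E t q \<le> E t p + d q p"
  shows "slope t q \<le> 1"
proof -
  define U \<phi> where "U = fst (some_chart q)" and "\<phi> = snd (some_chart q)"
  have sc: "some_chart q = (U, \<phi>)" by (simp add: U_def \<phi>_def)
  have c: "(U, \<phi>) \<in> charts_at q" using some_chart[of q] by (simp add: U_def \<phi>_def)
  then have at: "(U, \<phi>) \<in> atlas" "q \<in> U" by (auto simp: charts_at_iff)
  define x0 where "x0 = \<phi> q"
  have x0: "x0 \<in> \<phi> ` U" "inv_into U \<phi> x0 = q" using at chartD(5)[OF at] by (auto simp: x0_def)
  define g where "g x = E t (inv_into U \<phi> x)" for x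
  define D where "D = frechet_derivative g (at x0)"
  have D: "(g has_derivative D) (at x0)"
    unfolding D_def g_def using at x0 by (intro energy_has_derivative_chart[OF at(1) t]) auto
  have lin: "linear D" using D by (rule has_derivative_linear)
  have key: "D k \<le> chart_norm U \<phi> x0 k" for k
  proof (rule field_le_epsilon)
    fix e :: real assume e: "e > 0"
    define N where "N = chart_norm U \<phi> x0 k + e"
    have "continuous_on (\<phi> ` U) (\<lambda>x. (\<lambda>(x, w). chart_norm U \<phi> x w) (x, k))"
      by (rule continuous_on_compose2[OF chart_norm_continuous[OF at(1)]]) (auto intro!: continuous_intros)
    then have "continuous_on (\<phi> ` U) (\<lambda>x. chart_norm U \<phi> x k)" by simp
    then have "isCont (\<lambda>x. chart_norm U \<phi> x k) x0"
      using x0(1) chartD(2)[OF at(1)] continuous_on_eq_continuous_at by blast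
    then have "((\<lambda>x. chart_norm U \<phi> x k) \<longlongrightarrow> chart_norm U \<phi> x0 k) (nhds x0)"
      unfolding isCont_def by (rule tendsto_at_iff_tendsto_nhds[of "\<lambda>x. chart_norm U \<phi> x k", THEN iffD1])
    then have "\<forall>\<^sub>F x in nhds x0. chart_norm U \<phi> x k < N"
      by (rule order_tendstoD(2)) (use e in \<open>simp add: N_def\<close>)
    moreover have "\<forall>\<^sub>F x in nhds x0. x \<in> \<phi> ` U"
      using chartD(2)[OF at(1)] x0 by (intro eventually_nhds_in_open) auto
    ultimately have "\<forall>\<^sub>F x in nhds x0. chart_norm U \<phi> x k < N \<and> x \<in> \<phi> ` U" by (rule eventually_conj)
    then obtain \<delta> where \<delta>: "\<delta> > 0" "\<And>x. dist x x0 < \<delta> \<Longrightarrow> chart_norm U \<phi> x k < N \<and> x \<in> \<phi> ` U"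
      unfolding eventually_nhds_metric by blast
    have est: "g x0 - g (x0 - h *\<^sub>R k) \<le> h * N" if h: "h > 0" "h * norm k < \<delta>" for h
    proof -
      have near: "dist (x0 + s *\<^sub>R (- (h *\<^sub>R k))) x0 < \<delta>" if s: "0 \<le> s" "s \<le> 1" for s
      proof -
        have "dist (x0 + s *\<^sub>R (- (h *\<^sub>R k))) x0 = s * (h * norm k)"
          using s h by (simp add: dist_norm abs_mult)
        also have "\<dots> \<le> 1 * (h * norm k)" using s h by (intro mult_right_mono) auto
        finally show ?thesis using h by simp
      qed
      have sg: "x0 + s *\<^sub>R (- (h *\<^sub>R k)) \<in> \<phi> ` U" if "0 \<le> s" "s \<le> 1" for s
        using \<delta>(2)[OF near[OF that]] by blast
      have cn: "chart_norm U \<phi> (x0 + s *\<^sub>R (- (h *\<^sub>R k))) (- (h *\<^sub>R k)) \<le> h * N" if "0 \<le> s" "s \<le> 1" for s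
      proof -
        have "chart_norm U \<phi> (x0 + s *\<^sub>R (- (h *\<^sub>R k))) ((- h) *\<^sub>R k) = h * chart_norm U \<phi> (x0 + s *\<^sub>R (- (h *\<^sub>R k))) k"
          using chart_norm_scale[OF at(1) sg[OF that], of "-h" k] h by simp
        also have "\<dots> \<le> h * N" using \<delta>(2)[OF near[OF that]] h by (intro mult_left_mono) auto
        finally show ?thesis by simp
      qed
      let ?p = "inv_into U \<phi> (x0 + (- (h *\<^sub>R k)))"
      let ?y = "\<lambda>s. inv_into U \<phi> (x0 + s *\<^sub>R (- (h *\<^sub>R k)))"
      have "?y \<in> admissible (inv_into U \<phi> x0) ?p"
        by (rule curve_length_segment(1)[OF at(1)]) (rule sg)
      then have "ennreal (d q ?p) \<le> curve_length ?y 0 1"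
        unfolding x0(2) by (rule d_le_length)
      also have "\<dots> \<le> ennreal (h * N)"
        by (rule curve_length_segment(2)[OF at(1)]) (rule sg cn; assumption)+
      finally have "ennreal (d q ?p) \<le> ennreal (h * N)" .
      moreover have "h * N \<ge> 0"
      proof -
        have "chart_norm U \<phi> x0 k \<ge> 0"
          unfolding chart_norm_def x0(2) by (intro R1_nonneg tangent_of_in_tangent_space c)
        then show ?thesis using h e by (simp add: N_def)
      qed
      ultimately have "d q ?p \<le> h * N" by simp
      then show ?thesis using st[of ?p] x0 by (simp add: g_def)
    qed
    have der: "((\<lambda>h. g (x0 - h *\<^sub>R k)) has_real_derivative - D k) (at 0)"
    proof -
      have "((\<lambda>h. x0 - h *\<^sub>R k) has_derivative (\<lambda>h. - (h *\<^sub>R k))) (at 0)"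
        by (auto intro!: derivative_eq_intros)
      moreover have "(g has_derivative D) (at (x0 - 0 *\<^sub>R k))" using D by simp
      ultimately have "(g \<circ> (\<lambda>h. x0 - h *\<^sub>R k) has_derivative (D \<circ> (\<lambda>h. - (h *\<^sub>R k)))) (at 0)"
        by (rule diff_chain_at)
      moreover have "D \<circ> (\<lambda>h. - (h *\<^sub>R k)) = (*) (- D k)"
        using linear_scale[OF lin] linear_neg[OF lin] by (auto simp: fun_eq_iff)
      ultimately show ?thesis by (simp add: has_field_derivative_def comp_def)
    qed
    then have "((\<lambda>h. (g (x0 - h *\<^sub>R k) - g x0) / h) \<longlongrightarrow> - D k) (at 0)"
      by (simp add: has_field_derivative_iff)
    then have lim: "((\<lambda>h. (g (x0 - h *\<^sub>R k) - g x0) / h) \<longlongrightarrow> - D k) (at_right 0)"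
      by (rule filterlim_at_split[THEN iffD1, THEN conjunct2])
    have "\<forall>\<^sub>F h in at_right 0. (g (x0 - h *\<^sub>R k) - g x0) / h \<ge> - N"
    proof -
      have "\<forall>\<^sub>F h::real in at_right 0. h > 0" by (rule eventually_at_right_less)
      moreover have "\<forall>\<^sub>F h::real in at_right 0. h * norm k < \<delta>"
      proof (rule order_tendstoD(2)[OF _ \<delta>(1)])
        show "((\<lambda>h. h * norm k) \<longlongrightarrow> 0) (at_right 0)" by (auto intro!: tendsto_eq_intros)
      qed
      ultimately show ?thesis
      proof eventually_elim
        case (elim h)
        then show ?case using est[of h] by (simp add: field_simps)
      qed
    qed
    then have "- N \<le> - D k" using lim by (intro tendsto_lowerbound) auto
    then show "D k \<le> chart_norm U \<phi> x0 k + e" by (simp add: N_def)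
  qed
  have "differential (E t) q v / R1 q v \<le> 1" if v: "v \<in> tangent_space q - {\<lambda>_. 0}" for v
  proof -
    have "R1 q v > 0" using R1_nonneg[of v q] R1_eq_0_iff[of v q] v by force
    moreover have "differential (E t) q v = D (v (U, \<phi>))"
      by (simp add: differential_eq sc D_def g_def[abs_def] x0_def)
    moreover have "R1 q v = chart_norm U \<phi> x0 (v (U, \<phi>))"
      unfolding chart_norm_def x0(2) using tangent_of_surj[OF c, of v] v by auto
    ultimately show ?thesis using key[of "v (U, \<phi>)"] by simp
  qed
  moreover have "tangent_space q - {\<lambda>_. 0} \<noteq> {}"
  proof -
    obtain b :: 'e where "b \<in> Basis" using nonempty_Basis by blast
    then have "tangent_of U \<phi> q b \<in> tangent_space q - {\<lambda>_. 0}"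
      using tangent_of_in_tangent_space[OF c, of b] tangent_of_eq_0_iff[OF c, of b] nonzero_Basis by auto
    then show ?thesis by blast
  qed
  ultimately show ?thesis unfolding slope_def by (intro cSUP_least) auto
qed

end

section \<open>Curves of bounded variation\<close>

context rate_independent_system
begin

lemma Var_least:
  assumes "\<And>n \<tau>. (\<forall>j<n. \<tau> j < \<tau> (Suc j)) \<Longrightarrow> (\<forall>j\<le>n. \<tau> j \<in> I) \<Longrightarrow>
     ereal (\<Sum>j<n. d (q (\<tau> j)) (q (\<tau> (Suc j)))) \<le> B"
  shows "Var q I \<le> B"
  unfolding Var_def by (rule SUP_least) (use assms in auto)

lemma Var_upper:
  assumes "\<forall>j<n. \<tau> j < \<tau> (Suc j)" "\<forall>j\<le>n. \<tau> j \<in> I"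
  shows "ereal (\<Sum>j<n. d (q (\<tau> j)) (q (\<tau> (Suc j)))) \<le> Var q I"
  unfolding Var_def using assms by (intro SUP_upper2[of "(n, \<tau>)"]) auto

text \<open>Bounding the variation by a telescoping sum. Applied to \<open>V\<close> itself it gives superadditivity of the
variation; applied to \<open>V\<close> with a modified jump at one point it bounds the jumps of \<open>V\<close>. So partitions never
have to be refined or merged.\<close>

lemma Var_le_increment:
  assumes le: "\<And>x y. r \<le> x \<Longrightarrow> x < y \<Longrightarrow> y \<le> s \<Longrightarrow> d (q x) (q y) \<le> \<Phi> y - \<Phi> x" and rs: "r \<le> s"
  shows "Var q {r..s} \<le> ereal (\<Phi> s - \<Phi> r)"
proof (rule Var_least)
  fix n :: nat and \<tau> :: "nat \<Rightarrow> real"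
  assume \<tau>: "\<forall>j<n. \<tau> j < \<tau> (Suc j)" "\<forall>j\<le>n. \<tau> j \<in> {r..s}"
  have mono: "\<Phi> x \<le> \<Phi> y" if "r \<le> x" "x \<le> y" "y \<le> s" for x y
    using le[of x y] d_nonneg[of "q x" "q y"] that by (cases "x = y") auto
  have "(\<Sum>j<n. d (q (\<tau> j)) (q (\<tau> (Suc j)))) \<le> (\<Sum>j<n. \<Phi> (\<tau> (Suc j)) - \<Phi> (\<tau> j))"
    using \<tau> by (intro sum_mono le) auto
  also have "\<dots> = \<Phi> (\<tau> n) - \<Phi> (\<tau> 0)" by (rule sum_lessThan_telescope)
  also have "\<dots> \<le> \<Phi> s - \<Phi> r"
    using \<tau>(2) by (intro diff_mono mono) auto
  finally show "ereal (\<Sum>j<n. d (q (\<tau> j)) (q (\<tau> (Suc j)))) \<le> ereal (\<Phi> s - \<Phi> r)" by simp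
qed

end

locale bounded_variation_curve = rate_independent_system atlas R1 T E
  for atlas :: "('q::{t2_space, second_countable_topology}, 'e::euclidean_space) chart set"
    and R1 :: "'q \<Rightarrow> ('q, 'e) tangent \<Rightarrow> real" and T :: real and E :: "real \<Rightarrow> 'q \<Rightarrow> real" +
  fixes q :: "real \<Rightarrow> 'q"
  assumes finite_Var: "Var q {0..T} < \<infinity>"
begin

lemma Var_eq_V:
  assumes "0 \<le> t" "t \<le> T" shows "Var q {0..t} = ereal (V q t)"
proof -
  have "Var q {0..t} \<le> Var q {0..T}"
    by (rule Var_least, rule Var_upper) (use assms in \<open>auto intro: order_trans\<close>)
  moreover have "0 \<le> Var q {0..t}"
    using Var_upper[of 0 "\<lambda>_. 0" "{0..t}" q] assms by (simp add: zero_ereal_def)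
  ultimately have "\<bar>Var q {0..t}\<bar> \<noteq> \<infinity>" using finite_Var by auto
  then show ?thesis by (simp add: V_def ereal_real)
qed

lemma d_le_V:
  assumes xy: "0 \<le> x" "x < y" "y \<le> T"
  shows "d (q x) (q y) \<le> V q y - V q x"
proof -
  have "Var q {0..x} \<le> ereal (V q y - d (q x) (q y))"
  proof (rule Var_least)
    fix n :: nat and \<tau> :: "nat \<Rightarrow> real"
    assume \<tau>: "\<forall>j<n. \<tau> j < \<tau> (Suc j)" "\<forall>j\<le>n. \<tau> j \<in> {0..x}"
    have up: "ereal (\<Sum>j<m. d (q (\<sigma> j)) (q (\<sigma> (Suc j)))) \<le> ereal (V q y)"
      if "\<forall>j<m. \<sigma> j < \<sigma> (Suc j)" "\<forall>j\<le>m. \<sigma> j \<in> {0..y}" for m \<sigma>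
      using Var_upper[OF that, of q] Var_eq_V[of y] xy by simp
    show "ereal (\<Sum>j<n. d (q (\<tau> j)) (q (\<tau> (Suc j)))) \<le> ereal (V q y - d (q x) (q y))"
    proof (cases "\<tau> n = x")
      case True
      define \<sigma> where "\<sigma> j = (if j \<le> n then \<tau> j else y)" for j
      have \<sigma>1: "\<forall>j<Suc n. \<sigma> j < \<sigma> (Suc j)"
        using \<tau>(1) True xy by (auto simp: \<sigma>_def less_Suc_eq)
      have \<sigma>2: "\<forall>j\<le>Suc n. \<sigma> j \<in> {0..y}" using \<tau>(2) xy by (force simp: \<sigma>_def)
      have "(\<Sum>j<Suc n. d (q (\<sigma> j)) (q (\<sigma> (Suc j)))) = (\<Sum>j<n. d (q (\<tau> j)) (q (\<tau> (Suc j)))) + d (q x) (q y)"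
        using True by (simp add: \<sigma>_def)
      then show ?thesis using up[OF \<sigma>1 \<sigma>2] by simp
    next
      case False
      then have lt: "\<tau> n < x" using \<tau>(2) by force
      define \<sigma> where "\<sigma> j = (if j \<le> n then \<tau> j else if j = Suc n then x else y)" for j
      have \<sigma>1: "\<forall>j<Suc (Suc n). \<sigma> j < \<sigma> (Suc j)"
        using \<tau>(1) lt xy by (auto simp: \<sigma>_def less_Suc_eq)
      have \<sigma>2: "\<forall>j\<le>Suc (Suc n). \<sigma> j \<in> {0..y}" using \<tau>(2) xy by (force simp: \<sigma>_def)
      have "(\<Sum>j<Suc (Suc n). d (q (\<sigma> j)) (q (\<sigma> (Suc j)))) =
         (\<Sum>j<n. d (q (\<tau> j)) (q (\<tau> (Suc j)))) + d (q (\<tau> n)) (q x) + d (q x) (q y)"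
        by (simp add: \<sigma>_def)
      then show ?thesis using up[OF \<sigma>1 \<sigma>2] d_nonneg[of "q (\<tau> n)" "q x"] by simp
    qed
  qed
  then show ?thesis using Var_eq_V[of x] xy by simp
qed

lemma V_0: "V q 0 = 0"
proof -
  have "Var q {0..0} \<le> ereal (0 - 0)" by (rule Var_le_increment) auto
  moreover have "0 \<le> Var q {0..0}"
    using Var_upper[of 0 "\<lambda>_. 0" "{0..0}" q] by (simp add: zero_ereal_def)
  ultimately show ?thesis using Var_eq_V[of 0] T_pos by simp
qed

lemma V_mono: "0 \<le> x \<Longrightarrow> x \<le> y \<Longrightarrow> y \<le> T \<Longrightarrow> V q x \<le> V q y"
  using d_le_V[of x y] d_nonneg[of "q x" "q y"] by (cases "x = y") auto

lemma Var_le_V: "0 \<le> r \<Longrightarrow> r \<le> s \<Longrightarrow> s \<le> T \<Longrightarrow> Var q {r..s} \<le> ereal (V q s - V q r)"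
  by (rule Var_le_increment) (auto intro: d_le_V)

text \<open>The constant extension beyond \<open>[0,T]\<close> lets the conventions at \<open>0\<close> and \<open>T\<close> become ordinary side limits.\<close>

definition V_ext :: "real \<Rightarrow> real" where "V_ext t = V q (max 0 (min T t))"

lemma V_ext_eq: "0 \<le> t \<Longrightarrow> t \<le> T \<Longrightarrow> V_ext t = V q t" by (simp add: V_ext_def)

lemma V_ext_mono: "x \<le> y \<Longrightarrow> V_ext x \<le> V_ext y"
  unfolding V_ext_def using T_pos by (intro V_mono) auto

lemma V_ext_outside: "t \<le> 0 \<Longrightarrow> V_ext t = 0" "t \<ge> T \<Longrightarrow> V_ext t = V q T"
  using T_pos V_0 by (simp_all add: V_ext_def)

lemma d_le_V_ext: "0 \<le> x \<Longrightarrow> x \<le> y \<Longrightarrow> y \<le> T \<Longrightarrow> d (q x) (q y) \<le> V_ext y - V_ext x"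
  using d_le_V[of x y] by (cases "x = y") (auto simp: V_ext_eq d_refl)

definition V_right :: "real \<Rightarrow> real" where "V_right t = Inf (V_ext ` {t<..})"
definition V_left :: "real \<Rightarrow> real" where "V_left t = Sup (V_ext ` {..<t})"

lemma V_right_tendsto: "(V_ext \<longlongrightarrow> V_right t) (at_right t)"
  using Lim_right_bound[of UNIV t V_ext "V_ext t"] V_ext_mono by (simp add: V_right_def)

lemma V_left_tendsto: "(V_ext \<longlongrightarrow> V_left t) (at_left t)"
  using Lim_left_bound[of UNIV t V_ext "V_ext t"] V_ext_mono by (simp add: V_left_def)

lemma V_right_le: "t < y \<Longrightarrow> V_right t \<le> V_ext y"
  unfolding V_right_def by (intro cINF_lower bdd_belowI2[of _ "V_ext t"]) (auto intro: V_ext_mono)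

lemma V_ext_le_right: "V_ext t \<le> V_right t"
  unfolding V_right_def by (intro cINF_greatest) (auto intro: V_ext_mono)

lemma V_left_ge: "y < t \<Longrightarrow> V_ext y \<le> V_left t"
  unfolding V_left_def by (intro cSUP_upper bdd_aboveI2[of _ _ "V_ext t"]) (auto intro: V_ext_mono)

lemma V_right_mono: "x \<le> y \<Longrightarrow> V_right x \<le> V_right y"
  using V_right_le[of x y] V_ext_le_right[of y] by (cases "x = y") auto

lemma V_right_right_continuous: "continuous (at_right t) V_right"
  unfolding continuous_within
proof (rule order_tendstoI)
  fix a assume "a < V_right t"
  show "\<forall>\<^sub>F x in at_right t. a < V_right x"
    using eventually_at_right_less[of t]
  proof eventually_elim
    case (elim x)
    then show ?case using \<open>a < V_right t\<close> V_right_mono[of t x] by linarith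
  qed
next
  fix a assume "V_right t < a"
  then have "\<forall>\<^sub>F x in at_right t. V_ext x < a" by (rule order_tendstoD(2)[OF V_right_tendsto])
  then obtain y where y: "t < y" "\<And>x. t < x \<Longrightarrow> x < y \<Longrightarrow> V_ext x < a"
    unfolding eventually_at_right_field by blast
  show "\<forall>\<^sub>F x in at_right t. V_right x < a"
    unfolding eventually_at_right_field
  proof (intro exI[of _ y] conjI allI impI y(1))
    fix x assume x: "t < x" "x < y"
    then show "V_right x < a" using V_right_le[of x "(x + y)/2"] y(2)[of "(x+y)/2"] by auto
  qed
qed

text \<open>Distances of values of \<open>q\<close> are bounded by increments of \<open>V\<close>, so convergence of \<open>V\<close> makes \<open>q\<close> Cauchy, and
\<open>d\<close> is complete. The filter is a left or a right neighbourhood filter.\<close>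

lemma onesided_limit:
  assumes F: "F \<noteq> bot" and L: "(V_ext \<longlongrightarrow> L) F" and ev: "\<forall>\<^sub>F a in F. 0 \<le> a \<and> a \<le> T"
  obtains p where "((\<lambda>a. d (q a) p) \<longlongrightarrow> 0) F"
proof -
  have dV: "d (q x) (q y) \<le> \<bar>V_ext x - V_ext y\<bar>" if "0 \<le> x" "x \<le> T" "0 \<le> y" "y \<le> T" for x y
    using d_le_V_ext[of x y] d_le_V_ext[of y x] that d_commute[of "q x" "q y"] by (cases "x \<le> y") auto
  have "\<exists>a. 0 \<le> a \<and> a \<le> T \<and> \<bar>V_ext a - L\<bar> < inverse (real (Suc n))" for n
  proof -
    have "\<forall>\<^sub>F a in F. dist (V_ext a) L < inverse (real (Suc n))" by (rule tendstoD[OF L]) simp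
    then have "\<forall>\<^sub>F a in F. 0 \<le> a \<and> a \<le> T \<and> \<bar>V_ext a - L\<bar> < inverse (real (Suc n))"
      using ev by eventually_elim (auto simp: dist_real_def)
    then show ?thesis using F eventually_happens' by blast
  qed
  then obtain a where a: "\<And>n. 0 \<le> a n" "\<And>n. a n \<le> T" "\<And>n. \<bar>V_ext (a n) - L\<bar> < inverse (real (Suc n))" by metis
  obtain p where p: "(\<lambda>n. d (q (a n)) p) \<longlonglongrightarrow> 0"
  proof (rule d_Cauchy_converges[of "\<lambda>n. q (a n)"])
    fix \<epsilon> :: real assume \<epsilon>: "\<epsilon> > 0"
    obtain N where N: "inverse (real (Suc N)) < \<epsilon>/2" using reals_Archimedean[of "\<epsilon>/2"] \<epsilon> by auto
    show "\<exists>N. \<forall>n\<ge>N. \<forall>m\<ge>N. d (q (a n)) (q (a m)) < \<epsilon>"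
    proof (intro exI[of _ N] allI impI)
      fix n m assume nm: "N \<le> n" "N \<le> m"
      have "inverse (real (Suc n)) \<le> inverse (real (Suc N))" "inverse (real (Suc m)) \<le> inverse (real (Suc N))"
        using nm by (auto intro!: le_imp_inverse_le)
      then show "d (q (a n)) (q (a m)) < \<epsilon>"
        using dV[OF a(1,2)[of n] a(1,2)[of m]] a(3)[of n] a(3)[of m] N by linarith
    qed
  qed
  have "((\<lambda>x. d (q x) p) \<longlongrightarrow> 0) F"
  proof (rule tendstoI)
    fix \<epsilon> :: real assume \<epsilon>: "\<epsilon> > 0"
    have "\<forall>\<^sub>F n in sequentially. dist (d (q (a n)) p) 0 < \<epsilon>/3" using \<epsilon> by (intro tendstoD[OF p]) simp
    moreover have "\<forall>\<^sub>F n in sequentially. inverse (real (Suc n)) < \<epsilon>/3"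
      using order_tendstoD(2)[OF LIMSEQ_inverse_real_of_nat, of "\<epsilon>/3"] \<epsilon> by simp
    ultimately have "\<forall>\<^sub>F n in sequentially. dist (d (q (a n)) p) 0 < \<epsilon>/3 \<and> inverse (real (Suc n)) < \<epsilon>/3"
      by (rule eventually_conj)
    then obtain n where n: "dist (d (q (a n)) p) 0 < \<epsilon>/3" "inverse (real (Suc n)) < \<epsilon>/3"
      using eventually_happens'[of sequentially] by force
    have "\<forall>\<^sub>F x in F. dist (V_ext x) L < \<epsilon>/3" using \<epsilon> by (intro tendstoD[OF L]) simp
    then show "\<forall>\<^sub>F x in F. dist (d (q x) p) 0 < \<epsilon>"
      using ev
    proof eventually_elim
      case (elim x)
      have "d (q x) p \<le> d (q x) (q (a n)) + d (q (a n)) p" by (rule d_triangle)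
      also have "d (q x) (q (a n)) \<le> \<bar>V_ext x - V_ext (a n)\<bar>" using elim a by (intro dV) auto
      finally show ?case
        using n elim(1) a(3)[of n] d_nonneg[of "q x" p] d_nonneg[of "q (a n)" p] unfolding dist_real_def by linarith
    qed
  qed
  then show ?thesis by (rule that)
qed

lemma right_limit:
  assumes t: "0 \<le> t" "t < T"
  shows "((\<lambda>a. d (q a) (lim_right q t)) \<longlongrightarrow> 0) (at_right t)" "(q \<longlongrightarrow> lim_right q t) (at_right t)"
proof -
  have "\<forall>\<^sub>F a in at_right t. 0 \<le> a \<and> a \<le> T"
    unfolding eventually_at_right_field using t by (intro exI[of _ T]) auto
  then obtain p where p: "((\<lambda>a. d (q a) p) \<longlongrightarrow> 0) (at_right t)"
    using onesided_limit[OF _ V_right_tendsto[of t]] by auto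
  have lim: "(q \<longlongrightarrow> p) (at_right t)" by (rule d_tendsto_imp_tendsto[OF p])
  have "lim_right q t = p" using t lim by (simp add: lim_right_def tendsto_Lim)
  then show "((\<lambda>a. d (q a) (lim_right q t)) \<longlongrightarrow> 0) (at_right t)" "(q \<longlongrightarrow> lim_right q t) (at_right t)"
    using p lim by auto
qed

lemma left_limit:
  assumes t: "0 < t" "t \<le> T"
  shows "((\<lambda>a. d (q a) (lim_left q t)) \<longlongrightarrow> 0) (at_left t)" "(q \<longlongrightarrow> lim_left q t) (at_left t)"
proof -
  have "\<forall>\<^sub>F a in at_left t. 0 \<le> a \<and> a \<le> T"
    unfolding eventually_at_left_field using t by (intro exI[of _ 0]) auto
  then obtain p where p: "((\<lambda>a. d (q a) p) \<longlongrightarrow> 0) (at_left t)"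
    using onesided_limit[OF _ V_left_tendsto[of t]] by auto
  have lim: "(q \<longlongrightarrow> p) (at_left t)" by (rule d_tendsto_imp_tendsto[OF p])
  have "lim_left q t = p" using t lim by (simp add: lim_left_def tendsto_Lim)
  then show "((\<lambda>a. d (q a) (lim_left q t)) \<longlongrightarrow> 0) (at_left t)" "(q \<longlongrightarrow> lim_left q t) (at_left t)"
    using p lim by auto
qed

lemma d_right_limit_le:
  assumes "0 \<le> t" "t < y" "y \<le> T"
  shows "d (lim_right q t) (q y) \<le> V_ext y - V_right t"
proof (rule tendsto_lowerbound[of "\<lambda>a. d (q a) (lim_right q t) + (V_ext y - V_ext a)" _ "at_right t"])
  have "((\<lambda>a. d (q a) (lim_right q t) + (V_ext y - V_ext a)) \<longlongrightarrow> 0 + (V_ext y - V_right t)) (at_right t)"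
    using assms by (intro tendsto_intros right_limit V_right_tendsto) auto
  then show "((\<lambda>a. d (q a) (lim_right q t) + (V_ext y - V_ext a)) \<longlongrightarrow> V_ext y - V_right t) (at_right t)" by simp
  show "\<forall>\<^sub>F a in at_right t. d (lim_right q t) (q y) \<le> d (q a) (lim_right q t) + (V_ext y - V_ext a)"
    unfolding eventually_at_right_field
  proof (intro exI[of _ y] conjI allI impI assms(2))
    fix a assume a: "t < a" "a < y"
    have "d (lim_right q t) (q y) \<le> d (lim_right q t) (q a) + d (q a) (q y)" by (rule d_triangle)
    then show "d (lim_right q t) (q y) \<le> d (q a) (lim_right q t) + (V_ext y - V_ext a)"
      using d_le_V_ext[of a y] a assms d_commute[of "lim_right q t" "q a"] by auto
  qed
qed simp

lemma d_left_limit_le: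
  assumes "0 \<le> x" "x < t" "t \<le> T"
  shows "d (q x) (lim_left q t) \<le> V_left t - V_ext x"
proof (rule tendsto_lowerbound[of "\<lambda>a. d (q a) (lim_left q t) + (V_ext a - V_ext x)" _ "at_left t"])
  have "((\<lambda>a. d (q a) (lim_left q t) + (V_ext a - V_ext x)) \<longlongrightarrow> 0 + (V_left t - V_ext x)) (at_left t)"
    using assms by (intro tendsto_intros left_limit V_left_tendsto) auto
  then show "((\<lambda>a. d (q a) (lim_left q t) + (V_ext a - V_ext x)) \<longlongrightarrow> V_left t - V_ext x) (at_left t)" by simp
  show "\<forall>\<^sub>F a in at_left t. d (q x) (lim_left q t) \<le> d (q a) (lim_left q t) + (V_ext a - V_ext x)"
    unfolding eventually_at_left_field
  proof (intro exI[of _ x] conjI allI impI assms(2))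
    fix a assume a: "x < a" "a < t"
    have "d (q x) (lim_left q t) \<le> d (q x) (q a) + d (q a) (lim_left q t)" by (rule d_triangle)
    then show "d (q x) (lim_left q t) \<le> d (q a) (lim_left q t) + (V_ext a - V_ext x)"
      using d_le_V_ext[of x a] a assms by auto
  qed
qed simp

text \<open>The function \<open>\<Phi>\<close> is \<open>V_ext\<close> with the size of its jump at \<open>t\<close> replaced by the distance \<open>D\<close>. It still dominates all
distances of values of \<open>q\<close>, thus the whole variation, so the jump is at most \<open>D\<close>.\<close>

lemma V_right_jump:
  assumes t: "0 \<le> t" "t \<le> T"
  shows "V_right t - V_ext t \<le> d (q t) (lim_right q t)"
proof (cases "t = T")
  case True
  have "V_right t \<le> V_ext (T + 1)" using True by (intro V_right_le) simp
  then show ?thesis using True V_ext_outside(2) d_nonneg[of "q t" "lim_right q t"] by simp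
next
  case False
  define D where "D = d (q t) (lim_right q t)"
  define \<Phi> where "\<Phi> x = (if x \<le> t then V_ext x else V_ext x - (V_right t - V_ext t) + D)" for x
  have "Var q {0..T} \<le> ereal (\<Phi> T - \<Phi> 0)"
  proof (rule Var_le_increment)
    fix x y assume xy: "0 \<le> x" "x < y" "y \<le> T"
    show "d (q x) (q y) \<le> \<Phi> y - \<Phi> x"
    proof (cases "x \<le> t \<and> t < y")
      case True
      have "d (q x) (q y) \<le> d (q x) (q t) + (D + d (lim_right q t) (q y))"
        unfolding D_def using d_triangle[of "q x" "q y" "q t"] d_triangle[of "q t" "q y" "lim_right q t"] by linarith
      then show ?thesis
        using d_le_V_ext[of x t] d_right_limit_le[of t y] xy t True by (auto simp: \<Phi>_def)
    next
      case False
      then show ?thesis using d_le_V_ext[of x y] xy by (auto simp: \<Phi>_def)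
    qed
  qed (use T_pos in simp)
  then have "V_ext T \<le> V_ext T - (V_right t - V_ext t) + D"
    using Var_eq_V[of T] T_pos t False V_ext_outside(1)[of 0] by (simp add: \<Phi>_def V_ext_eq)
  then show ?thesis by (simp add: D_def)
qed

lemma V_left_jump:
  assumes t: "0 \<le> t" "t \<le> T"
  shows "V_ext t - V_left t \<le> d (lim_left q t) (q t)"
proof (cases "t = 0")
  case True
  have "V_ext (-1) \<le> V_left t" using True by (intro V_left_ge) simp
  then show ?thesis using True V_ext_outside(1)[of "-1"] V_ext_outside(1)[of 0] d_nonneg[of "lim_left q t" "q t"] by simp
next
  case False
  define D where "D = d (lim_left q t) (q t)"
  define \<Phi> where "\<Phi> x = (if x < t then V_ext x else V_ext x - (V_ext t - V_left t) + D)" for x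
  have "Var q {0..T} \<le> ereal (\<Phi> T - \<Phi> 0)"
  proof (rule Var_le_increment)
    fix x y assume xy: "0 \<le> x" "x < y" "y \<le> T"
    show "d (q x) (q y) \<le> \<Phi> y - \<Phi> x"
    proof (cases "x < t \<and> t \<le> y")
      case True
      have "d (q x) (q y) \<le> d (q x) (lim_left q t) + (D + d (q t) (q y))"
        unfolding D_def using d_triangle[of "q x" "q y" "lim_left q t"] d_triangle[of "lim_left q t" "q y" "q t"] by linarith
      then show ?thesis
        using d_le_V_ext[of t y] d_left_limit_le[of x t] xy t True by (auto simp: \<Phi>_def)
    next
      case False
      then show ?thesis using d_le_V_ext[of x y] xy by (auto simp: \<Phi>_def)
    qed
  qed (use T_pos in simp)
  then have "V_ext T \<le> V_ext T - (V_ext t - V_left t) + D"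
    using Var_eq_V[of T] T_pos t False V_ext_outside(1)[of 0] by (simp add: \<Phi>_def V_ext_eq)
  then show ?thesis by (simp add: D_def)
qed

lemma countable_discontinuities: "countable {t. \<not> isCont V_ext t}"
  by (rule mono_ctble_discont) (auto simp: mono_def V_ext_mono)

lemma continuous_time:
  assumes "0 \<le> t" "t \<le> T" "isCont V_ext t"
  shows "lim_left q t = q t" "lim_right q t = q t"
proof -
  have vt: "(V_ext \<longlongrightarrow> V_ext t) (at t)" using assms by (simp add: isCont_def)
  have "V_left t = V_ext t"
    by (rule tendsto_unique[OF _ V_left_tendsto tendsto_within_subset[OF vt]]) auto
  moreover have "V_right t = V_ext t"
    by (rule tendsto_unique[OF _ V_right_tendsto tendsto_within_subset[OF vt]]) auto
  ultimately have V_ext: "V_left t = V_ext t" "V_right t = V_ext t" by auto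
  show "lim_right q t = q t"
  proof (cases "t = T")
    case False
    have "\<forall>\<^sub>F a in at_right t. norm (d (q a) (q t)) \<le> V_ext a - V_ext t"
    proof -
      have "\<forall>\<^sub>F a in at_right t. t < a \<and> a < T"
        unfolding eventually_at_right_field using False assms by (intro exI[of _ T]) auto
      then show ?thesis
        proof eventually_elim
        case (elim a)
        then show ?case
          using d_le_V_ext[of t a] assms(1) d_nonneg[of "q a" "q t"] d_commute[of "q a" "q t"] by simp
      qed
    qed
    moreover have "((\<lambda>a. V_ext a - V_ext t) \<longlongrightarrow> 0) (at_right t)"
      using tendsto_diff[OF V_right_tendsto[of t] tendsto_const[of "V_ext t"]] V_ext by simp
    ultimately have "((\<lambda>a. d (q a) (q t)) \<longlongrightarrow> 0) (at_right t)"
      by (rule Lim_null_comparison)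
    then have "(q \<longlongrightarrow> q t) (at_right t)" by (rule d_tendsto_imp_tendsto)
    then show ?thesis using assms False by (simp add: lim_right_def tendsto_Lim)
  qed (simp add: lim_right_def)
  show "lim_left q t = q t"
  proof (cases "t = 0")
    case False
    have "\<forall>\<^sub>F a in at_left t. norm (d (q a) (q t)) \<le> V_ext t - V_ext a"
    proof -
      have "\<forall>\<^sub>F a in at_left t. 0 < a \<and> a < t"
        unfolding eventually_at_left_field using False assms by (intro exI[of _ 0]) auto
      then show ?thesis
        proof eventually_elim
        case (elim a)
        then show ?case using d_le_V_ext[of a t] assms(2) d_nonneg[of "q a" "q t"] by simp
      qed
    qed
    moreover have "((\<lambda>a. V_ext t - V_ext a) \<longlongrightarrow> 0) (at_left t)"
      using tendsto_diff[OF tendsto_const[of "V_ext t"] V_left_tendsto[of t]] V_ext by simp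
    ultimately have "((\<lambda>a. d (q a) (q t)) \<longlongrightarrow> 0) (at_left t)"
      by (rule Lim_null_comparison)
    then have "(q \<longlongrightarrow> q t) (at_left t)" by (rule d_tendsto_imp_tendsto)
    then show ?thesis using assms False by (simp add: lim_left_def tendsto_Lim)
  qed (simp add: lim_left_def)
qed

lemma countable_jump_points: "countable (jump_points q)"
  by (rule countable_subset[OF _ countable_discontinuities])
    (auto simp: jump_points_def cont_points_def continuous_time)

lemma continuous_time_isCont:
  assumes "0 < t" "t < T" "isCont V_ext t"
  shows "(q \<longlongrightarrow> q t) (at t)"
  using left_limit(2)[of t] right_limit(2)[of t] continuous_time[of t] assms
  by (simp add: filterlim_at_split)

text \<open>Near every time the power is bounded, since it has one-sided limits there; bisection yields a global bound.\<close>

lemma dt_E_bounded: "\<exists>B. \<forall>t. 0 \<le> t \<and> t \<le> T \<longrightarrow> \<bar>dt_E t (q t)\<bar> \<le> B"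
proof -
  define P where "P u w \<longleftrightarrow> (\<exists>B. \<forall>t. 0 \<le> t \<and> t \<le> T \<and> u \<le> t \<and> t \<le> w \<longrightarrow> \<bar>dt_E t (q t)\<bar> \<le> B)" for u w
  have "0 \<le> T" using T_pos by simp
  then have "P 0 T"
  proof (rule Bolzano[of 0 T P])
    fix a b c assume "P a b" "P b c"
    then obtain B1 B2 where B: "\<And>t. 0 \<le> t \<and> t \<le> T \<and> a \<le> t \<and> t \<le> b \<Longrightarrow> \<bar>dt_E t (q t)\<bar> \<le> B1"
      "\<And>t. 0 \<le> t \<and> t \<le> T \<and> b \<le> t \<and> t \<le> c \<Longrightarrow> \<bar>dt_E t (q t)\<bar> \<le> B2"
      unfolding P_def by blast
    show "P a c" unfolding P_def
    proof (intro exI[of _ "max B1 B2"] allI impI)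
      fix t assume "0 \<le> t \<and> t \<le> T \<and> a \<le> t \<and> t \<le> c"
      then show "\<bar>dt_E t (q t)\<bar> \<le> max B1 B2" using B[of t] by (cases "t \<le> b") auto
    qed
  next
    fix t assume t: "0 \<le> t" "t \<le> T"
    have r: "\<exists>e B. e > 0 \<and> (\<forall>a. t < a \<and> a < t + e \<and> a \<le> T \<longrightarrow> \<bar>dt_E a (q a)\<bar> \<le> B)"
    proof (cases "t = T")
      case False
      have "((\<lambda>a. dt_E a (q a)) \<longlongrightarrow> dt_E t (lim_right q t)) (at_right t)"
      proof (rule dt_E_tendsto)
        show "\<forall>\<^sub>F a in at_right t. a \<in> {0..T}"
          unfolding eventually_at_right_field using t False by (intro exI[of _ T]) auto
      qed (use t False right_limit in auto)
      then have "\<forall>\<^sub>F a in at_right t. dist (dt_E a (q a)) (dt_E t (lim_right q t)) < 1" by (rule tendstoD) simp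
      then obtain b where b: "b > t" "\<And>a. t < a \<Longrightarrow> a < b \<Longrightarrow> dist (dt_E a (q a)) (dt_E t (lim_right q t)) < 1"
        unfolding eventually_at_right_field by blast
      have "\<bar>dt_E a (q a)\<bar> \<le> \<bar>dt_E t (lim_right q t)\<bar> + 1" if "t < a" "a < b" for a
        using b(2)[OF that] by (simp add: dist_real_def)
      then show ?thesis using b(1) by (intro exI[of _ "b - t"] exI[of _ "\<bar>dt_E t (lim_right q t)\<bar> + 1"]) auto
    qed (auto intro: exI[of _ 1])
    have l: "\<exists>e B. e > 0 \<and> (\<forall>a. t - e < a \<and> a < t \<and> 0 \<le> a \<longrightarrow> \<bar>dt_E a (q a)\<bar> \<le> B)"
    proof (cases "t = 0")
      case False
      have "((\<lambda>a. dt_E a (q a)) \<longlongrightarrow> dt_E t (lim_left q t)) (at_left t)"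
      proof (rule dt_E_tendsto)
        show "\<forall>\<^sub>F a in at_left t. a \<in> {0..T}"
          unfolding eventually_at_left_field using t False by (intro exI[of _ 0]) auto
      qed (use t False left_limit in auto)
      then have "\<forall>\<^sub>F a in at_left t. dist (dt_E a (q a)) (dt_E t (lim_left q t)) < 1" by (rule tendstoD) simp
      then obtain b where b: "b < t" "\<And>a. b < a \<Longrightarrow> a < t \<Longrightarrow> dist (dt_E a (q a)) (dt_E t (lim_left q t)) < 1"
        unfolding eventually_at_left_field by blast
      have "\<bar>dt_E a (q a)\<bar> \<le> \<bar>dt_E t (lim_left q t)\<bar> + 1" if "b < a" "a < t" for a
        using b(2)[OF that] by (simp add: dist_real_def)
      then show ?thesis using b(1) by (intro exI[of _ "t - b"] exI[of _ "\<bar>dt_E t (lim_left q t)\<bar> + 1"]) auto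
    qed (auto intro: exI[of _ 1])
    obtain e1 B1 where e1: "e1 > 0" "\<And>a. t < a \<and> a < t + e1 \<and> a \<le> T \<Longrightarrow> \<bar>dt_E a (q a)\<bar> \<le> B1" using r by blast
    obtain e2 B2 where e2: "e2 > 0" "\<And>a. t - e2 < a \<and> a < t \<and> 0 \<le> a \<Longrightarrow> \<bar>dt_E a (q a)\<bar> \<le> B2" using l by blast
    show "\<exists>e>0. \<forall>a b. a \<le> t \<and> t \<le> b \<and> b - a < e \<longrightarrow> P a b"
    proof (intro exI[of _ "min e1 e2"] conjI allI impI)
      fix a b assume ab: "a \<le> t \<and> t \<le> b \<and> b - a < min e1 e2"
      show "P a b" unfolding P_def
      proof (intro exI[of _ "max (max B1 B2) \<bar>dt_E t (q t)\<bar>"] allI impI)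
        fix s assume s: "0 \<le> s \<and> s \<le> T \<and> a \<le> s \<and> s \<le> b"
        consider "s = t" | "s < t" | "t < s" by linarith
        then show "\<bar>dt_E s (q s)\<bar> \<le> max (max B1 B2) \<bar>dt_E t (q t)\<bar>"
          using e1(2)[of s] e2(2)[of s] s ab by cases auto
      qed
    qed (use e1 e2 in auto)
  qed
  then show ?thesis unfolding P_def by blast
qed

lemma dt_E_integrable:
  assumes "0 \<le> a" "b \<le> T"
  shows "set_integrable lebesgue {a..b} (\<lambda>t. dt_E t (q t))"
proof -
  define G where "G t = (if 0 \<le> t \<and> t \<le> T then dt_E t (q t) else 0)" for t
  let ?X = "{t. \<not> isCont V_ext t} \<union> {0, T}"
  have "isCont G t" if t: "t \<notin> ?X" for t
  proof -
    consider "t < 0" | "T < t" | "0 < t" "t < T" using t by force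
    then show ?thesis
    proof cases
      case 1
      have "\<forall>\<^sub>F x in nhds t. G x = 0"
        using eventually_nhds_in_open[of "{..<0}" t] 1 by (auto elim!: eventually_mono simp: G_def)
      then show ?thesis by (subst isCont_cong[of G "\<lambda>_. 0"]) auto
    next
      case 2
      have "\<forall>\<^sub>F x in nhds t. G x = 0"
        using eventually_nhds_in_open[of "{T<..}" t] 2 by (auto elim!: eventually_mono simp: G_def)
      then show ?thesis by (subst isCont_cong[of G "\<lambda>_. 0"]) auto
    next
      case 3
      have "\<forall>\<^sub>F x in nhds t. x \<in> {0<..<T}" using 3 by (intro eventually_nhds_in_open) auto
      then have ev: "\<forall>\<^sub>F x in at t. x \<in> {0<..<T}" by (simp add: eventually_at_filter eventually_mono)
      have "((\<lambda>a. dt_E a (q a)) \<longlongrightarrow> dt_E t (q t)) (at t)"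
        using 3 t ev by (intro dt_E_tendsto continuous_time_isCont) (auto elim!: eventually_mono)
      then have "(G \<longlongrightarrow> dt_E t (q t)) (at t)"
        by (rule Lim_transform_eventually) (use ev in \<open>auto elim!: eventually_mono simp: G_def\<close>)
      then show ?thesis using 3 by (simp add: isCont_def G_def)
    qed
  qed
  then have "continuous_on (- ?X) G" by (intro continuous_at_imp_continuous_on) auto
  moreover have "countable ?X" using countable_discontinuities by simp
  ultimately have "G \<in> borel_measurable borel" by (rule borel_measurable_continuous_countable_exceptions[rotated])
  then have G: "G \<in> borel_measurable lebesgue" by (simp add: measurable_completion)
  obtain B where B: "\<And>t. 0 \<le> t \<and> t \<le> T \<Longrightarrow> \<bar>dt_E t (q t)\<bar> \<le> B" using dt_E_bounded by blast
  have "integrable lebesgue (\<lambda>t. indicator {a..b} t *\<^sub>R G t)"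
  proof (rule integrableI_bounded_set_indicator[OF _ G])
    have "norm (G t) \<le> \<bar>B\<bar>" for t using B[of t] by (auto simp: G_def)
    then show "AE t in lebesgue. t \<in> {a..b} \<longrightarrow> norm (G t) \<le> \<bar>B\<bar>" by simp
    show "emeasure lebesgue {a..b} < \<infinity>" by (cases "a \<le> b") auto
  qed simp
  moreover have "(\<lambda>t. indicator {a..b} t *\<^sub>R G t) = (\<lambda>t. indicator {a..b} t *\<^sub>R dt_E t (q t))"
    using assms by (auto simp: G_def indicator_def)
  ultimately show ?thesis unfolding set_integrable_def by simp
qed

end

section \<open>The variation measure\<close>

lemma nn_integral_count_space_le_infsum:
  fixes f :: "'a \<Rightarrow> ennreal"
  assumes A: "countable A"
  shows "(\<integral>\<^sup>+x. f x \<partial>count_space A) \<le> infsum f A"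
proof (cases "finite A")
  case True
  then show ?thesis by (simp add: nn_integral_count_space_finite)
next
  case False
  have bij: "bij_betw (from_nat_into A) UNIV A" by (rule bij_betw_from_nat_into[OF A False])
  have "(\<integral>\<^sup>+x. f x \<partial>count_space A) = (\<Sum>n. f (from_nat_into A n))"
    using nn_integral_bij_count_space[OF bij, of f] by (simp add: nn_integral_count_space_nat)
  also have "\<dots> = (SUP n. \<Sum>i<n. f (from_nat_into A i))" by (rule suminf_eq_SUP)
  also have "\<dots> \<le> infsum f A"
  proof (rule SUP_least)
    fix n
    have "(\<Sum>i<n. f (from_nat_into A i)) = sum f (from_nat_into A ` {..<n})"
      using bij by (subst sum.reindex) (auto simp: bij_betw_def intro: inj_on_subset)
    also have "\<dots> \<le> (SUP F\<in>{F. finite F \<and> F \<subseteq> A}. sum f F)"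
      using bij by (intro SUP_upper) (auto simp: bij_betw_def)
    also have "\<dots> = infsum f A" by (rule nonneg_infsum_complete[symmetric]) simp
    finally show "(\<Sum>i<n. f (from_nat_into A i)) \<le> infsum f A" .
  qed
  finally show ?thesis .
qed

text \<open>The complement of the support is a countable union of null sets from a countable basis.\<close>

lemma AE_in_measure_support:
  fixes M :: "real measure"
  assumes sets: "sets M = sets borel"
  shows "AE x in M. x \<in> measure_support M"
proof -
  obtain B :: "real set set" where B: "countable B" "topological_basis B" using ex_countable_basis by blast
  let ?N = "\<Union>{b \<in> B. emeasure M b = 0}"
  have "?N \<in> null_sets M"
  proof -
    have "(\<Union>b\<in>{b \<in> B. emeasure M b = 0}. b) \<in> null_sets M"
    proof (rule null_sets_UN')
      show "countable {b \<in> B. emeasure M b = 0}" using B(1) by (rule countable_subset[rotated]) auto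
      fix b assume "b \<in> {b \<in> B. emeasure M b = 0}"
      then show "b \<in> null_sets M" using topological_basis_open[OF B(2)] sets by (auto simp: null_sets_def)
    qed
    then show ?thesis by simp
  qed
  moreover have "{x \<in> space M. x \<notin> measure_support M} \<subseteq> ?N"
  proof
    fix x assume "x \<in> {x \<in> space M. x \<notin> measure_support M}"
    then obtain U where U: "open U" "x \<in> U" "emeasure M U = 0"
      by (auto simp: measure_support_def)
    obtain b where b: "b \<in> B" "x \<in> b" "b \<subseteq> U" using topological_basisE[OF B(2) U(1,2)] by blast
    have "emeasure M b \<le> emeasure M U" using b U sets by (intro emeasure_mono) auto
    then show "x \<in> ?N" using b U by auto
  qed
  ultimately show ?thesis by (rule AE_I')
qed

context bounded_variation_curve
begin

lemma var_measure_eq: "var_measure q = interval_measure V_right"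
proof -
  have "(if t < 0 then 0 else if t < T then Lim (at_right t) (V q) else V q T) = V_right t" for t
  proof -
    consider "t < 0" | "0 \<le> t" "t < T" | "T \<le> t" by linarith
    then show ?thesis
    proof cases
      case 1
      have "V_right t \<le> V_ext 0" using 1 by (rule V_right_le)
      moreover have "V_ext t \<le> V_right t" by (rule V_ext_le_right)
      ultimately show ?thesis using 1 V_ext_outside(1)[of t] V_ext_outside(1)[of 0] by simp
    next
      case 2
      have "\<forall>\<^sub>F a in at_right t. V_ext a = V q a"
        unfolding eventually_at_right_field using 2 by (intro exI[of _ T]) (auto simp: V_ext_eq)
      then have "(V q \<longlongrightarrow> V_right t) (at_right t)"
        using tendsto_cong V_right_tendsto by blast
      then show ?thesis using 2 by (simp add: tendsto_Lim)
    next
      case 3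
      have "V_right t \<le> V_ext (t + 1)" by (rule V_right_le) simp
      moreover have "V_ext t \<le> V_right t" by (rule V_ext_le_right)
      ultimately show ?thesis using 3 T_pos V_ext_outside(2)[of t] V_ext_outside(2)[of "t+1"] by simp
    qed
  qed
  then show ?thesis unfolding var_measure_def by simp
qed

lemma sets_var_measure [measurable_cong, simp]: "sets (var_measure q) = sets borel"
  by (simp add: var_measure_def)

lemma var_measure_Ioc: "a \<le> b \<Longrightarrow> emeasure (var_measure q) {a<..b} = ennreal (V_right b - V_right a)"
  unfolding var_measure_eq
  by (rule emeasure_interval_measure_Ioc[OF _ V_right_mono V_right_right_continuous])

lemma var_measure_Ioo:
  assumes "r < s"
  shows "ennreal (V_left s - V_right r) \<le> emeasure (var_measure q) {r<..<s}"
proof -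
  have "emeasure (var_measure q) {r<..<s} \<le> emeasure (var_measure q) {r<..s}"
    by (intro emeasure_mono) auto
  also have "\<dots> < \<infinity>" using assms by (simp add: var_measure_Ioc)
  finally obtain m where m: "emeasure (var_measure q) {r<..<s} = ennreal m" "m \<ge> 0"
    by (cases "emeasure (var_measure q) {r<..<s}") auto
  have "V_left s - V_right r \<le> m"
  proof (rule tendsto_upperbound[of "\<lambda>a. V_ext a - V_right r" _ "at_left s"])
    show "((\<lambda>a. V_ext a - V_right r) \<longlongrightarrow> V_left s - V_right r) (at_left s)" by (intro tendsto_intros V_left_tendsto)
    show "\<forall>\<^sub>F a in at_left s. V_ext a - V_right r \<le> m"
      unfolding eventually_at_left_field
    proof (intro exI[of _ r] conjI allI impI assms)
      fix a assume a: "r < a" "a < s"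
      have "ennreal (V_right a - V_right r) = emeasure (var_measure q) {r<..a}" using a by (simp add: var_measure_Ioc)
      also have "\<dots> \<le> emeasure (var_measure q) {r<..<s}" using a by (intro emeasure_mono) auto
      finally have "V_right a - V_right r \<le> m" using m by simp
      then show "V_ext a - V_right r \<le> m" using V_ext_le_right[of a] by linarith
    qed
  qed simp
  then show ?thesis unfolding m(1) by (rule ennreal_leI)
qed

lemma var_measure_atom:
  "emeasure (var_measure q) {t} \<le> ennreal (V_right t - V_left t)"
proof -
  have le: "emeasure (var_measure q) {t} \<le> ennreal (V_right t - V_ext a)" if "a < t" for a
  proof -
    have "emeasure (var_measure q) {t} \<le> emeasure (var_measure q) {a<..t}"
      using that by (intro emeasure_mono) auto
    also have "\<dots> \<le> ennreal (V_right t - V_ext a)"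
      using that V_ext_le_right[of a] by (simp add: var_measure_Ioc ennreal_leI)
    finally show ?thesis .
  qed
  have "emeasure (var_measure q) {t} < \<infinity>" using le[of "t - 1"] by (simp add: le_less_trans)
  then obtain m where m: "emeasure (var_measure q) {t} = ennreal m" "m \<ge> 0"
    by (cases "emeasure (var_measure q) {t}") auto
  have "m \<le> V_right t - V_left t"
  proof (rule tendsto_lowerbound[of "\<lambda>a. V_right t - V_ext a" _ "at_left t"])
    show "((\<lambda>a. V_right t - V_ext a) \<longlongrightarrow> V_right t - V_left t) (at_left t)" by (intro tendsto_intros V_left_tendsto)
    show "\<forall>\<^sub>F a in at_left t. m \<le> V_right t - V_ext a"
      unfolding eventually_at_left_field
    proof (intro exI[of _ "t - 1"] conjI allI impI)
      fix a assume a: "t - 1 < a" "a < t"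
      have "0 \<le> V_right t - V_ext a" using V_right_le V_ext_le_right[of t] V_ext_mono[of a t] a by linarith
      then show "m \<le> V_right t - V_ext a" using le[OF a(2)] m by simp
    qed simp
  qed simp
  then show ?thesis unfolding m(1) by (rule ennreal_leI)
qed

section \<open>Energetic and BV solutions are local solutions\<close>

lemma energetic_imp_local:
  assumes q: "energetic_solution q"
  shows "local_solution q"
  unfolding local_solution_def
proof (intro conjI allI impI)
  have S: "E t (q t) \<le> E t p + d (q t) p"
    and En: "ereal (E t (q t)) + Var q {0..t} = ereal (E 0 (q 0) + (LINT s:{0..t}|lebesgue. dt_E s (q s)))"
    if "0 \<le> t" "t \<le> T" for t p
    using q that unfolding energetic_solution_def by auto
  show "AE t in lebesgue. t \<in> {0..T} \<longrightarrow> slope t (q t) \<le> 1"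
    by (rule AE_I2) (use S in \<open>auto intro!: stable_imp_slope_le_1\<close>)
  fix r s assume rs: "0 \<le> r" "r < s" "s \<le> T"
  have split: "(LINT t:{0..s}|lebesgue. dt_E t (q t)) =
     (LINT t:{0..r}|lebesgue. dt_E t (q t)) + (LINT t:{r..s}|lebesgue. dt_E t (q t))"
  proof -
    have "AE t in lebesgue. t \<noteq> r" by (rule AE_completion) (rule AE_lborel_singleton)
    then have ae: "AE t in lebesgue. \<not> (t \<in> {0..r} \<and> t \<in> {r..s})" by eventually_elim auto
    have "{0..s} = {0..r} \<union> {r..s}" using rs by auto
    then show ?thesis
      using set_integral_Un_AE[OF ae _ _ dt_E_integrable dt_E_integrable] rs by simp
  qed
  have "E s (q s) + V q s = E 0 (q 0) + (LINT t:{0..s}|lebesgue. dt_E t (q t))"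
    "E r (q r) + V q r = E 0 (q 0) + (LINT t:{0..r}|lebesgue. dt_E t (q t))"
    using En[of s] En[of r] rs Var_eq_V[of s] Var_eq_V[of r] by auto
  then have "E s (q s) + (V q s - V q r) = E r (q r) + (LINT t:{r..s}|lebesgue. dt_E t (q t))"
    using split by linarith
  moreover have "ereal (E s (q s)) + Var q {r..s} \<le> ereal (E s (q s)) + ereal (V q s - V q r)"
    using rs by (intro add_left_mono Var_le_V) auto
  ultimately show "ereal (E s (q s)) + Var q {r..s} \<le> ereal (E r (q r) + (LINT \<tau>:{r..s}|lebesgue. dt_E \<tau> (q \<tau>)))"
    by simp
qed

text \<open>The increment of \<open>V\<close> splits into the two half jumps at the end points and the mass of the open interval, which is
diffuse mass plus atoms; each of these is matched with its term in \<open>Sigma0\<close>.\<close>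

lemma V_increment_le_Sigma0:
  assumes rs: "0 \<le> r" "r < s" "s \<le> T"
    and supp: "\<And>t. t \<in> measure_support (var_measure q) \<Longrightarrow> slope t (q t) \<ge> 1"
    and jumpS: "\<And>t. 0 \<le> t \<Longrightarrow> t \<le> T \<Longrightarrow> ennreal (d (lim_left q t) (q t)) \<le> S0 t (lim_left q t) (q t)
       \<and> ennreal (d (q t) (lim_right q t)) \<le> S0 t (q t) (lim_right q t)"
  shows "ennreal (V q s - V q r) \<le> Sigma0 q r s"
proof -
  let ?\<mu> = "var_measure q"
  define C where "C = cont_points q"
  define J where "J = jump_points q \<inter> {r<..<s}"
  have J: "countable J" unfolding J_def using countable_jump_points by simp
  have Cb: "C \<in> sets borel"
  proof -
    have "C = {0..T} - jump_points q" unfolding C_def jump_points_def cont_points_def by auto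
    moreover have "jump_points q \<in> sets borel" using countable_jump_points by (rule sets.countable[rotated]) auto
    ultimately show ?thesis by auto
  qed
  have diffuse: "emeasure ?\<mu> (C \<inter> {r<..<s}) \<le> (\<integral>\<^sup>+t\<in>{r..s}. ennreal (slope t (q t)) \<partial>diffuse_var_measure q)"
  proof -
    have ae: "AE t in diffuse_var_measure q. t \<in> measure_support ?\<mu>"
      unfolding diffuse_var_measure_def C_def[symmetric]
      using Cb AE_in_measure_support[of ?\<mu>] by (subst AE_density) (auto elim!: eventually_mono)
    have "emeasure ?\<mu> (C \<inter> {r<..<s}) = (\<integral>\<^sup>+t. indicator C t * indicator {r<..<s} t \<partial>?\<mu>)"
      unfolding indicator_inter_arith[symmetric] using Cb by (intro nn_integral_indicator[symmetric]) auto
    also have "\<dots> = (\<integral>\<^sup>+t. indicator {r<..<s} t \<partial>diffuse_var_measure q)"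
      unfolding diffuse_var_measure_def C_def[symmetric] using Cb by (intro nn_integral_density[symmetric]) auto
    also have "\<dots> \<le> (\<integral>\<^sup>+t\<in>{r..s}. ennreal (slope t (q t)) \<partial>diffuse_var_measure q)"
    proof (rule nn_integral_mono_AE)
      show "AE t in diffuse_var_measure q. indicator {r<..<s} t \<le> ennreal (slope t (q t)) * indicator {r..s} t"
        using ae
      proof eventually_elim
        case (elim t)
        then have "ennreal 1 \<le> ennreal (slope t (q t))" by (intro ennreal_leI supp)
        then show ?case by (auto simp: indicator_def)
      qed
    qed
    finally show ?thesis .
  qed
  have jumps: "emeasure ?\<mu> J \<le> (\<Sum>\<^sub>\<infinity>t\<in>J. S0 t (lim_left q t) (q t) + S0 t (q t) (lim_right q t))"
  proof -
    have "emeasure ?\<mu> J = (\<integral>\<^sup>+t. emeasure ?\<mu> {t} \<partial>count_space J)"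
      using J by (intro emeasure_countable_singleton) auto
    also have "\<dots> \<le> (\<integral>\<^sup>+t. S0 t (lim_left q t) (q t) + S0 t (q t) (lim_right q t) \<partial>count_space J)"
    proof (rule nn_integral_mono)
      fix t assume "t \<in> space (count_space J)"
      then have t: "0 \<le> t" "t \<le> T" using rs by (auto simp: J_def)
      have "emeasure ?\<mu> {t} \<le> ennreal (d (lim_left q t) (q t) + d (q t) (lim_right q t))"
        using V_right_jump[OF t] V_left_jump[OF t] by (intro order_trans[OF var_measure_atom] ennreal_leI) linarith
      also have "\<dots> = ennreal (d (lim_left q t) (q t)) + ennreal (d (q t) (lim_right q t))"
        by (intro ennreal_plus d_nonneg)
      also have "\<dots> \<le> S0 t (lim_left q t) (q t) + S0 t (q t) (lim_right q t)"
        using jumpS[OF t] by (intro add_mono) auto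
      finally show "emeasure ?\<mu> {t} \<le> S0 t (lim_left q t) (q t) + S0 t (q t) (lim_right q t)" .
    qed
    also have "\<dots> \<le> (\<Sum>\<^sub>\<infinity>t\<in>J. S0 t (lim_left q t) (q t) + S0 t (q t) (lim_right q t))"
      by (rule nn_integral_count_space_le_infsum[OF J])
    finally show ?thesis .
  qed
  have "ennreal (V_left s - V_right r) \<le> emeasure ?\<mu> {r<..<s}" by (rule var_measure_Ioo[OF rs(2)])
  also have "{r<..<s} = (C \<inter> {r<..<s}) \<union> J"
    using rs by (auto simp: C_def J_def jump_points_def)
  also have "emeasure ?\<mu> \<dots> \<le> emeasure ?\<mu> (C \<inter> {r<..<s}) + emeasure ?\<mu> J"
    using Cb J by (intro emeasure_subadditive) (auto intro: sets.countable)
  finally have mid: "ennreal (V_left s - V_right r) \<le> emeasure ?\<mu> (C \<inter> {r<..<s}) + emeasure ?\<mu> J" .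
  have vlr: "V_right r \<le> V_left s" using V_right_le[of r "(r+s)/2"] V_left_ge[of "(r+s)/2" s] rs by auto
  have "V q s - V q r \<le> (V_left s - V_right r) + d (q r) (lim_right q r) + d (lim_left q s) (q s)"
    using V_right_jump[of r] V_left_jump[of s] rs V_ext_eq[of r] V_ext_eq[of s] by simp
  then have "ennreal (V q s - V q r) \<le> ennreal ((V_left s - V_right r) + d (q r) (lim_right q r) + d (lim_left q s) (q s))"
    by (rule ennreal_leI)
  also have "\<dots> = ennreal (V_left s - V_right r) + ennreal (d (q r) (lim_right q r)) + ennreal (d (lim_left q s) (q s))"
    using vlr by (simp add: ennreal_plus d_nonneg)
  also have "\<dots> \<le> (emeasure ?\<mu> (C \<inter> {r<..<s}) + emeasure ?\<mu> J)
      + S0 r (q r) (lim_right q r) + S0 s (lim_left q s) (q s)"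
    using mid jumpS[of r] jumpS[of s] rs by (intro add_mono) auto
  also have "\<dots> \<le> ((\<integral>\<^sup>+t\<in>{r..s}. ennreal (slope t (q t)) \<partial>diffuse_var_measure q)
      + (\<Sum>\<^sub>\<infinity>t\<in>J. S0 t (lim_left q t) (q t) + S0 t (q t) (lim_right q t)))
      + S0 r (q r) (lim_right q r) + S0 s (lim_left q s) (q s)"
    by (intro add_mono diffuse jumps order_refl)
  also have "\<dots> = Sigma0 q r s" unfolding Sigma0_def J_def by (simp add: add_ac)
  finally show ?thesis .
qed

lemma BV_imp_local:
  assumes q: "BV_solution q"
  shows "local_solution q"
proof -
  have up: "ereal (E s (q s) - E r (q r) - (LINT t:{r..s}|lebesgue. dt_E t (q t))) \<le> - enn2ereal (Sigma0 q r s)"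
    if "0 \<le> r" "r < s" "s \<le> T" for r s
    using q that unfolding BV_solution_def by blast
  have sl: "slope t (q t) \<le> 1" if "t \<in> {0..T} - jump_points q" for t
    using q that unfolding BV_solution_def by blast
  have supp: "slope t (q t) \<ge> 1" if "t \<in> measure_support (var_measure q)" for t
    using q that unfolding BV_solution_def by blast
  have jumpS: "ennreal (d (lim_left q t) (q t)) \<le> S0 t (lim_left q t) (q t)
       \<and> ennreal (d (q t) (lim_right q t)) \<le> S0 t (q t) (lim_right q t)" if t: "0 \<le> t" "t \<le> T" for t
  proof (cases "t \<in> jump_points q")
    case False
    then have "lim_left q t = q t" "lim_right q t = q t" using t by (auto simp: jump_points_def cont_points_def)
    then show ?thesis by (simp add: d_refl)
  next
    case True
    then obtain y \<theta> where y: "y \<in> admissible (lim_left q t) (lim_right q t)" "\<theta> \<in> {0..1}" "y \<theta> = q t"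
      "\<forall>\<theta>'\<in>{0..1}. slope t (y \<theta>') \<ge> 1"
      "ereal (E t (lim_right q t) - E t (lim_left q t)) = - enn2ereal (slope_length t y)"
      using q unfolding BV_solution_def by blast
    have t': "t \<in> {0..T}" using t by simp
    have th: "0 \<le> \<theta>" "\<theta> \<le> 1" using y(2) by auto
    have ge: "1 \<le> slope t (y s)" if "0 \<le> s" "s \<le> 1" for s using y(4) that by auto
    note halves = d_le_slope_length_halves[OF t' y(1) th ge y(5), unfolded y(3)]
    show ?thesis
      using halves energy_drop_le_S0[OF t', of "lim_left q t" "q t"] energy_drop_le_S0[OF t', of "q t" "lim_right q t"]
      by (meson ennreal_leI order_trans)
  qed
  show ?thesis
    unfolding local_solution_def
  proof (intro conjI allI impI)
    have "jump_points q \<in> null_sets lebesgue"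
      using countable_jump_points by (intro null_sets_completionI countable_imp_null_set_lborel)
    then have "AE t in lebesgue. t \<notin> jump_points q" by (rule AE_not_in)
    then show "AE t in lebesgue. t \<in> {0..T} \<longrightarrow> slope t (q t) \<le> 1"
      by eventually_elim (use sl in auto)
    fix r s assume rs: "0 \<le> r" "r < s" "s \<le> T"
    let ?I = "LINT t:{r..s}|lebesgue. dt_E t (q t)"
    have "ennreal (V q s - V q r) \<le> Sigma0 q r s"
      by (rule V_increment_le_Sigma0[OF rs supp jumpS])
    then have "enn2ereal (ennreal (V q s - V q r)) \<le> enn2ereal (Sigma0 q r s)"
      by (simp add: less_eq_ennreal.rep_eq)
    then have "ereal (V q s - V q r) \<le> enn2ereal (Sigma0 q r s)"
      using V_mono[of r s] rs by (simp add: enn2ereal_ennreal)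
    then have "- enn2ereal (Sigma0 q r s) \<le> - ereal (V q s - V q r)"
      by (simp only: ereal_minus_le_minus)
    with up[OF rs] have "ereal (E s (q s) - E r (q r) - ?I) \<le> - ereal (V q s - V q r)"
      by (rule order_trans)
    then have "E s (q s) + (V q s - V q r) \<le> E r (q r) + ?I" by simp
    moreover have "ereal (E s (q s)) + Var q {r..s} \<le> ereal (E s (q s)) + ereal (V q s - V q r)"
      using rs by (intro add_left_mono Var_le_V) auto
    ultimately show "ereal (E s (q s)) + Var q {r..s} \<le> ereal (E r (q r) + (LINT \<tau>:{r..s}|lebesgue. dt_E \<tau> (q \<tau>)))"
      by (auto intro: order_trans)
  qed
qed

end

context rate_independent_system
begin

lemma bounded_variation_curveI:
  "Var q {0..T} < \<infinity> \<Longrightarrow> bounded_variation_curve atlas R1 T E q"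
  by unfold_locales

lemma energetic_solution_imp_local_solution:
  assumes q: "energetic_solution q"
  shows "local_solution q"
proof -
  have "ereal (E T (q T)) + Var q {0..T} = ereal (E 0 (q 0) + (LINT s:{0..T}|lebesgue. dt_E s (q s)))"
    using q T_pos unfolding energetic_solution_def by auto
  then have "Var q {0..T} < \<infinity>" by (cases "Var q {0..T}") auto
  then show ?thesis
    using bounded_variation_curve.energetic_imp_local[OF bounded_variation_curveI] q by blast
qed

lemma BV_solution_imp_local_solution:
  assumes q: "BV_solution q"
  shows "local_solution q"
proof -
  have "Var q {0..T} < \<infinity>" using q unfolding BV_solution_def BV_def by blast
  then show ?thesis
    using bounded_variation_curve.BV_imp_local[OF bounded_variation_curveI] q by blast
qed

end

theorem mainTheorem5:
  fixes atlas :: "('q::{t2_space, second_countable_topology}, 'e::euclidean_space) chart set"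
    and R1 :: "'q \<Rightarrow> ('q, 'e) tangent \<Rightarrow> real"
    and T :: real
    and E :: "real \<Rightarrow> 'q \<Rightarrow> real"
  assumes "rate_independent_system atlas R1 T E"
  shows "(\<forall>q. rate_independent_system.energetic_solution atlas R1 T E q \<longrightarrow>
              rate_independent_system.local_solution atlas R1 T E q) \<and>
         (\<forall>q. rate_independent_system.BV_solution atlas R1 T E q \<longrightarrow>
              rate_independent_system.local_solution atlas R1 T E q)"
  using rate_independent_system.energetic_solution_imp_local_solution[OF assms]
    rate_independent_system.BV_solution_imp_local_solution[OF assms] by blast

end
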